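(* Let $d\ge 4$ be an integer and let $w\in[0,1)$. Then the $4$-state anti-ferromagnetic Potts model with interaction parameter $w$ on the infinite $(d+1)$-regular tree $\mathbb{T}_d$ has a unique Gibbs measure if and only if $w\geq 1-\frac{4}{d+1}$.
   Context: Let $q\ge 2$ be an integer (the number of states), $[q]=\{1,\dots,q\}$, and $w\ge 0$ (the interaction parameter; the model is anti-ferromagnetic if $w<1$). For a finite graph $H$ and a configuration $\sigma:V(H)\to[q]$, the weight of $\sigma$ is $w^{m(\sigma)}$, where $m(\sigma)$ is the number of monochromatic edges of $H$ under $\sigma$ (with $0^0=1$; when $w=0$ one implicitly assumes that some configuration under consideration has non-zero weight). Let $\mathbb{T}_d$ be the infinite $(d+1)$-regular tree with vertex set $V_d$, and let $\Omega_{q,d}$ be the set of all maps $\psi:V_d\to[q]$, equipped with the sigma algebra generated by the sets $\{\psi\in\Omega_{q,d}: \psi\restriction_U=\phi\}$ with $U\subset V_d$ finite and $\phi:U\to[q]$. For $U\subset V_d$, let $\partial U$ be the set of vertices of $U$ adjacent to some vertex of $V_d\setminus U$, and $U^\circ=U\setminus\partial U$. A probability measure $\mu$ on $\Omega_{q,d}$ is a Gibbs measure (for the $q$-state Potts model with parameter $w$) if for every finite $U\subset V_d$ and $\mu$-almost every $\phi\in\Omega_{q,d}$, $$\mathbb{P}_{\mathbf{\Phi}\sim\mu}[\mathbf{\Phi}\restriction_U=\phi\restriction_U \mid \mathbf{\Phi}\restriction_{V_d\setminus U^\circ}=\phi\restriction_{V_d\setminus U^\circ}]=\mathbb{P}_U[\mathbf{\Phi}\restriction_U=\phi\restriction_U\mid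 \mathbf{\Phi}\restriction_{\partial U}=\phi\restriction_{\partial U}],$$ where the left-hand side is understood via conditional expectation, and the right-hand side is the weight of $\phi\restriction_U$ on the finite induced graph $\mathbb{T}_d[U]$ divided by the sum of the weights of all colorings $U\to[q]$ that agree with $\phi$ on $\partial U$. *)

theory Defs
  imports "HOL-Probability.Probability"
begin

section \<open>Regular trees\<close>

text \<open>Graphs are given by a vertex set and a set of edges, each edge being a two-element set
  of vertices.\<close>

definition simple_graph :: "'v set \<Rightarrow> 'v set set \<Rightarrow> bool" where
  "simple_graph V E \<longleftrightarrow> (\<forall>e\<in>E. e \<subseteq> V \<and> card e = 2)"

definition is_walk :: "'v set \<Rightarrow> 'v set set \<Rightarrow> 'v list \<Rightarrow> bool" where
  "is_walk V E p \<longleftrightarrow> p \<noteq> [] \<and> set p \<subseteq> V \<and> successively (\<lambda>u v. {u, v} \<in> E) p"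

definition is_cycle :: "'v set \<Rightarrow> 'v set set \<Rightarrow> 'v list \<Rightarrow> bool" where
  "is_cycle V E p \<longleftrightarrow>
     is_walk V E p \<and> distinct p \<and> 3 \<le> length p \<and> {last p, hd p} \<in> E"

definition connected_graph :: "'v set \<Rightarrow> 'v set set \<Rightarrow> bool" where
  "connected_graph V E \<longleftrightarrow> V \<noteq> {} \<and> (\<forall>u\<in>V. \<forall>v\<in>V. \<exists>p. is_walk V E p \<and> hd p = u \<and> last p = v)"

definition is_tree :: "'v set \<Rightarrow> 'v set set \<Rightarrow> bool" where
  "is_tree V E \<longleftrightarrow> simple_graph V E \<and> connected_graph V E \<and> (\<nexists>p. is_cycle V E p)"

definition infinite_regular_tree :: "nat \<Rightarrow> 'v set \<Rightarrow> 'v set set \<Rightarrow> bool" where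
  "infinite_regular_tree k V E \<longleftrightarrow>
     is_tree V E \<and> infinite V \<and>
     (\<forall>v\<in>V. finite {u \<in> V. {u, v} \<in> E} \<and> card {u \<in> V. {u, v} \<in> E} = k)"

definition inner_boundary :: "'v set \<Rightarrow> 'v set set \<Rightarrow> 'v set \<Rightarrow> 'v set" where
  "inner_boundary V E U = {u \<in> U. \<exists>v \<in> V - U. {u, v} \<in> E}"

definition graph_interior :: "'v set \<Rightarrow> 'v set set \<Rightarrow> 'v set \<Rightarrow> 'v set" where
  "graph_interior V E U = U - inner_boundary V E U"

section \<open>The Potts model\<close>

definition monochromatic_edges :: "'v set set \<Rightarrow> 'v set \<Rightarrow> ('v \<Rightarrow> nat) \<Rightarrow> 'v set set" where
  "monochromatic_edges E U \<sigma> = {e \<in> E. e \<subseteq> U \<and> (\<forall>u\<in>e. \<forall>v\<in>e. \<sigma> u = \<sigma> v)}"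

text \<open>The weight of \<open>\<sigma>\<close> on the subgraph induced by the finite set \<open>U\<close>; note that \<open>0 ^ 0 = 1\<close>.\<close>

definition potts_weight :: "real \<Rightarrow> 'v set set \<Rightarrow> 'v set \<Rightarrow> ('v \<Rightarrow> nat) \<Rightarrow> real" where
  "potts_weight w E U \<sigma> = w ^ card (monochromatic_edges E U \<sigma>)"

text \<open>The finite-volume probability of \<open>\<phi>\<close> restricted to \<open>U\<close>, given its values on the inner
  boundary. The denominator can only vanish if \<open>w = 0\<close>, when the values on the boundary
  cannot be completed to a proper colouring of \<open>U\<close>. The quotient is then \<open>0\<close> by
  the convention for division. This admits no additional Gibbs measures: below, the conditional
  probability it is compared with is positive for almost every \<open>\<phi>\<close>.\<close>

definition potts_boundary_prob ::
    "nat \<Rightarrow> real \<Rightarrow> 'v set \<Rightarrow> 'v set set \<Rightarrow> 'v set \<Rightarrow> ('v \<Rightarrow> nat) \<Rightarrow> real" where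
  "potts_boundary_prob q w V E U \<phi> =
     potts_weight w E U \<phi> /
     (\<Sum>\<sigma> \<in> {\<sigma> \<in> U \<rightarrow>\<^sub>E {1..q}. \<forall>v \<in> inner_boundary V E U. \<sigma> v = \<phi> v}. potts_weight w E U \<sigma>)"

text \<open>The product \<open>\<sigma>\<close>-algebra on the set of maps from \<open>V\<close> to \<open>{1..q}\<close>. Only the space and the
  measurable sets matter here.\<close>

definition config_space :: "nat \<Rightarrow> 'v set \<Rightarrow> ('v \<Rightarrow> nat) measure" where
  "config_space q V = PiM V (\<lambda>_. count_space {1..q})"

lemma space_config_space: "space (config_space q V) = V \<rightarrow>\<^sub>E {1..q}"
  by (simp add: config_space_def space_PiM)

lemma sets_config_space:
  "sets (config_space q V) =
     sigma_sets (V \<rightarrow>\<^sub>E {1..q})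
       {{\<psi> \<in> V \<rightarrow>\<^sub>E {1..q}. restrict \<psi> U = \<phi>} | U \<phi>. finite U \<and> U \<subseteq> V \<and> \<phi> \<in> U \<rightarrow>\<^sub>E {1..q}}"
    (is "_ = sigma_sets ?\<Omega> ?C")
proof
  have C: "{\<psi> \<in> ?\<Omega>. restrict \<psi> U = \<phi>} \<in> ?C"
    if "finite U" "U \<subseteq> V" "\<phi> \<in> U \<rightarrow>\<^sub>E {1..q}" for U \<phi>
    using that by blast
  have "{f \<in> ?\<Omega>. f i \<in> A} \<in> sigma_sets ?\<Omega> ?C" if i: "i \<in> V" and A: "A \<subseteq> {1..q}" for i A
  proof -
    have eq: "{f \<in> ?\<Omega>. f i \<in> A} =
        (\<Union>a\<in>A. {\<psi> \<in> ?\<Omega>. restrict \<psi> {i} = restrict (\<lambda>_. a) {i}})"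
      by (auto simp: restrict_def fun_eq_iff split: if_splits)
    have "finite A"
      using A finite_subset by blast
    moreover have "{\<psi> \<in> ?\<Omega>. restrict \<psi> {i} = restrict (\<lambda>_. a) {i}} \<in> sigma_sets ?\<Omega> ?C"
      if "a \<in> A" for a
      using that i A by (intro sigma_sets.Basic C) auto
    moreover have "sigma_algebra ?\<Omega> (sigma_sets ?\<Omega> ?C)"
      by (rule sigma_algebra_sigma_sets) auto
    ultimately show ?thesis
      unfolding eq by (metis (no_types, lifting) sigma_algebra.axioms(1) algebra.axioms(1) ring_of_sets.finite_UN)
  qed
  then show "sets (config_space q V) \<subseteq> sigma_sets ?\<Omega> ?C"
    unfolding config_space_def sets_PiM_single space_count_space sets_count_space
    by (intro sigma_sets_mono subsetI) auto
next
  have "?C \<subseteq> sets (config_space q V)"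
  proof safe
    fix U \<phi> assume U: "finite U" "U \<subseteq> V" and \<phi>: "\<phi> \<in> U \<rightarrow>\<^sub>E {1..q}"
    have "{\<psi> \<in> ?\<Omega>. restrict \<psi> U = \<phi>} = {\<psi> \<in> space (config_space q V). \<forall>u\<in>U. \<psi> u = \<phi> u}"
      using \<phi> by (auto simp: space_config_space fun_eq_iff PiE_def extensional_def)
    also have "\<dots> \<in> sets (config_space q V)"
    proof (intro sets.sets_Collect_finite_All U(1))
      fix u assume "u \<in> U"
      then have "(\<lambda>\<psi>. \<psi> u) \<in> config_space q V \<rightarrow>\<^sub>M count_space {1..q}"
        using U unfolding config_space_def by (intro measurable_component_singleton) auto
      from measurable_sets[OF this, of "{\<phi> u}"] PiE_mem[OF \<phi> \<open>u \<in> U\<close>]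
      show "{\<psi> \<in> space (config_space q V). \<psi> u = \<phi> u} \<in> sets (config_space q V)"
        by (auto simp: vimage_def Int_def conj_commute)
    qed
    finally show "{\<psi> \<in> ?\<Omega>. restrict \<psi> U = \<phi>} \<in> sets (config_space q V)" .
  qed
  then show "sigma_sets ?\<Omega> ?C \<subseteq> sets (config_space q V)"
    using sets.sigma_sets_subset[of ?C "config_space q V"] by (simp add: space_config_space)
qed

text \<open>The \<open>\<sigma>\<close>-algebra on the configurations on \<open>V\<close> generated by their restriction to \<open>W\<close>.\<close>

definition restriction_algebra :: "nat \<Rightarrow> 'v set \<Rightarrow> 'v set \<Rightarrow> ('v \<Rightarrow> nat) measure" where
  "restriction_algebra q V W =
     vimage_algebra (V \<rightarrow>\<^sub>E {1..q}) (\<lambda>\<psi>. restrict \<psi> W) (config_space q W)"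

lemma subalgebra_restriction_algebra:
  assumes "sets \<mu> = sets (config_space q V)" "W \<subseteq> V"
  shows "subalgebra \<mu> (restriction_algebra q V W)"
proof -
  have sp: "space \<mu> = V \<rightarrow>\<^sub>E {1..q}"
    using sets_eq_imp_space_eq[OF assms(1)] by (simp add: space_config_space)
  have "(\<lambda>\<psi>. restrict \<psi> W) \<in> config_space q V \<rightarrow>\<^sub>M config_space q W"
    unfolding config_space_def using assms(2) by (rule measurable_restrict_subset)
  then have m: "(\<lambda>\<psi>. restrict \<psi> W) \<in> \<mu> \<rightarrow>\<^sub>M config_space q W"
    using assms(1) measurable_cong_sets by blast
  then have "(\<lambda>\<psi>. restrict \<psi> W) \<in> space \<mu> \<rightarrow> space (config_space q W)"
    by (rule measurable_space[THEN funcsetI])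
  then have "sets (vimage_algebra (space \<mu>) (\<lambda>\<psi>. restrict \<psi> W) (config_space q W)) \<subseteq> sets \<mu>"
    using measurable_sets[OF m] by (auto simp: sets_vimage_algebra2)
  then show ?thesis
    by (simp add: subalgebra_def restriction_algebra_def sp)
qed

definition potts_gibbs_measure ::
    "nat \<Rightarrow> real \<Rightarrow> 'v set \<Rightarrow> 'v set set \<Rightarrow> ('v \<Rightarrow> nat) measure \<Rightarrow> bool" where
  "potts_gibbs_measure q w V E \<mu> \<longleftrightarrow>
     prob_space \<mu> \<and> sets \<mu> = sets (config_space q V) \<and>
     (\<forall>U. finite U \<and> U \<subseteq> V \<longrightarrow>
       (AE \<phi> in \<mu>.
         real_cond_exp \<mu> (restriction_algebra q V (V - graph_interior V E U))
           (indicator {\<psi> \<in> space \<mu>. restrict \<psi> U = restrict \<phi> U}) \<phi>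
         = potts_boundary_prob q w V E U \<phi>))"

end

theory Submission
  imports Defs
begin

text \<open>Delete the root of the tree; each remaining branch is described by its message, the vector of
  partition functions of the branch given the colour of its top vertex. A message is a product over
  the children of affine functions of their messages.

  Uniqueness: let \<open>s\<close> bound the quotients \<open>(x a - x b) / (x a + x b)\<close> of the grandchildren's
  messages. On the logarithmic scale the messages of the children lie in a convex set, for which one
  has a linear inequality valid for all of them, hence also after summing over the children. Maximising
  the next quotient under this single inequality gives the bound \<open>s - s\<^sup>3 / 100\<close>, for all \<open>w\<close> down to
  the critical value. Starting from \<open>s = 1\<close> (arbitrary boundary colours) the quotients tend to \<open>0\<close>,
  so all Gibbs measures have the same marginals on balls.

  Existence and non-uniqueness: a positive vector field reproduced by the message recursion up to
  scaling yields a Gibbs measure by Kolmogorov extension. The constant field always works. Below the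
  critical value the recursion restricted to messages \<open>(t, 1, 1, 1)\<close> has derivative less than \<open>-1\<close>
  at \<open>t = 1\<close>, so it has a cycle of length two, which gives a second measure.\<close>

section \<open>Real inequalities\<close>

text \<open>At the critical value the message recursion along \<open>(t, 1, 1, 1)\<close> has
  derivative exactly -1 at \<open>t = 1\<close>. The linear part alone then gives no contraction,
  and the decrease must come from third-order terms; hence the multiple of \<open>s ^ 3\<close>. The
  scale is natural because \<open>artanh\<close> of the quotient is half the log ratio, log ratios
  add up over children, and convexity of \<open>artanh\<close> turns bounds on them into linear
  ones. Two steps are treated together because the extreme ratio of a child's message does not tell
  where the other two colours lie. The linear inequality retains this as a parameter
  \<open>m\<close>, which enters the denominator of the next quotient. The degree appears as
  \<open>\<delta> = 1 / d\<close>, and \<open>\<delta> = 1/4\<close> is the decisive case. A further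
  obstacle lies in the definition of a Gibbs measure: at a configuration it prescribes only the
  conditional probability of that configuration's own restriction. This yields upper bounds for
  cylinder probabilities; equality is recovered from total mass one.\<close>

lemma convex_on_artanh: "convex_on {0..<1} (artanh :: real \<Rightarrow> real)"
proof (rule convex_on_realI)
  show "connected {0..<1::real}" by simp
  show "(artanh has_real_derivative 1 / (1 - x\<^sup>2)) (at x)" if "x \<in> {0..<1}" for x :: real
    using that by (auto intro!: derivative_eq_intros simp: abs_less_iff)
  show "1 / (1 - x\<^sup>2) \<le> 1 / (1 - y\<^sup>2)" if "x \<in> {0..<1}" "y \<in> {0..<1}" "x \<le> y" for x y :: real
  proof -
    have "x\<^sup>2 \<le> y\<^sup>2" using that by (auto intro: power_mono)
    moreover have "y\<^sup>2 < 1" using that by (simp add: power_less_one_iff abs_square_less_1)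
    ultimately show ?thesis by (intro divide_left_mono) auto
  qed
qed

text \<open>Convexity and \<open>artanh 0 = 0\<close> make \<open>artanh x / x\<close>
  non-decreasing; the product form also covers zero arguments. It linearises log ratios in
  \<open>sorted_child_bound\<close>, and later replaces \<open>1 / d\<close> inside
  \<open>artanh\<close> by 1/4 or 1/2.\<close>

lemma artanh_le_linear:
  fixes x y :: real
  assumes "0 \<le> x" "x \<le> y" "y < 1"
  shows "y * artanh x \<le> x * artanh y"
proof (cases "y = 0")
  case False
  then have y: "0 < y" using assms by linarith
  have "artanh ((1 - x / y) *\<^sub>R 0 + (x / y) *\<^sub>R y) \<le> (1 - x / y) * artanh 0 + x / y * artanh y"
    using assms y by (intro convex_onD[OF convex_on_artanh]) auto
  then have "artanh x \<le> x / y * artanh y" using y by simp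
  then show ?thesis using y by (simp add: field_simps)
qed (use assms in auto)

lemma artanh_mono_real:
  fixes x y :: real
  assumes "- 1 < x" "x \<le> y" "y < 1"
  shows "artanh x \<le> artanh y"
proof -
  have "(1 + x) / (1 - x) \<le> (1 + y) / (1 - y)"
    using assms by (simp add: field_simps)
  then show ?thesis using assms by (simp add: artanh_def)
qed

lemma artanh_nonneg_real: "0 \<le> x \<Longrightarrow> x < 1 \<Longrightarrow> 0 \<le> artanh (x::real)"
  using artanh_mono_real[of 0 x] by simp

text \<open>The passage between log ratios, which add up over children, and the quotients controlled
  by \<open>spread\<close>.\<close>

lemma ln_ratio_eq_artanh:
  fixes a b :: real
  assumes "0 < a" "0 < b"
  shows "ln (a / b) = 2 * artanh ((a - b) / (a + b))"
proof -
  have "(1 + (a - b) / (a + b)) / (1 - (a - b) / (a + b)) = a / b"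
  proof -
    have "1 + (a - b) / (a + b) = 2 * a / (a + b)" "1 - (a - b) / (a + b) = 2 * b / (a + b)"
      using assms by (simp_all add: field_simps)
    then show ?thesis using assms by simp
  qed
  then show ?thesis by (simp add: artanh_def)
qed

text \<open>Enlarging the Taylor coefficient 1/3 to 2/5 absorbs all higher terms on this range. The
  limit 2/5 is the value of \<open>2 * \<delta> / (1 + \<delta>)\<close> at
  \<open>\<delta> = 1/4\<close>, which bounds the argument in
  \<open>rho_bound_small\<close>.\<close>

lemma artanh_le_cubic:
  fixes x :: real
  assumes "0 \<le> x" "x \<le> 2/5"
  shows "artanh x \<le> x + 2/5 * x ^ 3"
proof -
  have "0 + 2/5 * 0 ^ 3 - artanh 0 \<le> x + 2/5 * x ^ 3 - artanh x"
  proof (rule DERIV_nonneg_imp_nondecreasing[OF assms(1)], intro exI conjI)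
    fix t :: real assume t: "0 \<le> t" "t \<le> x"
    then have t2: "t\<^sup>2 \<le> (2/5)\<^sup>2" using assms by (intro power_mono) auto
    show "((\<lambda>t. t + 2/5 * t ^ 3 - artanh t) has_real_derivative
        (1 + 6/5 * t\<^sup>2 - 1 / (1 - t\<^sup>2))) (at t)"
      using t assms by (auto intro!: derivative_eq_intros simp: abs_less_iff)
    have "1 \<le> (1 + 6/5 * t\<^sup>2) * (1 - t\<^sup>2)"
    proof -
      have "0 \<le> t\<^sup>2 * (1/5 - 6/5 * t\<^sup>2)"
        using t2 by (intro mult_nonneg_nonneg) (auto simp: power2_eq_square)
      then show ?thesis by (simp add: algebra_simps)
    qed
    then have "1 / (1 - t\<^sup>2) \<le> 1 + 6/5 * t\<^sup>2"
      using t2 by (subst pos_divide_le_eq) (auto simp: power2_eq_square)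
    then show "0 \<le> 1 + 6/5 * t\<^sup>2 - 1 / (1 - t\<^sup>2)" by simp
  qed
  then show ?thesis by simp
qed

section \<open>Taylor estimates for sinh and cosh\<close>

lemma cosh_2_le: "cosh (2::real) \<le> 4"
proof -
  have "exp (2::real) = exp 1 * exp 1" by (simp flip: exp_add)
  also have "\<dots> \<le> 2.72 * 2.72" using e_less_272 by (intro mult_mono) auto
  finally have "exp (2::real) \<le> 7.5" by simp
  moreover have "exp (- 2::real) \<le> exp 0" by (subst exp_le_cancel_iff) simp
  then have "exp (- 2::real) \<le> 1/2"
  proof -
    have "exp (2::real) \<ge> 1 + 2" by (rule exp_ge_add_one_self)
    then show ?thesis by (simp add: exp_minus field_simps)
  qed
  ultimately show ?thesis by (simp add: cosh_def)
qed

text \<open>The last coefficient is 4 / 9!: the Lagrange remainder contains the ninth derivative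
  \<open>cosh t\<close>, which is at most \<open>cosh 2 \<le> 4\<close>.\<close>

lemma sinh_upper:
  fixes h :: real
  assumes "0 \<le> h" "h \<le> 2"
  shows "sinh h \<le> h + h ^ 3 / 6 + h ^ 5 / 120 + h ^ 7 / 5040 + 4 * h ^ 9 / 362880"
proof -
  define diff where "diff = (\<lambda>n::nat. if even n then (sinh :: real \<Rightarrow> real) else cosh)"
  have "\<forall>m x. DERIV (diff m) x :> diff (Suc m) x"
    by (auto simp: diff_def intro!: derivative_eq_intros)
  moreover have "diff 0 = sinh" by (simp add: diff_def)
  ultimately obtain t where t: "\<bar>t\<bar> \<le> \<bar>h\<bar>"
    and eq: "sinh h = (\<Sum>m<9. (diff m 0 / fact m) * h ^ m) + (diff 9 t / fact 9) * h ^ 9"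
    using Maclaurin_all_le_objl[of diff sinh h 9] by blast
  have sum_eq: "(\<Sum>m<9. f m) = f 0 + f 1 + f 2 + f 3 + f 4 + f 5 + f 6 + f 7 + f 8" for f :: "nat \<Rightarrow> real"
    by (simp add: eval_nat_numeral)
  have "cosh t \<le> cosh 2"
  proof -
    have "cosh t = cosh \<bar>t\<bar>" by (simp add: abs_if)
    also have "\<dots> \<le> cosh 2" using t assms by (subst cosh_real_nonneg_le_iff) auto
    finally show ?thesis .
  qed
  then have "cosh t \<le> 4" using cosh_2_le by simp
  then have "cosh t * h ^ 9 \<le> 4 * h ^ 9" using assms by (intro mult_right_mono) auto
  then show ?thesis
    unfolding eq sum_eq by (simp add: diff_def fact_numeral)
qed

lemma cosh_lower:
  fixes h :: real
  shows "1 + h\<^sup>2 / 2 + h ^ 4 / 24 + h ^ 6 / 720 \<le> cosh h"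
proof -
  define diff where "diff = (\<lambda>n::nat. if even n then (cosh :: real \<Rightarrow> real) else sinh)"
  have "\<forall>m x. DERIV (diff m) x :> diff (Suc m) x"
    by (auto simp: diff_def intro!: derivative_eq_intros)
  moreover have "diff 0 = cosh" by (simp add: diff_def)
  ultimately obtain t where t: "\<bar>t\<bar> \<le> \<bar>h\<bar>"
    and eq: "cosh h = (\<Sum>m<8. (diff m 0 / fact m) * h ^ m) + (diff 8 t / fact 8) * h ^ 8"
    using Maclaurin_all_le_objl[of diff cosh h 8] by blast
  have sum_eq: "(\<Sum>m<8. f m) = f 0 + f 1 + f 2 + f 3 + f 4 + f 5 + f 6 + f 7" for f :: "nat \<Rightarrow> real"
    by (simp add: eval_nat_numeral)
  have "0 \<le> cosh t / fact 8 * h ^ 8"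
    using cosh_real_pos[of t] by (intro mult_nonneg_nonneg) (auto simp: zero_le_even_power)
  then show ?thesis
    unfolding eq sum_eq by (simp add: diff_def fact_numeral)
qed

text \<open>This is \<open>sinh_quotient_le_cosh_exp\<close> at \<open>\<delta> = 1/4\<close> with
  \<open>m\<close> eliminated. As power series in \<open>H = h\<^sup>2\<close> both sides begin with
  2, followed by the linear coefficients 1/3 and 3/8. That margin and the later terms of
  \<open>cosh\<close> pay for the rest while \<open>H \<le> 4\<close>.\<close>

lemma sinh_cosh_quotient_bound:
  fixes h :: real
  assumes "0 < h" "h \<le> 2"
  shows "2 * (sinh h / h) + 5/8 * (sinh h / h - 1)\<^sup>2 \<le> 3/4 * cosh h + 5/4"
proof -
  define H where "H = h\<^sup>2"
  define T where "T = sinh h / h"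
  have H: "0 \<le> H" "H \<le> 4"
    using assms power_mono[of h 2 2] by (auto simp: H_def)
  have "h ^ 4 = H ^ 2" "h ^ 6 = H ^ 3"
    by (simp_all add: H_def flip: power_mult)
  then have cosh: "1 + H / 2 + H ^ 2 / 24 + H ^ 3 / 720 \<le> cosh h"
    using cosh_lower[of h] by (simp add: H_def)
  have "sinh h \<le> h * (1 + H / 6 + H ^ 2 / 120 + H ^ 3 / 5040 + 4 * H ^ 4 / 362880)"
    using sinh_upper[of h] assms by (simp add: H_def eval_nat_numeral algebra_simps)
  then have "T \<le> 1 + H / 6 + H ^ 2 / 120 + H ^ 3 / 5040 + 4 * H ^ 4 / 362880"
    using assms by (simp add: T_def pos_divide_le_eq mult.commute)
  moreover have H2: "H ^ 2 \<le> 4 * H" and H3: "H ^ 3 \<le> 4 * H ^ 2" and H4: "H ^ 4 \<le> 4 * H ^ 3"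
    using mult_right_mono[OF H(2), of H] mult_right_mono[OF H(2), of "H ^ 2"]
      mult_right_mono[OF H(2), of "H ^ 3"] H
    by (auto simp: eval_nat_numeral)
  moreover have H3_nonneg: "0 \<le> H ^ 3" using H by simp
  \<comment> \<open>The decimals are rounded up. Each use of \<open>H \<le> 4\<close> trades the
    highest power of \<open>H\<close> for the one below, so 243/1000000 covers 1/5040 + 16/362880,
    and 931/100000 covers 1/120 plus four times that.\<close>
  ultimately have T1: "T - 1 \<le> H / 6 + H ^ 2 / 120 + 243 / 1000000 * H ^ 3" by linarith
  then have "T - 1 \<le> H / 6 + 931 / 100000 * H ^ 2"
    using H3 zero_le_power2[of H] by linarith
  moreover have "0 \<le> T - 1"
    using real_le_x_sinh[of h] assms by (simp add: T_def sinh_def exp_minus)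
  ultimately have "(T - 1)\<^sup>2 \<le> (H / 6 + 931 / 100000 * H ^ 2)\<^sup>2"
    by (intro power_mono) auto
  also have "\<dots> = H ^ 2 / 36 + 931 / 100000 / 3 * H ^ 3 + (931 / 100000)\<^sup>2 * H ^ 4"
    by (simp add: eval_nat_numeral field_simps)
  also have "(931 / 100000)\<^sup>2 = (866761 / 10000000000 :: real)" by (simp add: power2_eq_square)
  finally have "(T - 1)\<^sup>2 \<le> H ^ 2 / 36 + 346 / 100000 * H ^ 3"
    using H4 H3_nonneg by linarith
  then show ?thesis
    using cosh T1 H2 H3 H unfolding T_def[symmetric] by linarith
qed

text \<open>The right-hand side is the denominator of \<open>rho\<close>. Bounding it below by
  \<open>sinh h / h\<close> times a linear function of \<open>m\<close> cancels the hyperbolic sine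
  and leaves a quotient of linear expressions in \<open>h\<close> and \<open>m\<close>.\<close>

lemma sinh_quotient_le_cosh_exp:
  fixes h m \<delta> :: real
  assumes h: "0 < h" "h \<le> 2" and \<delta>: "\<delta> \<le> 1/4" "0 \<le> \<delta>"
  shows "(sinh h / h) * (2 + (1 + \<delta>) * m) \<le> (1 - \<delta>) * cosh h + (1 + \<delta>) * exp m"
proof -
  define T where "T = sinh h / h"
  have T: "1 \<le> T"
    using real_le_x_sinh[of h] assms by (simp add: T_def sinh_def exp_minus)
  \<comment> \<open>For \<open>m \<ge> 0\<close>, replace \<open>exp m\<close> by its quadratic
    Taylor polynomial: the minimum is at \<open>m = T - 1\<close> and has the value on the
    left.\<close>
  have "- ((T - 1)\<^sup>2 / 2) \<le> exp m - 1 - m * T"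
  proof (cases "0 \<le> m")
    case True
    have "0 \<le> (m - (T - 1))\<^sup>2" by simp
    then have "- ((T - 1)\<^sup>2 / 2) \<le> m\<^sup>2 / 2 - m * (T - 1)"
      by (simp add: power2_eq_square field_simps)
    then show ?thesis using exp_lower_Taylor_quadratic[OF True] by (simp add: algebra_simps)
  next
    case False
    then have "m * (T - 1) \<le> 0" using T by (simp add: mult_nonpos_nonneg)
    moreover have "0 \<le> (T - 1)\<^sup>2" by simp
    moreover have "m * T = m * (T - 1) + m" by (simp add: algebra_simps)
    ultimately show ?thesis using exp_ge_add_one_self[of m] by linarith
  qed
  then have "(1 + \<delta>) * - ((T - 1)\<^sup>2 / 2) \<le> (1 + \<delta>) * (exp m - 1 - m * T)"
    using \<delta> by (intro mult_left_mono) auto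
  moreover have "2 * T + 5/8 * (T - 1)\<^sup>2 \<le> 3/4 * cosh h + 5/4"
    using sinh_cosh_quotient_bound[OF h] by (simp add: T_def)
  \<comment> \<open>Once \<open>exp m\<close> is replaced by the bound above, this is exactly the
    surplus over the case \<open>\<delta> = 1/4\<close>.\<close>
  moreover have "0 \<le> (1/4 - \<delta>) * (cosh h - 1 + (T - 1)\<^sup>2 / 2)"
    using \<delta> cosh_real_ge_1[of h] by (intro mult_nonneg_nonneg add_nonneg_nonneg) auto
  ultimately show ?thesis
    unfolding T_def[symmetric] by (simp add: field_simps)
qed

text \<open>In the application \<open>2 * h\<close> is the log ratio of the largest to the smallest
  entry of a child's message, and \<open>m\<close> is the log ratio of the geometric mean of the
  other two entries to that of these two. Then \<open>rho (1 / D) h m / D\<close> bounds the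
  quotient of the next factors; see \<open>factor_ratio_eq_rho\<close>.\<close>

definition rho :: "real \<Rightarrow> real \<Rightarrow> real \<Rightarrow> real" where
  "rho \<delta> h m = 2 * sinh h / ((1 - \<delta>) * cosh h + (1 + \<delta>) * exp m)"

lemma rho_denominator_pos: "0 \<le> \<delta> \<Longrightarrow> \<delta> < 1 \<Longrightarrow> 0 < (1 - \<delta>) * cosh h + (1 + \<delta>) * exp (m::real)"
  by (rule add_pos_pos; rule mult_pos_pos) auto

text \<open>The map \<open>x / (1 + x\<^sup>2 / 4)\<close> is the duplication formula of tanh: it
  equals \<open>tanh (2 * u)\<close> when \<open>tanh u = x / 2\<close>. It increases up to
  \<open>x = 2\<close>.\<close>

lemma damped_mono:
  fixes x y :: real
  assumes "0 \<le> x" "x \<le> y" "y \<le> 2"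
  shows "x / (1 + x\<^sup>2 / 4) \<le> y / (1 + y\<^sup>2 / 4)"
proof -
  have "x * y \<le> 2 * 2" using assms by (intro mult_mono) auto
  then have "0 \<le> (y - x) * (1 - x * y / 4)" using assms by (intro mult_nonneg_nonneg) auto
  then have "x * (1 + y\<^sup>2 / 4) \<le> y * (1 + x\<^sup>2 / 4)"
    by (simp add: power2_eq_square field_simps)
  then show ?thesis by (simp add: frac_le_eq divide_le_eq add_pos_nonneg pos_le_divide_eq)
qed

text \<open>The regime \<open>(1 + \<delta>) / 2 \<le> g\<close>, where \<open>bound\<close> is the
  linear inequality with \<open>b = (1 + \<delta>) / 2\<close>. It gives \<open>rho\<close> at most
  \<open>s * (2 * K + (1 + \<delta>) * m) / (2 + (1 + \<delta>) * m)\<close>, and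
  \<open>K - 1\<close> is at most \<open>s\<^sup>2 / 10\<close> because the argument of
  \<open>artanh\<close> is at most \<open>s / 2\<close>.\<close>

lemma rho_bound_small:
  fixes s \<delta> h m :: real
  assumes \<delta>: "0 < \<delta>" "\<delta> \<le> 1/4" and s: "0 < s" "s * (1 + \<delta>) \<le> 1"
    and h: "0 < h" "\<bar>m\<bar> \<le> h"
  defines "g \<equiv> 1 / s - (1 + \<delta>) / 2"
  assumes bound: "h / s \<le> g * (artanh (\<delta> / g) / \<delta>) + (1 + \<delta>) * m / 2"
  shows "rho \<delta> h m \<le> s + s ^ 3 / 5" "s \<le> 1"
proof -
  define K where "K = g * (artanh (\<delta> / g) / \<delta>)"
  define x where "x = \<delta> / g"
  have \<beta>: "1 + \<delta> \<le> 1 / s" using s by (simp add: field_simps)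
  then have g: "(1 + \<delta>) / 2 \<le> g" "0 < g" "1 / (2 * s) \<le> g"
    using \<delta> s by (auto simp: g_def field_simps)
  show s1: "s \<le> 1"
    using s \<delta> by (smt (verit) mult_left_le mult_le_cancel_left2)
  have x0: "0 < x" using \<delta> g by (simp add: x_def)
  have x1: "x \<le> 2 * \<delta> / (1 + \<delta>)"
    using divide_left_mono[OF g(1), of \<delta>] g \<delta> by (simp add: x_def mult.commute)
  have x2: "x \<le> 2 * \<delta> * s"
    using divide_left_mono[OF g(3), of \<delta>] g \<delta> s by (simp add: x_def mult_ac)
  have x3: "x \<le> 2/5"
  proof -
    have "2 * \<delta> / (1 + \<delta>) \<le> 2/5" using \<delta> by (simp add: field_simps)
    then show ?thesis using x1 by simp
  qed
  have "K = artanh x / x" using g \<delta> by (simp add: K_def x_def)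
  also have "\<dots> \<le> 1 + 2/5 * x\<^sup>2"
    using artanh_le_cubic[of x] x0 x3 by (simp add: pos_divide_le_eq eval_nat_numeral algebra_simps)
  finally have K: "K \<le> 1 + 2/5 * x\<^sup>2" .
  have K1: "K \<le> 1 + s\<^sup>2 / 10"
  proof -
    have "x\<^sup>2 \<le> (2 * (1/4) * s)\<^sup>2"
      using x2 x0 s mult_right_mono[OF \<delta>(2), of s] by (intro power_mono) linarith+
    then show ?thesis using K by (simp add: power2_eq_square)
  qed
  have K2: "K \<le> 1 + \<delta>"
  proof -
    have "x \<le> 2 * \<delta>" using x2 \<delta> mult_left_mono[OF s1, of "2 * \<delta>"] by linarith
    then have "x * x \<le> (2 * \<delta>) * (2/5)" using x0 x3 \<delta> by (intro mult_mono) auto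
    then show ?thesis using K \<delta> by (simp add: power2_eq_square)
  qed
  have b: "h / s \<le> K + (1 + \<delta>) * m / 2" using bound by (simp add: K_def)
  \<comment> \<open>Inserting \<open>m \<le> h\<close> into the bound leaves
    \<open>h * g \<le> K \<le> 2 * g\<close>. This is the range in which the Taylor estimates
    hold.\<close>
  have "h \<le> 2"
  proof -
    have "h * g = h / s - (1 + \<delta>) * h / 2" by (simp add: g_def algebra_simps)
    also have "\<dots> \<le> K"
    proof -
      have "(1 + \<delta>) * m \<le> (1 + \<delta>) * h" using h \<delta> by (intro mult_left_mono) auto
      then show ?thesis using b by simp
    qed
    also have "\<dots> \<le> 2 * g" using K2 g by simp
    finally show ?thesis using g by simp
  qed
  \<comment> \<open>This keeps \<open>2 + (1 + \<delta>) * m\<close> at least 1, which is what turns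
    the absolute error \<open>s\<^sup>2 / 5\<close> into the relative factor
    \<open>1 + s\<^sup>2 / 5\<close> at the end.\<close>
  have \<beta>m: "- 1 \<le> (1 + \<delta>) * m"
  proof (cases "0 \<le> m")
    case False
    have "- m * (1 + \<delta>) \<le> h * (1 / s)"
      using h \<beta> False \<delta> by (intro mult_mono) auto
    then have "- m * (1 + \<delta>) \<le> K + (1 + \<delta>) * m / 2" using b by simp
    moreover have "K \<le> 11/10" using K1 s1 s power_le_one[of s 2] by simp
    moreover have "- m * (1 + \<delta>) = - ((1 + \<delta>) * m)" by simp
    ultimately show ?thesis by linarith
  next
    case True
    then have "0 \<le> (1 + \<delta>) * m" using \<delta> by simp
    then show ?thesis by linarith
  qed
  have den: "0 < (1 - \<delta>) * cosh h + (1 + \<delta>) * exp m"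
    using \<delta> by (intro rho_denominator_pos) auto
  have L: "(sinh h / h) * (2 + (1 + \<delta>) * m) \<le> (1 - \<delta>) * cosh h + (1 + \<delta>) * exp m"
    using sinh_quotient_le_cosh_exp[of h \<delta> m] h \<open>h \<le> 2\<close> \<delta> by simp
  have c: "0 < 2 + (1 + \<delta>) * m" using \<beta>m by simp
  have "rho \<delta> h m \<le> 2 * sinh h / ((sinh h / h) * (2 + (1 + \<delta>) * m))"
    unfolding rho_def using L h c den by (intro divide_left_mono mult_pos_pos divide_pos_pos) auto
  also have "\<dots> = 2 * h / (2 + (1 + \<delta>) * m)"
  proof -
    have "2 * S / ((S / h) * c) = 2 * h / c" if "S \<noteq> 0" for S c :: real
      using that h by (simp add: field_simps)
    then show ?thesis using h by simp
  qed
  also have "\<dots> \<le> s + s ^ 3 / 5"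
  proof -
    have "2 * h \<le> s * (2 * K + (1 + \<delta>) * m)"
      using b s by (simp add: field_simps)
    also have "\<dots> \<le> s * ((1 + s\<^sup>2 / 5) * (2 + (1 + \<delta>) * m))"
    proof (intro mult_left_mono)
      have "0 \<le> s\<^sup>2 * (1 + (1 + \<delta>) * m)" using \<beta>m by (intro mult_nonneg_nonneg) auto
      then show "2 * K + (1 + \<delta>) * m \<le> (1 + s\<^sup>2 / 5) * (2 + (1 + \<delta>) * m)"
        using K1 by (simp add: field_simps)
    qed (use s in auto)
    finally show ?thesis
      using c by (subst pos_divide_le_eq) (simp_all add: eval_nat_numeral field_simps)
  qed
  finally show "rho \<delta> h m \<le> s + s ^ 3 / 5" .
qed

text \<open>Damping subtracts about \<open>s ^ 3 / 4\<close>, more than the \<open>s ^ 3 / 5\<close>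
  lost in \<open>rho_bound_small\<close>. The net gain is about \<open>s ^ 3 / 20\<close> for small
  \<open>s\<close>; the constant 1/100 leaves room for all \<open>s\<close> up to 1.\<close>

lemma damped_small:
  fixes s :: real
  assumes "0 < s" "s \<le> 1"
  shows "(s + s ^ 3 / 5) / (1 + (s + s ^ 3 / 5)\<^sup>2 / 4) \<le> s - s ^ 3 / 100"
proof -
  have s2: "0 \<le> s\<^sup>2" "s\<^sup>2 \<le> 1" using assms by (auto simp: power_le_one)
  have "(s + s ^ 3 / 5) / (1 + (s + s ^ 3 / 5)\<^sup>2 / 4) \<le> (s + s ^ 3 / 5) / (1 + s\<^sup>2 / 4)"
    using assms by (intro divide_left_mono mult_pos_pos add_pos_nonneg add_left_mono divide_right_mono power_mono) auto
  also have "\<dots> \<le> s - s ^ 3 / 100"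
  proof -
    have "0 \<le> s * s\<^sup>2 * (4/100 - s\<^sup>2 / 400)"
      using assms s2 by (intro mult_nonneg_nonneg) auto
    then have "s + s ^ 3 / 5 \<le> (s - s ^ 3 / 100) * (1 + s\<^sup>2 / 4)"
      by (simp add: eval_nat_numeral field_simps)
    then show ?thesis by (subst pos_divide_le_eq) (auto intro: add_pos_nonneg)
  qed
  finally show ?thesis .
qed

text \<open>On \<open>X \<ge> 0\<close> the function \<open>p * X ^ 3 - b * X\<^sup>2\<close> is
  smallest at \<open>X = 2 * b / (3 * p)\<close>, with value
  \<open>- 4 * b ^ 3 / (27 * p\<^sup>2)\<close>; the last hypothesis says that this is at least
  \<open>- e\<close>.\<close>

lemma cubic_bound:
  fixes p b e X :: real
  assumes "0 < p" "0 \<le> b" "0 \<le> X" "4 * b ^ 3 \<le> 27 * p\<^sup>2 * e"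
  shows "b * X\<^sup>2 \<le> p * X ^ 3 + e"
proof -
  define Y where "Y = 2 * b / (3 * p)"
  have Y: "0 \<le> Y" and b: "b = 3 * p * Y / 2" using assms by (auto simp: Y_def)
  have "0 \<le> p * ((X - Y)\<^sup>2 * (X + Y / 2))" using assms Y by (intro mult_nonneg_nonneg add_nonneg_nonneg) auto
  moreover have "p * Y ^ 3 \<le> 2 * e"
  proof -
    have "27 / 2 * p\<^sup>2 * (p * Y ^ 3) \<le> 27 / 2 * p\<^sup>2 * (2 * e)"
      using assms(4) unfolding b by (simp add: eval_nat_numeral algebra_simps)
    then show ?thesis using assms(1) by simp
  qed
  ultimately show ?thesis unfolding b by (simp add: eval_nat_numeral field_simps)
qed

text \<open>The hypothesis of \<open>cubic_bound\<close> for the coefficients met in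
  \<open>rho_bound_large\<close>. Written in \<open>t = V - 1/5\<close>, right side minus left side
  has only positive coefficients.\<close>

lemma quintic_bound:
  fixes V :: real
  assumes "1/5 \<le> V"
  shows "4 * (2 * V - 4/25) ^ 3 \<le> 27 * (5/4 * V\<^sup>2)\<^sup>2 * (2 * V - 4/25 + 3/4)"
proof -
  define t where "t = V - 1/5"
  have t: "0 \<le> t" and V: "V = t + 1/5" using assms by (auto simp: t_def)
  have "0 \<le> t ^ 2" "0 \<le> t ^ 3" "0 \<le> t ^ 4" "0 \<le> t ^ 5" using t by auto
  then show ?thesis unfolding V using t by (simp add: eval_nat_numeral field_simps)
qed

text \<open>With \<open>a = 2 * V + 43/200\<close> and \<open>s = 8 * (1 - V) / (7 - 3 * V)\<close>
  this is \<open>a / (a\<^sup>2 + 1/4) \<le> 99/100 * s\<close>. The endpoints 1/5 and 3/7 of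
  \<open>V\<close> correspond to \<open>s = 1\<close> and \<open>s = 4/5\<close>.\<close>

lemma quadratic_bound:
  fixes V :: real
  assumes "1/5 \<le> V" "V \<le> 3/7"
  shows "(2 * V + 43/200) * (7 - 3 * V) \<le> 198/25 * (1 - V) * ((2 * V + 43/200)\<^sup>2 + 1/4)"
proof -
  define t where "t = V - 1/5"
  have t: "0 \<le> t" "t \<le> 8/35" and V: "V = t + 1/5" using assms by (auto simp: t_def)
  have "t * t * t \<le> t * t * (8/35)" using t by (intro mult_left_mono) auto
  moreover have "0 \<le> (t - 1/20)\<^sup>2" by simp
  ultimately show ?thesis unfolding V using t by (simp add: eval_nat_numeral field_simps)
qed

text \<open>The complementary regime, where \<open>bound\<close> comes from the coefficient
  \<open>b = g\<close>. Now \<open>4/5 < s\<close>, so a fixed relative gain is affordable: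
  \<open>99/100 * s\<close> already lies below the target. The alternative for
  \<open>\<delta>\<close> records that it is the reciprocal of an integer.\<close>

lemma rho_bound_large:
  fixes s \<delta> h m :: real
  assumes \<delta>: "0 < \<delta>" "\<delta> = 1/4 \<or> \<delta> \<le> 1/5" and s: "s \<le> 1" "1 < s * (1 + \<delta>)"
    and h: "0 < h"
  defines "g \<equiv> 1 / s - (1 + \<delta>) / 2"
  assumes bound: "2 * h - m \<le> artanh (\<delta> / g) / \<delta>"
  shows "rho \<delta> h m < 2" "rho \<delta> h m / (1 + (rho \<delta> h m)\<^sup>2 / 4) \<le> s - s ^ 3 / 100"
proof -
  have \<delta>4: "\<delta> \<le> 1/4" using \<delta> by auto
  have s0: "4/5 < s"
  proof (rule ccontr)
    assume "\<not> 4/5 < s"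
    then have "s * (1 + \<delta>) \<le> 4/5 * (1 + 1/4)" using \<delta> \<delta>4 by (intro mult_mono) auto
    then show False using s by simp
  qed
  define w where "w = 1 / g"
  \<comment> \<open>Replacing \<open>\<delta>\<close> by 1/4, both inside \<open>artanh\<close> and
    in \<open>g\<close>, raises \<open>artanh (\<delta> / g) / \<delta>\<close> to
    \<open>- 2 * ln V\<close>.\<close>
  define V where "V = (8 - 7 * s) / (8 - 3 * s)"
  have g: "(8 - 5 * s) / (8 * s) \<le> g" using \<delta>4 s0 by (simp add: g_def field_simps)
  have "0 < (8 - 5 * s) / (8 * s)" using s s0 by simp
  then have w: "0 < w" "w \<le> 8 * s / (8 - 5 * s)"
    using le_imp_inverse_le[OF g] g by (auto simp: w_def inverse_eq_divide)
  have V: "1/5 \<le> V" "V \<le> 3/7" and sV: "s = 8 * (1 - V) / (7 - 3 * V)"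
    using s s0 by (auto simp: V_def field_simps)
  have w4: "w / 4 \<le> 2 * s / (8 - 5 * s)" "2 * s / (8 - 5 * s) < 1"
    using w s s0 by (auto simp: field_simps)
  have "w / 4 * artanh (\<delta> * w) \<le> \<delta> * w * artanh (w / 4)"
    using w w4 \<delta> \<delta>4 mult_right_mono[OF \<delta>4, of w] by (intro artanh_le_linear) auto
  then have "artanh (\<delta> * w) / \<delta> \<le> 4 * artanh (w / 4)"
    using w \<delta> by (simp add: field_simps)
  also have "artanh (w / 4) \<le> artanh (2 * s / (8 - 5 * s))"
    using w w4 by (intro artanh_mono_real) auto
  also have "\<dots> = ln ((8 - 3 * s) / (8 - 7 * s)) / 2"
  proof -
    have "1 + 2 * s / (8 - 5 * s) = (8 - 3 * s) / (8 - 5 * s)"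
      "1 - 2 * s / (8 - 5 * s) = (8 - 7 * s) / (8 - 5 * s)"
      using s by (simp_all add: field_simps)
    then show ?thesis using s by (simp add: artanh_def)
  qed
  also have "ln ((8 - 3 * s) / (8 - 7 * s)) = - ln V"
    using s by (simp add: V_def ln_div)
  finally have b: "2 * h + 2 * ln V \<le> m" using bound by (simp add: w_def)
  define X where "X = exp h"
  have X: "1 < X" using h by (simp add: X_def)
  have expm: "X\<^sup>2 * V\<^sup>2 \<le> exp m"
  proof -
    have "exp (2 * h + 2 * ln V) = X\<^sup>2 * V\<^sup>2"
      using V by (simp add: exp_add X_def exp_double)
    then show ?thesis using b by (metis exp_le_cancel_iff)
  qed
  have sX: "sinh h = (X - 1 / X) / 2" and cX: "cosh h = (X + 1 / X) / 2"
    by (auto simp: sinh_def cosh_def X_def exp_minus inverse_eq_divide)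
  have main: "rho \<delta> h m < 2 \<and> rho \<delta> h m / (1 + (rho \<delta> h m)\<^sup>2 / 4) \<le> s - s ^ 3 / 100"
    if *: "3/4 * cosh h + 5/4 * exp m \<le> (1 - \<delta>) * cosh h + (1 + \<delta>) * exp m"
  proof -
    \<comment> \<open>The reciprocal of \<open>a\<close> will bound \<open>rho\<close>. With
      \<open>exp m\<close> bounded below by \<open>X\<^sup>2 * V\<^sup>2\<close> and after
      multiplication by \<open>X = exp h\<close>, the required inequality is the cubic one of
      \<open>cubic_bound\<close>. The offset 43/200 fits between two demands:
      \<open>quintic_bound\<close> limits \<open>a\<close> from above,
      \<open>quadratic_bound\<close> from below.\<close>
    define a where "a = 2 * V + 43/200"
    have a: "0.615 \<le> a" using V by (simp add: a_def)
    have "(2 * V - 4/25) * X\<^sup>2 \<le> (5/4 * V\<^sup>2) * X ^ 3 + (2 * V - 4/25 + 3/4)"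
      using V X quintic_bound[of V] by (intro cubic_bound) auto
    then have "(a - 3/8) * X\<^sup>2 \<le> (5/4 * V\<^sup>2) * X ^ 3 + (a + 3/8)"
      by (simp add: a_def algebra_simps)
    then have "a * (X\<^sup>2 - 1) \<le> 3/8 * (X\<^sup>2 + 1) + 5/4 * (X\<^sup>2 * V\<^sup>2) * X"
      by (simp add: eval_nat_numeral field_simps)
    also have "\<dots> \<le> 3/8 * (X\<^sup>2 + 1) + 5/4 * exp m * X"
      using expm X by (intro add_left_mono mult_right_mono mult_left_mono) auto
    finally have "a * (X\<^sup>2 - 1) / X \<le> (3/8 * (X\<^sup>2 + 1) + 5/4 * exp m * X) / X"
      using X by (intro divide_right_mono) auto
    then have "a * (2 * sinh h) \<le> 3/4 * cosh h + 5/4 * exp m"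
      using X by (simp add: sX cX field_simps power2_eq_square)
    also note *
    finally have r: "rho \<delta> h m \<le> 1 / a"
      using a rho_denominator_pos[of \<delta> h m] \<delta> \<delta>4 by (simp add: rho_def field_simps)
    have r0: "0 \<le> rho \<delta> h m"
      unfolding rho_def using h rho_denominator_pos[of \<delta> h m] \<delta> \<delta>4 by (intro divide_nonneg_nonneg) auto
    have a2: "1 / a < 2" using a by (simp add: field_simps)
    have "rho \<delta> h m / (1 + (rho \<delta> h m)\<^sup>2 / 4) \<le> (1 / a) / (1 + (1 / a)\<^sup>2 / 4)"
      using r r0 a2 by (intro damped_mono) auto
    also have "\<dots> = a / (a\<^sup>2 + 1/4)" using a by (simp add: field_simps power2_eq_square)
    also have "\<dots> \<le> 99/100 * s"
    proof -
      have "a * (7 - 3 * V) \<le> (198/25 * (1 - V)) * (a\<^sup>2 + 1/4)"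
        using quadratic_bound[OF V] by (simp add: a_def)
      then show ?thesis using V unfolding sV
        by (simp add: pos_divide_le_eq add_nonneg_pos) (simp add: field_simps)
    qed
    also have "\<dots> \<le> s - s ^ 3 / 100"
    proof -
      have "s * s\<^sup>2 \<le> s * 1" using s s0 by (intro mult_left_mono power_le_one) auto
      then show ?thesis by (simp add: eval_nat_numeral)
    qed
    finally show ?thesis using r a2 by simp
  qed
  have "rho \<delta> h m < 2 \<and> rho \<delta> h m / (1 + (rho \<delta> h m)\<^sup>2 / 4) \<le> s - s ^ 3 / 100"
  proof (cases "exp m \<le> cosh h \<or> \<delta> = 1/4")
    case True
    then have "0 \<le> (1/4 - \<delta>) * (cosh h - exp m)"
    proof
      assume "\<delta> = 1/4"
      then have "1/4 - \<delta> = 0" by linarith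
      then show ?thesis by (simp only: mult_zero_left)
    qed (use \<delta>4 in auto)
    then show ?thesis by (intro main) (simp add: field_simps)
  next
    case False
    \<comment> \<open>Here the denominator is at least \<open>2 * cosh h\<close>, so
      \<open>rho \<le> 1\<close>, which is damped to 4/5. That meets the target because
      \<open>\<delta> \<le> 1/5\<close> forces \<open>5/6 < s\<close>; for
      \<open>\<delta> = 1/4\<close> only \<open>4/5 < s\<close> is known, so that value belongs to
      the first case.\<close>
    then have c: "cosh h \<le> exp m" and \<delta>5: "\<delta> \<le> 1/5" using \<delta> by auto
    have "0 \<le> (1 + \<delta>) * (exp m - cosh h)" using c \<delta> by simp
    then have "2 * sinh h \<le> (1 - \<delta>) * cosh h + (1 + \<delta>) * exp m"
      using sinh_le_cosh_real[of h] by (simp add: algebra_simps)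
    then have r: "rho \<delta> h m \<le> 1"
      using rho_denominator_pos[of \<delta> h m] \<delta> \<delta>4 by (simp add: rho_def)
    have r0: "0 \<le> rho \<delta> h m"
      unfolding rho_def using h rho_denominator_pos[of \<delta> h m] \<delta> \<delta>4 by (intro divide_nonneg_nonneg) auto
    have "5/6 < s"
    proof (rule ccontr)
      assume "\<not> 5/6 < s"
      then have "s * (1 + \<delta>) \<le> 5/6 * (1 + 1/5)" using \<delta> \<delta>5 by (intro mult_mono) auto
      then show False using s by simp
    qed
    have "rho \<delta> h m / (1 + (rho \<delta> h m)\<^sup>2 / 4) \<le> 1 / (1 + 1\<^sup>2 / 4)"
      using r r0 by (intro damped_mono) auto
    also have "\<dots> \<le> s - s ^ 3 / 100"
      using \<open>5/6 < s\<close> s power_le_one[of s 3] by simp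
    finally show ?thesis using r by simp
  qed
  then show "rho \<delta> h m < 2" "rho \<delta> h m / (1 + (rho \<delta> h m)\<^sup>2 / 4) \<le> s - s ^ 3 / 100"
    by auto
qed
section \<open>Two-step contraction of messages\<close>

abbreviation colours :: "nat set" where "colours \<equiv> {1..4}"

text \<open>The cross-multiplied form admits zero entries, so every non-negative message satisfies
  it with \<open>s = 1\<close>; this is the start of the iteration.\<close>

definition spread :: "real \<Rightarrow> (nat \<Rightarrow> real) \<Rightarrow> bool" where
  "spread s x \<longleftrightarrow> (\<forall>a\<in>colours. \<forall>b\<in>colours. x a - x b \<le> s * (x a + x b))"

definition factor :: "real \<Rightarrow> (nat \<Rightarrow> real) \<Rightarrow> nat \<Rightarrow> real" where
  "factor \<omega> x a = sum x colours - \<omega> * x a"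

abbreviation colourings :: "'v set \<Rightarrow> ('v \<Rightarrow> nat) set" where
  "colourings U \<equiv> U \<rightarrow>\<^sub>E colours"

text \<open>The quantity \<open>N\<close> is built so that the spread hypothesis and the bound on
  \<open>\<omega>\<close> give \<open>L y - L xi \<le> 2 * artanh ((y - xi) / (N * D))\<close>.
  Since \<open>g * (y - xi) \<le> N\<close>, convexity makes this at most a fixed multiple of
  \<open>(y - xi) / N\<close>. Weighted by \<open>g\<close>, \<open>b\<close>, \<open>b\<close>, the
  numerators add up to at most \<open>N\<close>.\<close>

lemma sorted_child_bound:
  fixes xi xk xl xm S s \<omega> D b :: real
  assumes x: "0 \<le> xi" "xi \<le> xl" "xi \<le> xm" "xl \<le> xk" "xm \<le> xk"
    and S: "S = xi + xk + xl + xm" "0 < S"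
    and spread: "xk - xi \<le> s * (xk + xi)" and s: "0 < s" "s \<le> 1"
    and D: "4 \<le> D" and \<omega>: "0 \<le> \<omega>" "\<omega> \<le> 4 / (D + 1)"
  defines "g \<equiv> 1 / s - (1 + 1 / D) / 2"
  assumes b: "0 \<le> b" "b \<le> (1 + 1 / D) / 2"
  defines "L \<equiv> \<lambda>y. - ln (S - \<omega> * y)"
  shows "D * (g * (L xk - L xi) + b * (L xl - L xi) + b * (L xm - L xi))
    \<le> 2 * g * (D * artanh (1 / D / g))"
proof -
  define A where "A = artanh (1 / D / g)"
  define N where "N = g * (xk - xi) + (1 + 1 / D) / 2 * ((xl - xi) + (xm - xi))"
  have s1: "1 \<le> 1 / s" using s by simp
  have Dg_eq: "D * g = D * (1 / s) - (D + 1) / 2" using D by (simp add: g_def field_simps)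
  have aux: "1 < Z - (D + 1) / 2" if "D * 1 \<le> Z" for Z
    using that D by (simp add: field_simps)
  have "D * 1 \<le> D * (1 / s)" using s1 D by (intro mult_left_mono) auto
  then have Dg: "1 < D * g" unfolding Dg_eq by (rule aux)
  then have g: "0 < g" using D zero_less_mult_pos[of D g] by linarith
  have A0: "0 \<le> A" unfolding A_def
    using Dg g D by (intro artanh_nonneg_real) (auto simp: field_simps)
  have pos: "0 < S - \<omega> * y" if "y \<le> S" "0 \<le> y" for y
  proof -
    have "\<omega> * y \<le> 4 / (D + 1) * S" using \<omega> that D by (intro mult_mono) auto
    also have "\<dots> < 1 * S" using D S by (intro mult_strict_right_mono) auto
    finally show ?thesis by simp
  qed
  have DN: "D * N \<le> 2 * D * xi + D * (xk - xi) - (D + 1) / 2 * (xk - xi)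
      + (D + 1) / 2 * ((xl - xi) + (xm - xi))"
  proof -
    have "D * ((1 / s) * (xk - xi)) \<le> D * (xk + xi)"
      using spread s D by (intro mult_left_mono) (auto simp: field_simps)
    moreover have "D * N = D * ((1 / s) * (xk - xi)) - (D + 1) / 2 * (xk - xi)
        + (D + 1) / 2 * ((xl - xi) + (xm - xi))"
    proof -
      have gen: "D * (g * q + \<beta> / 2 * r) = (D * g) * q + (D * \<beta>) / 2 * r" for q \<beta> r :: real
        by (simp add: algebra_simps)
      have "D * N = (D * g) * (xk - xi) + (D * (1 + 1 / D)) / 2 * ((xl - xi) + (xm - xi))"
        unfolding N_def by (rule gen)
      also have "D * (1 + 1 / D) = D + 1" using D by (simp add: field_simps)
      finally show ?thesis unfolding Dg_eq by (simp add: algebra_simps)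
    qed
    ultimately show ?thesis by (simp add: algebra_simps)
  qed
  have diff: "L y - L xi \<le> 2 * ((y - xi) / N * (g * A))"
    if y: "xi \<le> y" "y \<le> xk" and N: "0 < N" "g * (y - xi) \<le> N" for y
  proof -
    have yS: "y \<le> S" "xi \<le> S" using y x S by auto
    have "L y - L xi = ln ((S - \<omega> * xi) / (S - \<omega> * y))"
      using pos[of y] pos[of xi] yS x y by (simp add: L_def ln_div)
    also have "\<dots> = 2 * artanh (((S - \<omega> * xi) - (S - \<omega> * y)) / ((S - \<omega> * xi) + (S - \<omega> * y)))"
      using pos[of y] pos[of xi] yS x y by (intro ln_ratio_eq_artanh) auto
    also have "((S - \<omega> * xi) - (S - \<omega> * y)) / ((S - \<omega> * xi) + (S - \<omega> * y))
        = \<omega> * (y - xi) / (2 * S - \<omega> * (y + xi))"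
      by (simp add: algebra_simps)
    also have "artanh \<dots> \<le> artanh ((y - xi) / (N * D))"
    proof (rule artanh_mono_real)
      have den: "0 < 2 * S - \<omega> * (y + xi)"
        using pos[of y] pos[of xi] yS x y by (simp add: algebra_simps)
      then show "- 1 < \<omega> * (y - xi) / (2 * S - \<omega> * (y + xi))"
        using \<omega> y by (smt (verit) divide_nonneg_pos mult_nonneg_nonneg)
      \<comment> \<open>The critical value enters here: for \<open>y = xk\<close> the chain is an
        equality when \<open>\<omega> = 4 / (D + 1)\<close> and the spread hypothesis is attained.
        This dictates the form of \<open>g\<close>.\<close>
      have "(N * D + y + xi) * \<omega> \<le> (N * D + y + xi) * (4 / (D + 1))"
        using \<omega> N D y x by (intro mult_left_mono) auto
      also have "\<dots> \<le> 2 * S"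
      proof -
        have "(2 * D - 2) * (xk - xi) + 4 * (y - xi) \<le> (2 * D + 2) * (xk - xi)"
          using y by (simp add: algebra_simps)
        then have "4 * (N * D + y + xi) \<le> 2 * S * (D + 1)"
          using DN unfolding S(1) by (simp add: field_simps)
        then show ?thesis using D by (simp add: field_simps)
      qed
      finally have "\<omega> * (N * D) \<le> 2 * S - \<omega> * (y + xi)" by (simp add: algebra_simps)
      then have "(\<omega> * (N * D)) * (y - xi) \<le> (2 * S - \<omega> * (y + xi)) * (y - xi)"
        using y by (intro mult_right_mono) auto
      then show "\<omega> * (y - xi) / (2 * S - \<omega> * (y + xi)) \<le> (y - xi) / (N * D)"
        using den N D by (simp add: frac_le_eq divide_le_0_iff mult_ac)
      \<comment> \<open>The summand 1 keeps the inequality strict when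
        \<open>y = xi\<close>.\<close>
      have "y - xi < (g * (y - xi)) * D + (if y = xi then 1 else 0)"
        using Dg y mult_strict_right_mono[OF Dg, of "y - xi"] by (auto simp: mult_ac)
      also have "\<dots> \<le> N * D + (if y = xi then 1 else 0)"
        using N D by (intro add_right_mono mult_right_mono) auto
      finally show "(y - xi) / (N * D) < 1"
        using N D by (cases "y = xi") auto
    qed
    also have "\<dots> \<le> (y - xi) / N * (g * A)"
    proof -
      have "1 / (D * g) * artanh ((y - xi) / (N * D)) \<le> (y - xi) / (N * D) * artanh (1 / (D * g))"
        using y N D g Dg mult_left_mono[OF N(2), of D]
        by (intro artanh_le_linear) (auto simp: field_simps)
      then show ?thesis using D g N by (simp add: A_def field_simps)
    qed
    finally show ?thesis by simp
  qed
  show ?thesis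
  proof (cases "xk = xi")
    case True
    then have "xl = xi" "xm = xi" using x by auto
    then show ?thesis using True A0 g D unfolding A_def[symmetric] by simp
  next
    case False
    then have qk: "0 < xk - xi" using x by simp
    have "0 \<le> (1 + 1 / D) / 2 * ((xl - xi) + (xm - xi))" using D x by (intro mult_nonneg_nonneg) auto
    then have Nk: "g * (xk - xi) \<le> N" by (simp add: N_def)
    have N: "0 < N" using Nk mult_pos_pos[OF g qk] by linarith
    have Ny: "g * (y - xi) \<le> N" if "y \<le> xk" for y
      using that Nk g mult_left_mono[of "y - xi" "xk - xi" g] by linarith
    have "g * (L xk - L xi) + b * (L xl - L xi) + b * (L xm - L xi)
      \<le> g * (2 * ((xk - xi) / N * (g * A))) + b * (2 * ((xl - xi) / N * (g * A)))
        + b * (2 * ((xm - xi) / N * (g * A)))"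
      using g b x N Ny by (intro add_mono mult_left_mono diff) auto
    also have "\<dots> = 2 * (g * A) * ((g * (xk - xi) + b * ((xl - xi) + (xm - xi))) / N)"
      by (simp add: algebra_simps add_divide_distrib diff_divide_distrib)
    also have "\<dots> \<le> 2 * (g * A) * 1"
    proof (intro mult_left_mono)
      have "b * ((xl - xi) + (xm - xi)) \<le> (1 + 1 / D) / 2 * ((xl - xi) + (xm - xi))"
        using b x by (intro mult_right_mono) auto
      then show "(g * (xk - xi) + b * ((xl - xi) + (xm - xi))) / N \<le> 1"
        using N by (simp add: N_def)
    qed (use g A0 in auto)
    finally have "D * (g * (L xk - L xi) + b * (L xl - L xi) + b * (L xm - L xi)) \<le> D * (2 * (g * A))"
      using D by (intro mult_left_mono) auto
    then show ?thesis by (simp add: A_def mult_ac)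
  qed
qed

lemma set_colours: "colours = {1, 2, 3, 4}"
  by auto

lemma sum_colours_distinct:
  fixes f :: "nat \<Rightarrow> real"
  assumes "{i, k, l, m} = colours"
  shows "sum f colours = f i + f k + f l + f m"
proof -
  have "card {i, k, l, m} = 4" using assms by simp
  then have "distinct [i, k, l, m]"
    using card_distinct[of "[i, k, l, m]"] by simp
  then show ?thesis unfolding assms[symmetric] by simp
qed

text \<open>The maximum is taken over the colours other than \<open>i\<close>, so the four positions
  stay distinct even when entries coincide.\<close>

lemma obtain_extremes:
  fixes x :: "nat \<Rightarrow> real"
  obtains i k l m where "{i, k, l, m} = colours"
    "\<And>a. a \<in> colours \<Longrightarrow> x i \<le> x a" "\<And>a. a \<in> colours \<Longrightarrow> x a \<le> x k"
proof -
  have c4: "card colours = 4" by simp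
  obtain i where i: "is_arg_min x (\<lambda>a. a \<in> colours) i"
    using ex_is_arg_min_if_finite[of colours x] by auto
  then have i: "i \<in> colours" "\<And>a. a \<in> colours \<Longrightarrow> x i \<le> x a"
    by (auto simp: is_arg_min_def not_less)
  then have "card (colours - {i}) = card colours - 1" by (intro card_Diff_singleton)
  then have c3: "card (colours - {i}) = 3" unfolding c4 by simp
  then have "finite (colours - {i})" "colours - {i} \<noteq> {}"
    by (metis card.infinite zero_neq_numeral, metis card.empty zero_neq_numeral)
  then obtain k where "is_arg_min (\<lambda>a. - x a) (\<lambda>a. a \<in> colours - {i}) k"
    using ex_is_arg_min_if_finite[of "colours - {i}" "\<lambda>a. - x a"] by blast
  then have k: "k \<in> colours - {i}" "\<And>a. a \<in> colours - {i} \<Longrightarrow> x a \<le> x k"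
    by (auto simp: is_arg_min_def not_less)
  then have "card (colours - {i} - {k}) = 2" using c3 by (subst card_Diff_singleton) auto
  then obtain l m where lm: "colours - {i} - {k} = {l, m}" by (auto simp: card_2_iff)
  show ?thesis
  proof
    show "{i, k, l, m} = colours" using i k lm by blast
    show "x i \<le> x a" if "a \<in> colours" for a using that i by blast
    show "x a \<le> x k" if "a \<in> colours" for a
      using that i k by (cases "a = i") blast+
  qed
qed

lemma factor_pos:
  assumes x: "\<And>a. a \<in> colours \<Longrightarrow> 0 \<le> x a" "0 < sum x colours"
    and \<omega>: "0 \<le> \<omega>" "\<omega> < 1" and a: "a \<in> colours"
  shows "0 < factor \<omega> x a"
proof -
  have "x a \<le> sum x colours" using a x by (intro member_le_sum) auto
  then have "\<omega> * x a \<le> \<omega> * sum x colours" using \<omega> by (intro mult_left_mono) auto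
  also have "\<dots> < 1 * sum x colours" using \<omega> x by (intro mult_strict_right_mono) auto
  finally show ?thesis by (simp add: factor_def)
qed

text \<open>The functional equals
  \<open>(g - b) * L k - (g + 3 * b) * L i + b * sum L colours\<close>. As \<open>b \<le> g\<close>,
  it is largest when \<open>k\<close> and \<open>i\<close> are the extreme colours, which is the
  sorted case. The positions are thus the same for all children whatever the order of their entries,
  and the inequalities can be added.\<close>

lemma child_bound:
  fixes s \<omega> D b :: real
  assumes C: "{i, k, l, m} = colours"
    and x: "\<And>a. a \<in> colours \<Longrightarrow> 0 \<le> x a" "0 < sum x colours"
    and spread: "spread s x" and s: "0 < s" "s \<le> 1"
    and D: "4 \<le> D" and \<omega>: "0 \<le> \<omega>" "\<omega> \<le> 4 / (D + 1)"
  defines "g \<equiv> 1 / s - (1 + 1 / D) / 2"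
  assumes b: "0 \<le> b" "b \<le> g" "b \<le> (1 + 1 / D) / 2"
  defines "L \<equiv> \<lambda>a. - ln (factor \<omega> x a)"
  shows "D * (g * (L k - L i) + b * (L l - L i) + b * (L m - L i))
    \<le> 2 * g * (D * artanh (1 / D / g))"
proof -
  obtain i' k' l' m' where C': "{i', k', l', m'} = colours"
    and mi: "\<And>a. a \<in> colours \<Longrightarrow> x i' \<le> x a" and mx: "\<And>a. a \<in> colours \<Longrightarrow> x a \<le> x k'"
    using obtain_extremes by blast
  have in_C: "i \<in> colours" "k \<in> colours" "i' \<in> colours" "k' \<in> colours" "l' \<in> colours" "m' \<in> colours"
    using C C' by blast+
  have "4 / (D + 1) < 1" using D by simp
  then have pos: "0 < factor \<omega> x a" if "a \<in> colours" for a
    using x \<omega> that by (intro factor_pos) auto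
  have L_mono: "L a \<le> L c" if "x a \<le> x c" "a \<in> colours" "c \<in> colours" for a c
    using that pos[of a] pos[of c] \<omega> by (simp add: L_def factor_def mult_left_mono)
  have "g * (L k - L i) + b * (L l - L i) + b * (L m - L i)
      = (g - b) * L k - (g + 3 * b) * L i + b * sum L colours"
    unfolding sum_colours_distinct[OF C] by (simp add: algebra_simps)
  also have "\<dots> \<le> (g - b) * L k' - (g + 3 * b) * L i' + b * sum L colours"
    using b L_mono mi mx in_C by (intro add_mono diff_mono mult_left_mono) auto
  also have "\<dots> = g * (L k' - L i') + b * (L l' - L i') + b * (L m' - L i')"
    unfolding sum_colours_distinct[OF C'] by (simp add: algebra_simps)
  finally have "D * (g * (L k - L i) + b * (L l - L i) + b * (L m - L i))
      \<le> D * (g * (L k' - L i') + b * (L l' - L i') + b * (L m' - L i'))"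
    using D by (intro mult_left_mono) auto
  also have "\<dots> \<le> 2 * g * (D * artanh (1 / D / g))"
    unfolding L_def factor_def g_def
  proof (rule sorted_child_bound)
    show "x k' - x i' \<le> s * (x k' + x i')" using spread in_C by (simp add: spread_def)
    show "sum x colours = x i' + x k' + x l' + x m'" by (rule sum_colours_distinct[OF C'])
  qed (use x mi mx in_C s D \<omega> b in auto)
  finally show ?thesis .
qed

lemma product_bound:
  fixes s \<omega> b :: real and x :: "'j \<Rightarrow> nat \<Rightarrow> real" and d :: nat
  assumes C: "{i, k, l, m} = colours" and J: "finite J" "card J = d" "4 \<le> d"
    and x: "\<And>j a. j \<in> J \<Longrightarrow> a \<in> colours \<Longrightarrow> 0 \<le> x j a" "\<And>j. j \<in> J \<Longrightarrow> 0 < sum (x j) colours"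
    and spread: "\<And>j. j \<in> J \<Longrightarrow> spread s (x j)" and s: "0 < s" "s \<le> 1"
    and \<omega>: "0 \<le> \<omega>" "\<omega> \<le> 4 / (real d + 1)"
  defines "g \<equiv> 1 / s - (1 + 1 / real d) / 2"
  assumes b: "0 \<le> b" "b \<le> g" "b \<le> (1 + 1 / real d) / 2"
  defines "y \<equiv> \<lambda>a. \<Prod>j\<in>J. factor \<omega> (x j) a"
  shows "g * ln (y i / y k) + b * ln (y i / y l) + b * ln (y i / y m)
    \<le> 2 * g * (real d * artanh (1 / real d / g))"
proof -
  have "4 / (real d + 1) < 1" using J by simp
  then have \<omega>1: "\<omega> < 1" using \<omega> by linarith
  have in_C: "i \<in> colours" "k \<in> colours" "l \<in> colours" "m \<in> colours"
    using C by blast+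
  have pos: "0 < factor \<omega> (x j) a" if "j \<in> J" "a \<in> colours" for j a
    using factor_pos[of "x j" \<omega> a] that x \<omega> \<omega>1 by blast
  have ln_y: "ln (y i / y a) = (\<Sum>j\<in>J. - ln (factor \<omega> (x j) a) - - ln (factor \<omega> (x j) i))"
    if "a \<in> colours" for a
  proof -
    have "0 < y i" "0 < y a" unfolding y_def using pos that in_C by (auto intro!: prod_pos)
    then have "ln (y i / y a) = ln (y i) - ln (y a)" by (simp add: ln_div)
    also have "\<dots> = (\<Sum>j\<in>J. ln (factor \<omega> (x j) i)) - (\<Sum>j\<in>J. ln (factor \<omega> (x j) a))"
      unfolding y_def using pos[OF _ that] pos[OF _ in_C(1)] J
      by (subst (1 2) ln_prod) (auto dest: less_imp_neq[symmetric] simp: less_imp_neq[symmetric])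
    finally show ?thesis by (simp add: sum_subtractf sum_negf)
  qed
  have "real d * (g * ln (y i / y k) + b * ln (y i / y l) + b * ln (y i / y m))
    = (\<Sum>j\<in>J. real d * (g * (- ln (factor \<omega> (x j) k) - - ln (factor \<omega> (x j) i))
        + b * (- ln (factor \<omega> (x j) l) - - ln (factor \<omega> (x j) i))
        + b * (- ln (factor \<omega> (x j) m) - - ln (factor \<omega> (x j) i))))"
    by (simp only: ln_y[OF in_C(2)] ln_y[OF in_C(3)] ln_y[OF in_C(4)] sum_distrib_left sum.distrib distrib_left)
  also have "\<dots> \<le> (\<Sum>j\<in>J. 2 * g * (real d * artanh (1 / real d / g)))"
  proof (rule sum_mono)
    fix j assume j: "j \<in> J"
    show "real d * (g * (- ln (factor \<omega> (x j) k) - - ln (factor \<omega> (x j) i))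
        + b * (- ln (factor \<omega> (x j) l) - - ln (factor \<omega> (x j) i))
        + b * (- ln (factor \<omega> (x j) m) - - ln (factor \<omega> (x j) i)))
      \<le> 2 * g * (real d * artanh (1 / real d / g))"
      unfolding g_def
      by (rule child_bound[OF C x(1)[OF j] x(2)[OF j] spread[OF j] s _ \<omega> b(1) _ b(3)])
        (use J b in \<open>simp_all add: g_def\<close>)
  qed
  also have "\<dots> = real d * (2 * g * (real d * artanh (1 / real d / g)))"
    using J by simp
  finally show ?thesis using J by simp
qed

lemma artanh_double:
  fixes r :: real
  assumes "- 1 < r" "r < 1"
  shows "2 * artanh r = artanh (2 * r / (1 + r\<^sup>2))"
proof -
  have "(1 + 2 * r / (1 + r\<^sup>2)) / (1 - 2 * r / (1 + r\<^sup>2)) = ((1 + r) / (1 - r))\<^sup>2"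
  proof -
    have "0 < 1 + r\<^sup>2" by (simp add: add_pos_nonneg)
    then have "1 + 2 * r / (1 + r\<^sup>2) = (1 + r)\<^sup>2 / (1 + r\<^sup>2)" "1 - 2 * r / (1 + r\<^sup>2) = (1 - r)\<^sup>2 / (1 + r\<^sup>2)"
      by (simp_all add: field_simps power2_eq_square)
    then show ?thesis using \<open>0 < 1 + r\<^sup>2\<close> by (simp add: power_divide)
  qed
  moreover have "0 < (1 + r) / (1 - r)" using assms by simp
  ultimately show ?thesis by (simp add: artanh_def ln_realpow)
qed

lemma mean_exp_ge:
  fixes u v :: real
  shows "2 * exp ((u + v) / 2) \<le> exp u + exp v"
proof -
  have "0 \<le> (exp (u / 2) - exp (v / 2))\<^sup>2" by simp
  also have "\<dots> = exp u + exp v - 2 * exp ((u + v) / 2)"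
    by (simp add: power2_eq_square algebra_simps add_divide_distrib flip: exp_add)
  finally show ?thesis by simp
qed

text \<open>Here \<open>e\<close> is the geometric mean of the extreme entries and
  \<open>e * exp m\<close> that of the other two. The quotient decreases in \<open>S\<close> and
  increases in \<open>\<omega>\<close>, so AM-GM for \<open>yl + ym\<close> and the critical
  \<open>\<omega>\<close> give an upper bound, which is the stated value of
  \<open>rho\<close>.\<close>

lemma factor_ratio_eq_rho:
  fixes yi yl ym h \<omega> D :: real
  assumes D: "4 \<le> D" and \<omega>: "0 \<le> \<omega>" "\<omega> \<le> 4 / (D + 1)" and h: "0 \<le> h"
    and yi: "0 < yi" "0 < yl" "0 < ym"
    and yk: "yk = yi * exp (- (2 * h))" and S: "S = yi + yk + yl + ym"
    and m: "m = h - (ln (yi / yl) + ln (yi / ym)) / 2"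
  shows "((S - \<omega> * yk) - (S - \<omega> * yi)) / ((S - \<omega> * yk) + (S - \<omega> * yi)) \<le> rho (1 / D) h m / D"
proof -
  have yk0: "0 < yk" "yk \<le> yi" using yi h by (simp_all add: yk mult_le_cancel_left1)
  define e where "e = yi * exp (- h)"
  have e: "0 < e" using yi by (simp add: e_def)
  have amgm: "2 * (e * exp m) \<le> yl + ym"
  proof -
    have "yi * (2 * exp ((- ln (yi / yl) + - ln (yi / ym)) / 2)) \<le> yi * (exp (- ln (yi / yl)) + exp (- ln (yi / ym)))"
      using yi by (intro mult_left_mono mean_exp_ge) auto
    also have "\<dots> = yl + ym"
      using yi by (simp add: exp_minus field_simps)
    also have "exp ((- ln (yi / yl) + - ln (yi / ym)) / 2) = exp (- h) * exp m"
      by (simp add: m algebra_simps flip: exp_add)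
    finally show ?thesis by (simp add: e_def algebra_simps)
  qed
  have sk: "2 * e * sinh h = yi - yk" and ck: "2 * e * cosh h = yi + yk"
    by (simp_all add: e_def sinh_def cosh_def yk algebra_simps flip: exp_add)
  have den: "0 < 2 * S - \<omega> * (yi + yk)"
  proof -
    have "4 / (D + 1) \<le> 1" using D by simp
    then have "\<omega> * (yi + yk) \<le> 1 * S" using \<omega> yk0 yi S
      by (intro mult_mono) auto
    then show ?thesis using yi yk0 S by simp
  qed
  define Q where "Q = (D - 1) * (yi + yk) + (D + 1) * (2 * (e * exp m))"
  have Q: "0 < Q" unfolding Q_def using D yi yk0 e by (intro add_pos_pos mult_pos_pos) auto
  have "((S - \<omega> * yk) - (S - \<omega> * yi)) / ((S - \<omega> * yk) + (S - \<omega> * yi)) = \<omega> * (yi - yk) / (2 * S - \<omega> * (yi + yk))"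
    by (simp add: algebra_simps)
  also have "\<dots> \<le> 2 * (yi - yk) / Q"
  proof -
    have "(D + 1) * (2 * (e * exp m)) \<le> (D + 1) * (yl + ym)" using amgm D by (intro mult_left_mono) auto
    then have "Q + 2 * (yi + yk) \<le> (D + 1) * S" by (simp add: Q_def S algebra_simps)
    then have "\<omega> * (Q + 2 * (yi + yk)) \<le> 4 / (D + 1) * ((D + 1) * S)"
      using \<omega> D Q yi yk0 by (intro mult_mono) auto
    also have "\<dots> = 4 * S" using D by simp
    finally have "\<omega> * Q \<le> 2 * (2 * S - \<omega> * (yi + yk))" by (simp add: algebra_simps)
    then have "(\<omega> * Q) * (yi - yk) \<le> (2 * (2 * S - \<omega> * (yi + yk))) * (yi - yk)"
      using yk0 by (intro mult_right_mono) auto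
    then have "(\<omega> * (yi - yk)) * Q \<le> (2 * (yi - yk)) * (2 * S - \<omega> * (yi + yk))"
      by (simp add: algebra_simps)
    moreover have "u / a \<le> v / b" if "0 < a" "0 < b" "u * b \<le> v * a" for u v a b :: real
      using that by (simp add: field_simps)
    ultimately show ?thesis using den Q by blast
  qed
  also have "\<dots> = rho (1 / D) h m / D"
  proof -
    have "Q = 2 * e * ((D - 1) * cosh h + (D + 1) * exp m)"
      unfolding Q_def ck[symmetric] by (simp add: algebra_simps)
    moreover have "(1 - 1 / D) * cosh h + (1 + 1 / D) * exp m = ((D - 1) * cosh h + (D + 1) * exp m) / D"
      using D by (simp add: field_simps)
    moreover have "2 * (2 * e * S) / (2 * e * T) = 2 * S / (T / D) / D" for S T
      using e D by simp
    ultimately show ?thesis unfolding sk[symmetric] rho_def by simp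
  qed
  finally show ?thesis .
qed

lemma contraction_constant:
  fixes s :: real
  assumes "0 < s" "s \<le> 1"
  shows "0 < s - s ^ 3 / 100" "s - s ^ 3 / 100 < 1" "s - s ^ 3 / 100 \<le> s"
proof -
  have "s ^ 3 \<le> s ^ 1" using assms by (intro power_decreasing) auto
  then have le: "s ^ 3 \<le> s" by simp
  have pos: "0 < s ^ 3" using assms by simp
  show "0 < s - s ^ 3 / 100" using le assms by linarith
  show "s - s ^ 3 / 100 < 1" using pos assms by linarith
  show "s - s ^ 3 / 100 \<le> s" using pos by linarith
qed

text \<open>Only the linear inequalities for \<open>y\<close> enter, not its product form. For the
  extreme colours \<open>i\<close> and \<open>k\<close> they read
  \<open>g * h + b * v \<le> g * (artanh (\<delta> / g) / \<delta>)\<close>. The best choice is the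
  largest admissible \<open>b\<close>, the minimum of \<open>g\<close> and
  \<open>(1 + \<delta>) / 2\<close>; which of the two it is separates the regimes of
  \<open>rho_bound_small\<close> and \<open>rho_bound_large\<close>.\<close>

lemma second_factor_bound:
  fixes s \<omega> :: real and y :: "nat \<Rightarrow> real" and d :: nat
  assumes d: "4 \<le> d" and s: "0 < s" "s \<le> 1" and \<omega>: "0 \<le> \<omega>" "\<omega> \<le> 4 / (real d + 1)"
    and y: "\<And>a. a \<in> colours \<Longrightarrow> 0 < y a"
  defines "g \<equiv> 1 / s - (1 + 1 / real d) / 2"
  assumes bound: "\<And>b i k l m. {i, k, l, m} = colours \<Longrightarrow> 0 \<le> b \<Longrightarrow> b \<le> g \<Longrightarrow> b \<le> (1 + 1 / real d) / 2 \<Longrightarrow>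
      g * ln (y i / y k) + b * ln (y i / y l) + b * ln (y i / y m)
        \<le> 2 * g * (real d * artanh (1 / real d / g))"
    and a: "a \<in> colours" "a' \<in> colours"
  shows "real d * ln (factor \<omega> y a / factor \<omega> y a') \<le> 2 * artanh (s - s ^ 3 / 100)"
proof -
  define \<delta> where "\<delta> = 1 / real d"
  have \<delta>: "0 < \<delta>" "\<delta> \<le> 1/4" "\<delta> = 1/4 \<or> \<delta> \<le> 1/5"
  proof -
    have "d = 4 \<or> 5 \<le> d" using d by auto
    then show "\<delta> = 1/4 \<or> \<delta> \<le> 1/5" by (auto simp: \<delta>_def field_simps)
  qed (use d in \<open>auto simp: \<delta>_def field_simps\<close>)
  define s' where "s' = s - s ^ 3 / 100"
  have s': "0 < s'" "s' < 1" using contraction_constant[OF s] by (auto simp: s'_def)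
  obtain k i l m where C: "{k, i, l, m} = colours"
    and mn: "\<And>a. a \<in> colours \<Longrightarrow> y k \<le> y a" and mx: "\<And>a. a \<in> colours \<Longrightarrow> y a \<le> y i"
    using obtain_extremes by blast
  have C': "{i, k, l, m} = colours" using C by blast
  have in_C: "i \<in> colours" "k \<in> colours" "l \<in> colours" "m \<in> colours"
    using C by blast+
  have S: "sum y colours = y i + y k + y l + y m" by (rule sum_colours_distinct[OF C'])
  have "4 / (real d + 1) < 1" using d by simp
  then have \<omega>1: "\<omega> < 1" using \<omega> by linarith
  have y0: "\<And>a. a \<in> colours \<Longrightarrow> 0 \<le> y a" "0 < sum y colours"
    using y by (auto simp: less_imp_le intro!: sum_pos)
  have pos: "0 < factor \<omega> y c" if "c \<in> colours" for c
    using factor_pos[OF y0 \<omega>(1) \<omega>1 that] .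
  have "ln (factor \<omega> y a / factor \<omega> y a') \<le> ln (factor \<omega> y k / factor \<omega> y i)"
  proof -
    have "factor \<omega> y a \<le> factor \<omega> y k" "factor \<omega> y i \<le> factor \<omega> y a'"
      unfolding factor_def using mn[OF a(1)] mx[OF a(2)] \<omega> by (auto intro: mult_left_mono)
    then have "factor \<omega> y a / factor \<omega> y a' \<le> factor \<omega> y k / factor \<omega> y i"
      using pos a in_C by (intro frac_le) (auto simp: less_imp_le)
    then show ?thesis using pos a in_C by (subst ln_le_cancel_iff) auto
  qed
  also have "real d * ln (factor \<omega> y k / factor \<omega> y i) \<le> 2 * artanh s'"
  proof (cases "y k = y i")
    case True
    then have "factor \<omega> y k / factor \<omega> y i = 1" using pos[OF in_C(1)] by (simp add: factor_def)
    then show ?thesis using artanh_nonneg_real[of s'] s' by simp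
  next
    case False
    define h where "h = ln (y i / y k) / 2"
    define v where "v = (ln (y i / y l) + ln (y i / y m)) / 2"
    define m' where "m' = h - v"
    have yik: "y k < y i" using False mn[OF in_C(1)] by simp
    have h: "0 < h" using yik y[OF in_C(2)] by (simp add: h_def)
    have v: "0 \<le> ln (y i / y c) \<and> ln (y i / y c) \<le> 2 * h" if "c \<in> colours" for c
    proof -
      have "y i / y c \<le> y i / y k" using y in_C that mn by (intro divide_left_mono) (auto simp: less_imp_le)
      then have "ln (y i / y c) \<le> ln (y i / y k)" using y in_C that by (subst ln_le_cancel_iff) auto
      moreover have "1 \<le> y i / y c" using y[OF that] mx[OF that] by simp
      ultimately show ?thesis by (simp add: h_def)
    qed
    have m': "\<bar>m'\<bar> \<le> h" using v[OF in_C(3)] v[OF in_C(4)] by (auto simp: m'_def v_def abs_le_iff field_simps)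
    have g\<delta>: "g = 1 / s - (1 + \<delta>) / 2" by (simp add: g_def \<delta>_def)
    have Aeq: "real d * artanh (1 / real d / g) = artanh (\<delta> / g) / \<delta>" by (simp add: \<delta>_def)
    have "1 \<le> 1 / s" using s by simp
    then have g: "0 < g" using \<delta> by (simp add: g\<delta>)
    have bnd: "g * h + b * v \<le> g * (artanh (\<delta> / g) / \<delta>)" if "0 \<le> b" "b \<le> g" "b \<le> (1 + \<delta>) / 2" for b
      using bound[OF C' that(1,2)] that(3) unfolding Aeq by (simp add: \<delta>_def h_def v_def field_simps)
    define r where "r = rho \<delta> h m'"
    have r0: "0 \<le> r" unfolding r_def rho_def
      using h rho_denominator_pos[of \<delta> h m'] \<delta> by (intro divide_nonneg_nonneg) auto
    have half: "z / 2 \<le> t - z / 2" if "z \<le> t" for t z :: real using that by (simp add: field_simps)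
    have half': "t - z / 2 \<le> z / 2" if "t < z" for t z :: real using that by (simp add: field_simps)
    have r: "r < 2 \<and> r / (1 + r\<^sup>2 / 4) \<le> s'"
    proof (cases "s * (1 + \<delta>) \<le> 1")
      case True
      have "(1 + \<delta>) \<le> 1 / s" using True s by (simp add: field_simps)
      then have "(1 + \<delta>) / 2 \<le> g" unfolding g\<delta> by (rule half)
      then have "g * h + (1 + \<delta>) / 2 * v \<le> g * (artanh (\<delta> / g) / \<delta>)"
        using \<delta> by (intro bnd) auto
      moreover have "h / s = g * h + (1 + \<delta>) / 2 * v + (1 + \<delta>) * m' / 2"
        by (simp add: g\<delta> m'_def field_simps)
      ultimately have "h / s \<le> g * (artanh (\<delta> / g) / \<delta>) + (1 + \<delta>) * m' / 2" by simp
      from rho_bound_small[OF \<delta>(1,2) s(1) True h m' this[unfolded g\<delta>]]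
      have r1: "r \<le> s + s ^ 3 / 5" by (simp add: r_def)
      have s2: "s + s ^ 3 / 5 < 2" using s power_le_one[of s 3] by simp
      have "r / (1 + r\<^sup>2 / 4) \<le> (s + s ^ 3 / 5) / (1 + (s + s ^ 3 / 5)\<^sup>2 / 4)"
        using r0 r1 s2 by (intro damped_mono) auto
      also have "\<dots> \<le> s'" unfolding s'_def by (rule damped_small[OF s])
      finally show ?thesis using r1 s2 by simp
    next
      case False
      then have "1 / s < 1 + \<delta>" using s by (simp add: field_simps)
      then have "g \<le> (1 + \<delta>) / 2" unfolding g\<delta> by (rule half')
      then have "g * h + g * v \<le> g * (artanh (\<delta> / g) / \<delta>)"
        using g by (intro bnd) auto
      then have "g * (h + v) \<le> g * (artanh (\<delta> / g) / \<delta>)" by (simp only: distrib_left)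
      then have "h + v \<le> artanh (\<delta> / g) / \<delta>" by (rule mult_left_le_imp_le[OF _ g])
      then have "2 * h - m' \<le> artanh (\<delta> / g) / \<delta>" by (simp add: m'_def)
      from rho_bound_large[OF \<delta>(1,3) s(2) _ h this[unfolded g\<delta>]] False
      show ?thesis by (simp add: r_def s'_def)
    qed
    have yk: "y k = y i * exp (- (2 * h))"
      using y[OF in_C(1)] y[OF in_C(2)] by (simp add: h_def exp_minus)
    have "ln (factor \<omega> y k / factor \<omega> y i)
        = 2 * artanh ((factor \<omega> y k - factor \<omega> y i) / (factor \<omega> y k + factor \<omega> y i))"
      using pos in_C by (intro ln_ratio_eq_artanh) auto
    also have "artanh ((factor \<omega> y k - factor \<omega> y i) / (factor \<omega> y k + factor \<omega> y i)) \<le> artanh (r / real d)"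
    proof (rule artanh_mono_real)
      show "(factor \<omega> y k - factor \<omega> y i) / (factor \<omega> y k + factor \<omega> y i) \<le> r / real d"
        unfolding factor_def r_def \<delta>_def
        using d \<omega> h y in_C yk S by (intro factor_ratio_eq_rho) (auto simp: m'_def v_def)
      show "- 1 < (factor \<omega> y k - factor \<omega> y i) / (factor \<omega> y k + factor \<omega> y i)"
        using pos[OF in_C(1)] pos[OF in_C(2)] by (simp add: pos_less_divide_eq)
      show "r / real d < 1" using r d by simp
    qed
    finally have "real d * ln (factor \<omega> y k / factor \<omega> y i) \<le> real d * (2 * artanh (r / real d))"
      by (intro mult_left_mono) auto
    \<comment> \<open>As \<open>n * artanh (r / n)\<close> decreases in \<open>n\<close>, the
      \<open>d\<close> factors may be replaced by two, for which the duplication formula gives a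
      closed form.\<close>
    also have "\<dots> \<le> 2 * (2 * artanh (r / 2))"
    proof -
      have "r / 2 * artanh (r / real d) \<le> r / real d * artanh (r / 2)"
        using r r0 d by (intro artanh_le_linear divide_left_mono) auto
      then show ?thesis using r0 d by (cases "r = 0") (simp_all add: field_simps)
    qed
    also have "2 * artanh (r / 2) = artanh (r / (1 + r\<^sup>2 / 4))"
      using artanh_double[of "r / 2"] r r0 by (simp add: power_divide)
    also have "2 * artanh (r / (1 + r\<^sup>2 / 4)) \<le> 2 * artanh s'"
    proof -
      have "0 \<le> r / (1 + r\<^sup>2 / 4)" using r0 by (intro divide_nonneg_nonneg add_nonneg_nonneg) auto
      then show ?thesis using r s' artanh_mono_real[of "r / (1 + r\<^sup>2 / 4)" s'] by simp
    qed
    finally show ?thesis .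
  qed
  finally show ?thesis
    using d by (simp add: s'_def mult_left_mono)
qed

text \<open>Each of the \<open>d\<close> factors contributes at most
  \<open>2 * artanh (s - s ^ 3 / 100) / d\<close> to a log ratio of the product.\<close>

theorem two_step_contraction:
  fixes s \<omega> :: real and x :: "'i \<Rightarrow> 'j \<Rightarrow> nat \<Rightarrow> real" and d :: nat
  assumes I: "finite I" "card I = d" and J: "\<And>i. i \<in> I \<Longrightarrow> finite (J i)" "\<And>i. i \<in> I \<Longrightarrow> card (J i) = d"
    and d: "4 \<le> d" and s: "0 < s" "s \<le> 1" and \<omega>: "0 \<le> \<omega>" "\<omega> \<le> 4 / (real d + 1)"
    and x: "\<And>i j a. i \<in> I \<Longrightarrow> j \<in> J i \<Longrightarrow> a \<in> colours \<Longrightarrow> 0 \<le> x i j a"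
      "\<And>i j. i \<in> I \<Longrightarrow> j \<in> J i \<Longrightarrow> 0 < sum (x i j) colours"
    and spread: "\<And>i j. i \<in> I \<Longrightarrow> j \<in> J i \<Longrightarrow> spread s (x i j)"
  shows "spread (s - s ^ 3 / 100) (\<lambda>a. \<Prod>i\<in>I. factor \<omega> (\<lambda>b. \<Prod>j\<in>J i. factor \<omega> (x i j) b) a)"
proof -
  define y where "y = (\<lambda>i b. \<Prod>j\<in>J i. factor \<omega> (x i j) b)"
  define z where "z = (\<lambda>a. \<Prod>i\<in>I. factor \<omega> (y i) a)"
  define s' where "s' = s - s ^ 3 / 100"
  have s': "0 < s'" "s' < 1" using contraction_constant[OF s] by (auto simp: s'_def)
  have "4 / (real d + 1) < 1" using d by simp
  then have \<omega>1: "\<omega> < 1" using \<omega> by linarith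
  have y_pos: "0 < y i a" if "i \<in> I" "a \<in> colours" for i a
    unfolding y_def using factor_pos[OF x(1) x(2) \<omega>(1) \<omega>1] that by (intro prod_pos) blast
  have sum_pos: "0 < sum (y i) colours" if "i \<in> I" for i
    using y_pos[OF that] by (intro sum_pos) auto
  have f_pos: "0 < factor \<omega> (y i) a" if "i \<in> I" "a \<in> colours" for i a
    using factor_pos[of "y i" \<omega> a] y_pos sum_pos that \<omega> \<omega>1 by (auto simp: less_imp_le)
  have z_pos: "0 < z a" if "a \<in> colours" for a
    unfolding z_def using f_pos that by (intro prod_pos) auto
  have ratio: "real d * ln (factor \<omega> (y i) a / factor \<omega> (y i) a') \<le> 2 * artanh s'"
    if i: "i \<in> I" and a: "a \<in> colours" "a' \<in> colours" for i a a'
    unfolding s'_def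
  proof (rule second_factor_bound[OF d s \<omega> y_pos[OF i] _ a])
    fix b i' k l m
    assume C: "{i', k, l, m} = colours" and b: "0 \<le> b" "b \<le> 1 / s - (1 + 1 / real d) / 2"
      "b \<le> (1 + 1 / real d) / 2"
    show "(1 / s - (1 + 1 / real d) / 2) * ln (y i i' / y i k) + b * ln (y i i' / y i l) + b * ln (y i i' / y i m)
      \<le> 2 * (1 / s - (1 + 1 / real d) / 2) * (real d * artanh (1 / real d / (1 / s - (1 + 1 / real d) / 2)))"
      unfolding y_def
      by (rule product_bound[OF C J(1)[OF i] J(2)[OF i] d x(1)[OF i] x(2)[OF i] spread[OF i] s \<omega> b])
  qed
  have ln_z: "ln (z a / z a') \<le> 2 * artanh s'" if a: "a \<in> colours" "a' \<in> colours" for a a'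
  proof -
    have ne: "factor \<omega> (y i) c \<noteq> 0" if "i \<in> I" "c \<in> colours" for i c
      using f_pos[OF that] by simp
    have "z a / z a' = (\<Prod>i\<in>I. factor \<omega> (y i) a / factor \<omega> (y i) a')"
      by (simp add: z_def prod_dividef)
    then have "ln (z a / z a') = (\<Sum>i\<in>I. ln (factor \<omega> (y i) a / factor \<omega> (y i) a'))"
      using I ne a by (simp add: ln_prod)
    then have "real d * ln (z a / z a') = (\<Sum>i\<in>I. real d * ln (factor \<omega> (y i) a / factor \<omega> (y i) a'))"
      by (simp add: sum_distrib_left)
    also have "\<dots> \<le> (\<Sum>i\<in>I. 2 * artanh s')" using ratio a by (intro sum_mono) auto
    also have "\<dots> = real d * (2 * artanh s')" using I by simp
    finally show ?thesis using d by simp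
  qed
  have "spread s' z"
    unfolding spread_def
  proof (intro ballI)
    fix a b assume ab: "a \<in> colours" "b \<in> colours"
    have "ln (z a / z b) \<le> ln ((1 + s') / (1 - s'))"
      using ln_z[OF ab] by (simp add: artanh_def)
    then have "z a / z b \<le> (1 + s') / (1 - s')"
      using z_pos ab s' by (subst (asm) ln_le_cancel_iff) auto
    then have "z a * (1 - s') \<le> (1 + s') * z b"
      using z_pos[OF ab(2)] s' by (simp add: field_simps)
    then show "z a - z b \<le> s' * (z a + z b)" by (simp add: algebra_simps)
  qed
  then show ?thesis by (simp add: s'_def z_def y_def)
qed
section \<open>Rooted regular trees\<close>

lemma successively_relpow:
  assumes "successively (\<lambda>u v. (u, v) \<in> R) p" "p \<noteq> []"
  shows "(hd p, last p) \<in> R ^^ (length p - 1)"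
  using assms
proof (induction p rule: rev_induct)
  case (snoc x p)
  show ?case
  proof (cases "p = []")
    case False
    then have "(hd p, last p) \<in> R ^^ (length p - 1)" "(last p, x) \<in> R"
      using snoc by (auto simp: successively_append_iff)
    then have "(hd p, x) \<in> R ^^ Suc (length p - 1)" by auto
    moreover have "Suc (length p - 1) = length p" using False by (cases p) auto
    ultimately show ?thesis using False by simp
  qed auto
qed simp

text \<open>When a new endpoint already lies on the walk, the walk is cut there. The control of
  \<open>set p\<close> keeps the walk in the region where \<open>R\<close> lives.\<close>

lemma rtrancl_distinct_walk:
  assumes "(u, v) \<in> R\<^sup>*"
  obtains p where "p \<noteq> []" "hd p = u" "last p = v" "distinct p"
    "successively (\<lambda>x y. (x, y) \<in> R) p" "set p \<subseteq> insert u (Range R)"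
proof -
  have "\<exists>p. p \<noteq> [] \<and> hd p = u \<and> last p = v \<and> distinct p
      \<and> successively (\<lambda>x y. (x, y) \<in> R) p \<and> set p \<subseteq> insert u (Range R)"
    using assms
  proof (induction rule: rtrancl_induct)
    case base
    show ?case by (intro exI[of _ "[u]"]) auto
  next
    case (step y z)
    then obtain p where p: "p \<noteq> []" "hd p = u" "last p = y" "distinct p"
      "successively (\<lambda>x y. (x, y) \<in> R) p" "set p \<subseteq> insert u (Range R)"
      by blast
    show ?case
    proof (cases "z \<in> set p")
      case True
      then obtain xs ys where eq: "p = xs @ z # ys" by (meson split_list)
      then have "hd (xs @ [z]) = u" using p(2) by (cases xs) auto
      then show ?thesis
        using p eq by (intro exI[of _ "xs @ [z]"]) (auto simp: successively_append_iff)
    next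
      case False
      have "hd (p @ [z]) = u" using p by simp
      then show ?thesis
        using p step False by (intro exI[of _ "p @ [z]"]) (auto simp: successively_append_iff)
    qed
  qed
  then show thesis using that by blast
qed

locale rooted_regular_tree =
  fixes d :: nat and V :: "'v set" and E :: "'v set set" and r :: 'v
  assumes regular_tree: "infinite_regular_tree (d + 1) V E"
    and root: "r \<in> V" and d_pos: "1 \<le> d"
begin

definition adj :: "('v \<times> 'v) set" where
  "adj = {(u, v). u \<in> V \<and> v \<in> V \<and> {u, v} \<in> E}"

definition level :: "'v \<Rightarrow> nat" where
  "level v = (LEAST n. (r, v) \<in> adj ^^ n)"

definition sphere :: "nat \<Rightarrow> 'v set" where
  "sphere n = {v \<in> V. level v = n}"

definition ball :: "nat \<Rightarrow> 'v set" where
  "ball n = {v \<in> V. level v \<le> n}"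

definition children :: "'v \<Rightarrow> 'v set" where
  "children v = {u \<in> sphere (Suc (level v)). (v, u) \<in> adj}"

lemma adj_sym: "(u, v) \<in> adj \<Longrightarrow> (v, u) \<in> adj"
  by (auto simp: adj_def insert_commute)

lemma edge_subset: "e \<in> E \<Longrightarrow> e \<subseteq> V" and edge_card: "e \<in> E \<Longrightarrow> card e = 2"
  using regular_tree by (auto simp: infinite_regular_tree_def is_tree_def simple_graph_def)

lemma adj_irrefl: "(v, v) \<notin> adj"
  using edge_card[of "{v, v}"] by (auto simp: adj_def)

lemma edgeE:
  assumes "e \<in> E" obtains u v where "e = {u, v}" "(u, v) \<in> adj"
proof -
  obtain u v where "e = {u, v}" using edge_card[OF assms] by (auto simp: card_2_iff)
  then show ?thesis using that[of u v] assms edge_subset[OF assms] by (auto simp: adj_def)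
qed

lemma no_cycle: "\<not> is_cycle V E p"
  using regular_tree by (auto simp: infinite_regular_tree_def is_tree_def)

lemma reachable:
  assumes "v \<in> V" shows "\<exists>n. (r, v) \<in> adj ^^ n"
proof -
  have "connected_graph V E" using regular_tree by (auto simp: infinite_regular_tree_def is_tree_def)
  then obtain p where p: "is_walk V E p" "hd p = r" "last p = v"
    using assms root unfolding connected_graph_def by metis
  have "successively (\<lambda>u v. (u, v) \<in> adj) p" if "set p \<subseteq> V" "successively (\<lambda>u v. {u, v} \<in> E) p" for p
    using that by (induction p rule: induct_list012) (auto simp: adj_def)
  then have "successively (\<lambda>u v. (u, v) \<in> adj) p"
    using p(1) unfolding is_walk_def by blast
  from successively_relpow[OF this] p show ?thesis by (auto simp: is_walk_def)
qed

lemma relpow_level: "v \<in> V \<Longrightarrow> (r, v) \<in> adj ^^ level v"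
  unfolding level_def by (rule LeastI_ex) (rule reachable)

lemma level_le: "(r, v) \<in> adj ^^ n \<Longrightarrow> level v \<le> n"
  unfolding level_def by (rule Least_le)

lemma level_root [simp]: "level r = 0"
  using level_le[of r 0] by simp

lemma level_eq_0_iff: "v \<in> V \<Longrightarrow> level v = 0 \<longleftrightarrow> v = r"
  using relpow_level[of v] by auto

lemma level_adj_le:
  assumes "(u, v) \<in> adj" shows "level v \<le> Suc (level u)"
proof -
  have "(r, u) \<in> adj ^^ level u" using assms by (intro relpow_level) (auto simp: adj_def)
  then have "(r, v) \<in> adj ^^ Suc (level u)" using assms by auto
  then show ?thesis by (rule level_le)
qed

lemma parent_exists:
  assumes "v \<in> V" "level v = Suc n"
  shows "\<exists>u. (u, v) \<in> adj \<and> level u = n"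
proof -
  obtain u where u: "(r, u) \<in> adj ^^ n" "(u, v) \<in> adj"
    using relpow_level[OF assms(1)] assms(2) by auto
  then have "level u \<le> n" "level v \<le> Suc (level u)" by (auto intro: level_le level_adj_le)
  then show ?thesis using u assms(2) by auto
qed

text \<open>Both neighbours descend to the root inside \<open>W\<close>, which omits
  \<open>v\<close>; a walk joining them there closes to a cycle through \<open>v\<close>. Allowing
  equal levels also excludes edges within a sphere.\<close>

lemma lower_neighbour_unique:
  assumes u1: "(u1, v) \<in> adj" "level u1 \<le> level v" and u2: "(u2, v) \<in> adj" "level u2 \<le> level v"
  shows "u1 = u2"
proof (rule ccontr)
  assume neq: "u1 \<noteq> u2"
  define W where "W = {x \<in> V. level x \<le> level v \<and> x \<noteq> v}"
  define R where "R = adj \<inter> W \<times> W"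
  have u_W: "u1 \<in> W" "u2 \<in> W"
    using u1 u2 adj_irrefl by (auto simp: W_def adj_def)
  have to_root: "(x, r) \<in> R\<^sup>*" if "x \<in> W" for x
    using that
  proof (induction "level x" arbitrary: x)
    case 0
    then show ?case using level_eq_0_iff by (auto simp: W_def)
  next
    case (Suc n)
    then obtain y where y: "(y, x) \<in> adj" "level y = n"
      using parent_exists[of x n] by (auto simp: W_def)
    have "y \<in> W" using y Suc.hyps(2) Suc.prems by (auto simp: W_def adj_def)
    then have "(x, y) \<in> R" using y Suc.prems adj_sym by (auto simp: R_def)
    then show ?case using Suc.hyps(1)[OF y(2)[symmetric] \<open>y \<in> W\<close>]
      by (rule converse_rtrancl_into_rtrancl)
  qed
  have "sym R" using adj_sym by (auto simp: sym_def R_def)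
  then have "(r, u2) \<in> R\<^sup>*" using to_root[OF u_W(2)] sym_rtrancl by (metis symD)
  then have "(u1, u2) \<in> R\<^sup>*" using to_root[OF u_W(1)] by simp
  then obtain p where p: "p \<noteq> []" "hd p = u1" "last p = u2" "distinct p"
    "successively (\<lambda>x y. (x, y) \<in> R) p" "set p \<subseteq> insert u1 (Range R)"
    by (rule rtrancl_distinct_walk)
  have pW: "set p \<subseteq> W" using p(6) u_W by (auto simp: R_def)
  have "2 \<le> length p" using p neq by (cases p; cases "tl p") auto
  have "successively (\<lambda>u v. {u, v} \<in> E) p"
    using p(5) by (rule successively_mono) (auto simp: R_def adj_def)
  moreover have "{v, hd p} \<in> E" "{last p, v} \<in> E" "v \<in> V"
    using u1(1) u2(1) p(2,3) by (auto simp: adj_def insert_commute)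
  ultimately have "is_cycle V E (v # p)"
    using p(1,4) pW \<open>2 \<le> length p\<close>
    by (auto simp: is_cycle_def is_walk_def W_def successively_Cons)
  then show False using no_cycle by blast
qed

lemma neighbours: "v \<in> V \<Longrightarrow> finite {u. (u, v) \<in> adj}" "v \<in> V \<Longrightarrow> card {u. (u, v) \<in> adj} = d + 1"
proof -
  assume v: "v \<in> V"
  have "{u. (u, v) \<in> adj} = {u \<in> V. {u, v} \<in> E}" using v by (auto simp: adj_def)
  then show "finite {u. (u, v) \<in> adj}" "card {u. (u, v) \<in> adj} = d + 1"
    using regular_tree v by (auto simp: infinite_regular_tree_def)
qed

lemma finite_children: "v \<in> V \<Longrightarrow> finite (children v)"
  by (rule finite_subset[OF _ neighbours(1)]) (auto simp: children_def intro: adj_sym)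

lemma card_children:
  assumes "v \<in> V" "v \<noteq> r" shows "card (children v) = d"
proof -
  obtain n where n: "level v = Suc n" using level_eq_0_iff[OF assms(1)] assms(2) by (cases "level v") auto
  then obtain p where p: "(p, v) \<in> adj" "level p = n" using parent_exists assms by blast
  have "{u. (u, v) \<in> adj} = insert p (children v)"
  proof (intro set_eqI iffI)
    fix u assume "u \<in> {u. (u, v) \<in> adj}"
    then have u: "(u, v) \<in> adj" by simp
    show "u \<in> insert p (children v)"
    proof (cases "level u \<le> level v")
      case True
      then show ?thesis using lower_neighbour_unique[OF u True p(1)] p n by simp
    next
      case False
      then show ?thesis using u level_adj_le[OF adj_sym[OF u]]
        by (auto simp: children_def sphere_def adj_def insert_commute)
    qed
  qed (auto simp: p children_def adj_sym)
  moreover have "p \<notin> children v" using p n by (auto simp: children_def sphere_def)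
  ultimately show ?thesis using neighbours(2)[OF assms(1)] finite_children[OF assms(1)] by simp
qed

lemma card_children_root: "card (children r) = d + 1"
proof -
  have "{u. (u, r) \<in> adj} = children r"
  proof (intro set_eqI iffI)
    fix u assume "u \<in> {u. (u, r) \<in> adj}"
    then have u: "(u, r) \<in> adj" by simp
    then have "u \<noteq> r" "u \<in> V" using adj_irrefl by (auto simp: adj_def)
    then have "level u = 1" using level_adj_le[OF adj_sym[OF u]] level_eq_0_iff[of u] by auto
    then show "u \<in> children r" using adj_sym[OF u] \<open>u \<in> V\<close> by (simp add: children_def sphere_def)
  qed (auto simp: children_def adj_sym)
  then show ?thesis using neighbours(2)[OF root] by simp
qed

lemma children_nonempty: "v \<in> V \<Longrightarrow> children v \<noteq> {}"
  using card_children[of v] card_children_root d_pos by (cases "v = r") force+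

lemma sphere_0: "sphere 0 = {r}"
  using root level_eq_0_iff by (auto simp: sphere_def)

lemma ball_0: "ball 0 = {r}"
  using root level_eq_0_iff by (auto simp: ball_def)

lemma sphere_Suc: "sphere (Suc n) = (\<Union>v\<in>sphere n. children v)"
proof (intro set_eqI iffI)
  fix u assume u: "u \<in> sphere (Suc n)"
  then obtain v where "(v, u) \<in> adj" "level v = n" using parent_exists[of u n] by (auto simp: sphere_def)
  then show "u \<in> (\<Union>v\<in>sphere n. children v)" using u by (auto simp: children_def sphere_def adj_def)
qed (auto simp: children_def sphere_def)

lemma children_disjoint: "v \<noteq> v' \<Longrightarrow> children v \<inter> children v' = {}"
proof (rule ccontr)
  assume neq: "v \<noteq> v'" and "children v \<inter> children v' \<noteq> {}"
  then obtain u where "u \<in> children v" "u \<in> children v'" by auto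
  then have "(v, u) \<in> adj" "(v', u) \<in> adj" "level v \<le> level u" "level v' \<le> level u"
    by (auto simp: children_def sphere_def)
  then show False using lower_neighbour_unique neq by blast
qed

lemma finite_sphere: "finite (sphere n)"
  by (induction n) (auto simp: sphere_0 sphere_Suc intro!: finite_children, auto simp: sphere_def)

lemma ball_Suc: "ball (Suc n) = ball n \<union> sphere (Suc n)"
  by (auto simp: ball_def sphere_def)

lemma ball_sphere_disjoint: "ball n \<inter> sphere (Suc n) = {}"
  by (auto simp: ball_def sphere_def)

lemma sphere_subset_ball: "sphere n \<subseteq> ball n"
  by (auto simp: ball_def sphere_def)

lemma finite_ball: "finite (ball n)"
  by (induction n) (auto simp: ball_0 ball_Suc finite_sphere)

lemma ball_mono: "m \<le> n \<Longrightarrow> ball m \<subseteq> ball n"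
  by (auto simp: ball_def)

lemma ball_subset: "ball n \<subseteq> V"
  by (auto simp: ball_def)

lemma finite_subset_ball:
  assumes "finite U" "U \<subseteq> V" obtains n where "U \<subseteq> ball n"
proof
  show "U \<subseteq> ball (Max (level ` U))" using assms by (auto simp: ball_def)
qed

text \<open>An edge reaching the new sphere has its other end one level below, since no edge lies
  within a sphere.\<close>

lemma edges_ball_Suc:
  "{e \<in> E. e \<subseteq> ball (Suc n)} = {e \<in> E. e \<subseteq> ball n} \<union> (\<Union>v\<in>sphere n. (\<lambda>u. {v, u}) ` children v)"
  (is "?L = ?R")
proof (intro set_eqI iffI)
  fix e assume e: "e \<in> ?L"
  then obtain u v where uv: "e = {u, v}" "(u, v) \<in> adj" using edgeE by blast
  have *: "{u, v} \<in> ?R" if "(u, v) \<in> adj" "level u \<le> level v" "{u, v} \<subseteq> ball (Suc n)" for u v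
  proof (cases "level v \<le> n")
    case True
    then show ?thesis using that by (auto simp: ball_def adj_def)
  next
    case False
    then have v: "level v = Suc n" "v \<in> V" using that by (auto simp: ball_def)
    then obtain p where p: "(p, v) \<in> adj" "level p = n" using parent_exists by blast
    then have "u = p" using lower_neighbour_unique[of u v p] that v by simp
    then show ?thesis using p v by (auto simp: children_def sphere_def adj_def)
  qed
  show "e \<in> ?R"
    using *[of u v] *[of v u] uv adj_sym[OF uv(2)] e by (cases "level u \<le> level v") (auto simp: insert_commute)
next
  fix e assume "e \<in> ?R"
  then show "e \<in> ?L"
    by (auto simp: ball_def children_def sphere_def adj_def)
qed

lemma inner_boundary_ball: "inner_boundary V E (ball n) = sphere n"
proof (intro set_eqI iffI)
  fix u assume "u \<in> inner_boundary V E (ball n)"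
  then obtain v where "u \<in> ball n" "v \<in> V - ball n" "{u, v} \<in> E" by (auto simp: inner_boundary_def)
  then have "(u, v) \<in> adj" "level u \<le> n" "n < level v" "u \<in> V" by (auto simp: ball_def adj_def)
  then show "u \<in> sphere n" using level_adj_le[of u v] by (auto simp: sphere_def)
next
  fix u assume u: "u \<in> sphere n"
  then obtain v where "v \<in> children u" using children_nonempty[of u] by (auto simp: sphere_def)
  then show "u \<in> inner_boundary V E (ball n)"
    using u by (auto simp: inner_boundary_def children_def sphere_def ball_def adj_def)
qed

end
section \<open>Partition functions and messages\<close>

lemma potts_weight_cong:
  assumes "\<And>v. v \<in> U \<Longrightarrow> \<sigma> v = \<sigma>' v"
  shows "potts_weight w E U \<sigma> = potts_weight w E U \<sigma>'"
proof -
  have "(\<forall>u\<in>e. \<forall>v\<in>e. \<sigma> u = \<sigma> v) \<longleftrightarrow> (\<forall>u\<in>e. \<forall>v\<in>e. \<sigma>' u = \<sigma>' v)" if e: "e \<subseteq> U" for e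
  proof (intro ball_cong refl)
    fix u v assume "u \<in> e" "v \<in> e"
    then have "\<sigma> u = \<sigma>' u" "\<sigma> v = \<sigma>' v" using e assms by blast+
    then show "(\<sigma> u = \<sigma> v) = (\<sigma>' u = \<sigma>' v)" by (simp only:)
  qed
  then have "monochromatic_edges E U \<sigma> = monochromatic_edges E U \<sigma>'"
    unfolding monochromatic_edges_def by (intro Collect_cong conj_cong refl)
  then show ?thesis by (simp add: potts_weight_def)
qed

lemma potts_weight_pos: "0 < w \<Longrightarrow> 0 < potts_weight w E U \<sigma>"
  and potts_weight_nonneg: "0 \<le> w \<Longrightarrow> 0 \<le> potts_weight w E U \<sigma>"
  by (auto simp: potts_weight_def)

abbreviation interaction :: "real \<Rightarrow> nat \<Rightarrow> nat \<Rightarrow> real" where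
  "interaction w a b \<equiv> (if a = b then w else 1)"

lemma prod_interaction:
  "finite A \<Longrightarrow> (\<Prod>x\<in>A. interaction w (f x) (g x)) = w ^ card {x \<in> A. f x = g x}"
  by (simp add: prod.If_cases Int_def)

context rooted_regular_tree
begin

lemma prod_sphere_Suc:
  fixes h :: "'v \<Rightarrow> 'b::comm_monoid_mult"
  shows "(\<Prod>u\<in>sphere (Suc n). h u) = (\<Prod>v\<in>sphere n. \<Prod>u\<in>children v. h u)"
  unfolding sphere_Suc
  by (rule prod.UNION_disjoint) (use finite_sphere finite_children children_disjoint in \<open>auto simp: sphere_def\<close>)

lemma potts_weight_ball_Suc:
  "potts_weight w E (ball (Suc n)) \<sigma> = potts_weight w E (ball n) \<sigma> *
     (\<Prod>v\<in>sphere n. \<Prod>u\<in>children v. interaction w (\<sigma> v) (\<sigma> u))"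
proof -
  \<comment> \<open>New monochromatic edges are counted as ordered parent-child pairs, so that their
    number splits into a sum over the parents.\<close>
  define P where "P = (SIGMA v:sphere n. {u \<in> children v. \<sigma> v = \<sigma> u})"
  define M where "M = monochromatic_edges E (ball n) \<sigma>"
  have finP: "finite P"
    unfolding P_def using finite_sphere finite_children by (intro finite_SigmaI) (auto simp: sphere_def)
  have finM: "finite M"
    by (rule finite_subset[of _ "Pow (ball n)"]) (auto simp: M_def monochromatic_edges_def finite_ball)
  have out: "u \<notin> ball n" "v \<in> ball n" if "(v, u) \<in> P" for u v
    using that by (auto simp: P_def children_def sphere_def ball_def)
  have "monochromatic_edges E (ball (Suc n)) \<sigma>
      = {e \<in> {e \<in> E. e \<subseteq> ball (Suc n)}. \<forall>u\<in>e. \<forall>v\<in>e. \<sigma> u = \<sigma> v}"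
    by (auto simp: monochromatic_edges_def)
  also have "\<dots> = M \<union> (\<lambda>(v, u). {v, u}) ` P"
    unfolding edges_ball_Suc by (auto simp: M_def monochromatic_edges_def P_def)
  finally have eq: "monochromatic_edges E (ball (Suc n)) \<sigma> = M \<union> (\<lambda>(v, u). {v, u}) ` P" .
  have "(u, v) \<notin> P" if "(v, u) \<in> P" for u v
    using out that by blast
  then have inj: "inj_on (\<lambda>(v, u). {v, u}) P"
    by (auto simp: inj_on_def doubleton_eq_iff)
  have "M \<inter> (\<lambda>(v, u). {v, u}) ` P = {}"
    using out by (auto simp: M_def monochromatic_edges_def)
  then have "card (monochromatic_edges E (ball (Suc n)) \<sigma>) = card M + card P"
    unfolding eq using finM finP inj by (subst card_Un_disjoint) (auto simp: card_image)
  also have "card P = (\<Sum>v\<in>sphere n. card {u \<in> children v. \<sigma> v = \<sigma> u})"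
    unfolding P_def using finite_sphere finite_children by (intro card_SigmaI) (auto simp: sphere_def)
  finally have "potts_weight w E (ball (Suc n)) \<sigma>
      = w ^ card M * (\<Prod>v\<in>sphere n. w ^ card {u \<in> children v. \<sigma> v = \<sigma> u})"
    by (simp add: potts_weight_def power_add power_sum)
  also have "(\<Prod>v\<in>sphere n. w ^ card {u \<in> children v. \<sigma> v = \<sigma> u})
      = (\<Prod>v\<in>sphere n. \<Prod>u\<in>children v. interaction w (\<sigma> v) (\<sigma> u))"
    by (intro prod.cong refl prod_interaction[symmetric] finite_children) (auto simp: sphere_def)
  finally show ?thesis by (simp add: potts_weight_def M_def)
qed

definition configs :: "'v set \<Rightarrow> ('v \<Rightarrow> nat) set" where
  "configs U = colourings U"

lemma finite_configs: "finite U \<Longrightarrow> finite (configs U)"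
  unfolding configs_def by (intro finite_PiE) auto

text \<open>The recursion is left unnormalised, so that its iterates express partial sums of weights
  exactly.\<close>

definition message_step :: "real \<Rightarrow> ('v \<Rightarrow> nat \<Rightarrow> real) \<Rightarrow> 'v \<Rightarrow> nat \<Rightarrow> real" where
  "message_step w f v a = (\<Prod>u\<in>children v. \<Sum>b\<in>colours. interaction w a b * f u b)"

text \<open>With the inner configuration fixed, the vertices of the new sphere interact only with
  their parents, so the sum factorises.\<close>

lemma sum_extend_one_level:
  assumes \<eta>: "\<eta> \<in> configs (ball n)"
  shows "(\<Sum>\<zeta>\<in>configs (sphere (Suc n)).
      potts_weight w E (ball (Suc n)) (\<lambda>x\<in>ball (Suc n). if x \<in> ball n then \<eta> x else \<zeta> x) *
      (\<Prod>u\<in>sphere (Suc n). f u (\<zeta> u)))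
    = potts_weight w E (ball n) \<eta> * (\<Prod>v\<in>sphere n. message_step w f v (\<eta> v))"
proof -
  \<comment> \<open>The parent map rewrites the product over parents and children as one product
    over the sphere, where sum and product can be exchanged.\<close>
  define par where "par u = (THE v. u \<in> children v)" for u
  have par: "par u = v" if "u \<in> children v" for u v
    unfolding par_def using that children_disjoint by (intro the_equality) auto
  define g where "g u b = interaction w (\<eta> (par u)) b * f u b" for u b
  have term_eq: "potts_weight w E (ball (Suc n)) (\<lambda>x\<in>ball (Suc n). if x \<in> ball n then \<eta> x else \<zeta> x) *
      (\<Prod>u\<in>sphere (Suc n). f u (\<zeta> u)) = potts_weight w E (ball n) \<eta> * (\<Prod>u\<in>sphere (Suc n). g u (\<zeta> u))"
    (is "?W * _ = _") for \<zeta>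
  proof -
    define \<sigma> where "\<sigma> = (\<lambda>x\<in>ball (Suc n). if x \<in> ball n then \<eta> x else \<zeta> x)"
    have "potts_weight w E (ball n) \<sigma> = potts_weight w E (ball n) \<eta>"
      by (rule potts_weight_cong) (auto simp: \<sigma>_def ball_Suc)
    moreover have "(\<Prod>v\<in>sphere n. \<Prod>u\<in>children v. interaction w (\<sigma> v) (\<sigma> u))
        = (\<Prod>v\<in>sphere n. \<Prod>u\<in>children v. interaction w (\<eta> (par u)) (\<zeta> u))"
    proof (intro prod.cong refl)
      fix v u assume vu: "v \<in> sphere n" "u \<in> children v"
      then have "v \<in> ball n" "u \<in> ball (Suc n)" "u \<notin> ball n"
        by (auto simp: children_def sphere_def ball_def)
      then show "interaction w (\<sigma> v) (\<sigma> u) = interaction w (\<eta> (par u)) (\<zeta> u)"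
        using par[OF vu(2)] by (simp add: \<sigma>_def ball_Suc)
    qed
    ultimately show ?thesis
      unfolding \<sigma>_def[symmetric] potts_weight_ball_Suc prod_sphere_Suc
      by (simp add: g_def prod.distrib mult.assoc)
  qed
  have "(\<Sum>\<zeta>\<in>configs (sphere (Suc n)). \<Prod>u\<in>sphere (Suc n). g u (\<zeta> u))
      = (\<Prod>u\<in>sphere (Suc n). \<Sum>b\<in>colours. g u b)"
    unfolding configs_def by (rule prod_sum_PiE[symmetric]) (auto simp: finite_sphere)
  also have "\<dots> = (\<Prod>v\<in>sphere n. message_step w f v (\<eta> v))"
    unfolding prod_sphere_Suc message_step_def g_def by (intro prod.cong refl) (simp add: par)
  finally show ?thesis unfolding term_eq sum_distrib_left[symmetric] by simp
qed

lemma sum_configs_ball_Suc: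
  fixes F :: "('v \<Rightarrow> nat) \<Rightarrow> real"
  assumes mn: "m \<le> n"
  shows "(\<Sum>\<eta> | \<eta> \<in> configs (ball (Suc n)) \<and> restrict \<eta> (ball m) = \<tau>. F \<eta>)
    = (\<Sum>\<eta> | \<eta> \<in> configs (ball n) \<and> restrict \<eta> (ball m) = \<tau>.
        \<Sum>\<zeta>\<in>configs (sphere (Suc n)). F (\<lambda>x\<in>ball (Suc n). if x \<in> ball n then \<eta> x else \<zeta> x))"
proof -
  have "(\<Sum>\<eta> | \<eta> \<in> configs (ball n) \<and> restrict \<eta> (ball m) = \<tau>.
        \<Sum>\<zeta>\<in>configs (sphere (Suc n)). F (\<lambda>x\<in>ball (Suc n). if x \<in> ball n then \<eta> x else \<zeta> x))
    = (\<Sum>p\<in>{\<eta>. \<eta> \<in> configs (ball n) \<and> restrict \<eta> (ball m) = \<tau>} \<times> configs (sphere (Suc n)).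
        F (\<lambda>x\<in>ball (Suc n). if x \<in> ball n then fst p x else snd p x))"
    by (subst sum.cartesian_product) (simp add: case_prod_beta)
  also have "\<dots> = (\<Sum>\<eta> | \<eta> \<in> configs (ball (Suc n)) \<and> restrict \<eta> (ball m) = \<tau>. F \<eta>)"
  proof (rule sum.reindex_bij_witness[where
      i = "\<lambda>\<eta>. (restrict \<eta> (ball n), restrict \<eta> (sphere (Suc n)))" and
      j = "\<lambda>p. \<lambda>x\<in>ball (Suc n). if x \<in> ball n then fst p x else snd p x"])
    have disj: "x \<notin> ball n" if "x \<in> sphere (Suc n)" for x
      using that ball_sphere_disjoint by blast
    have mem: "x \<in> ball m \<Longrightarrow> x \<in> ball n" for x using ball_mono[OF mn] by blast
    fix p assume p: "p \<in> {\<eta>. \<eta> \<in> configs (ball n) \<and> restrict \<eta> (ball m) = \<tau>} \<times> configs (sphere (Suc n))"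
    let ?j = "\<lambda>x\<in>ball (Suc n). if x \<in> ball n then fst p x else snd p x"
    have "restrict ?j (ball n) = fst p"
      using p by (intro ext) (auto simp: configs_def ball_Suc PiE_def extensional_def)
    moreover have "restrict ?j (sphere (Suc n)) = snd p"
      using p disj by (intro ext) (auto simp: configs_def ball_Suc PiE_def extensional_def)
    ultimately show "(restrict ?j (ball n), restrict ?j (sphere (Suc n))) = p" by simp
    have "restrict ?j (ball m) = restrict (fst p) (ball m)"
      using mem by (intro ext) (auto simp: ball_Suc)
    then show "?j \<in> {\<eta>. \<eta> \<in> configs (ball (Suc n)) \<and> restrict \<eta> (ball m) = \<tau>}"
      using p by (auto simp: configs_def ball_Suc PiE_iff)
  next
    fix \<eta> assume \<eta>: "\<eta> \<in> {\<eta>. \<eta> \<in> configs (ball (Suc n)) \<and> restrict \<eta> (ball m) = \<tau>}"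
    let ?p = "(restrict \<eta> (ball n), restrict \<eta> (sphere (Suc n)))"
    show "(\<lambda>x\<in>ball (Suc n). if x \<in> ball n then fst ?p x else snd ?p x) = \<eta>"
      using \<eta> by (intro ext) (auto simp: configs_def ball_Suc PiE_def extensional_def)
    have "restrict (restrict \<eta> (ball n)) (ball m) = restrict \<eta> (ball m)"
      using ball_mono[OF mn] by (simp add: Int_absorb1 restrict_restrict)
    then show "?p \<in> {\<eta>. \<eta> \<in> configs (ball n) \<and> restrict \<eta> (ball m) = \<tau>} \<times> configs (sphere (Suc n))"
      using \<eta> by (auto simp: configs_def ball_Suc PiE_iff)
  qed simp
  finally show ?thesis by simp
qed

text \<open>Summing out the outermost sphere replaces \<open>f\<close> by
  \<open>message_step w f\<close>, so the induction runs over arbitrary \<open>f\<close>. Two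
  choices matter later: indicators of boundary colours for uniqueness, and boundary laws for
  existence.\<close>

theorem sum_weights_eq_messages:
  assumes "\<tau> \<in> configs (ball m)"
  shows "(\<Sum>\<eta> | \<eta> \<in> configs (ball (m + k)) \<and> restrict \<eta> (ball m) = \<tau>.
      potts_weight w E (ball (m + k)) \<eta> * (\<Prod>u\<in>sphere (m + k). f u (\<eta> u)))
    = potts_weight w E (ball m) \<tau> * (\<Prod>v\<in>sphere m. (message_step w ^^ k) f v (\<tau> v))"
proof (induction k arbitrary: f)
  case 0
  have "{\<eta>. \<eta> \<in> configs (ball m) \<and> restrict \<eta> (ball m) = \<tau>} = {\<tau>}"
    using assms by (auto simp: configs_def PiE_restrict)
  then show ?case by (simp only: add_0_right funpow_0 sum.insert finite.emptyI empty_iff not_False_eq_True sum.empty)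
next
  case (Suc k)
  have "(\<Sum>\<eta> | \<eta> \<in> configs (ball (Suc (m + k))) \<and> restrict \<eta> (ball m) = \<tau>.
      potts_weight w E (ball (Suc (m + k))) \<eta> * (\<Prod>u\<in>sphere (Suc (m + k)). f u (\<eta> u)))
    = (\<Sum>\<eta> | \<eta> \<in> configs (ball (m + k)) \<and> restrict \<eta> (ball m) = \<tau>.
        \<Sum>\<zeta>\<in>configs (sphere (Suc (m + k))).
      potts_weight w E (ball (Suc (m + k))) (\<lambda>x\<in>ball (Suc (m + k)). if x \<in> ball (m + k) then \<eta> x else \<zeta> x) *
      (\<Prod>u\<in>sphere (Suc (m + k)). f u (\<zeta> u)))"
    unfolding sum_configs_ball_Suc[OF le_add1]
  proof (intro sum.cong refl arg_cong2[of _ _ _ _ "(*)"] prod.cong)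
    fix \<eta> \<zeta> u assume "u \<in> sphere (Suc (m + k))"
    then have "u \<notin> ball (m + k)" "u \<in> ball (Suc (m + k))"
      using ball_sphere_disjoint sphere_subset_ball by blast+
    then show "f u ((\<lambda>x\<in>ball (Suc (m + k)). if x \<in> ball (m + k) then \<eta> x else \<zeta> x) u) = f u (\<zeta> u)"
      by simp
  qed
  also have "\<dots> = (\<Sum>\<eta> | \<eta> \<in> configs (ball (m + k)) \<and> restrict \<eta> (ball m) = \<tau>.
      potts_weight w E (ball (m + k)) \<eta> * (\<Prod>v\<in>sphere (m + k). message_step w f v (\<eta> v)))"
    by (intro sum.cong refl sum_extend_one_level) auto
  also have "\<dots> = potts_weight w E (ball m) \<tau> * (\<Prod>v\<in>sphere m. (message_step w ^^ Suc k) f v (\<tau> v))"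
    unfolding Suc.IH by (simp add: funpow_swap1)
  finally show ?case by (simp only: add_Suc_right)
qed

end
section \<open>Uniqueness\<close>

definition cyl :: "'v set \<Rightarrow> 'v set \<Rightarrow> ('v \<Rightarrow> nat) \<Rightarrow> ('v \<Rightarrow> nat) set" where
  "cyl V U \<eta> = {\<psi> \<in> colourings V. restrict \<psi> U = \<eta>}"

lemma cyl_in_sets:
  assumes "finite U" "U \<subseteq> V"
  shows "cyl V U \<eta> \<in> sets (config_space 4 V)"
proof (cases "\<eta> \<in> colourings U")
  case True
  then show ?thesis
    unfolding sets_config_space cyl_def using assms by (intro sigma_sets.Basic) blast
next
  case False
  have "restrict \<psi> U \<in> colourings U" if "\<psi> \<in> colourings V" for \<psi>
    using that assms by (auto simp: PiE_iff)
  then have "cyl V U \<eta> = {}" using False unfolding cyl_def by blast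
  then show ?thesis by simp
qed

lemma restrict_mem_in_sets:
  assumes U: "finite U" "U \<subseteq> V"
  shows "{\<psi> \<in> colourings V. restrict \<psi> U \<in> X} \<in> sets (config_space 4 V)"
proof -
  have "restrict \<psi> U \<in> colourings U" if "\<psi> \<in> colourings V" for \<psi>
    using that U by (auto simp: PiE_iff)
  then have "{\<psi> \<in> colourings V. restrict \<psi> U \<in> X} = (\<Union>\<eta>\<in>X \<inter> (colourings U). cyl V U \<eta>)"
    unfolding cyl_def by blast
  moreover have "finite (X \<inter> (colourings U))" using U by (intro finite_Int disjI2 finite_PiE) auto
  ultimately show ?thesis using cyl_in_sets[OF U] by (simp only: sets.finite_UN)
qed

lemma cyl_decompose:
  assumes "U \<subseteq> U'" "U' \<subseteq> V"
  shows "cyl V U \<eta> = (\<Union>\<eta>'\<in>{\<eta>'. \<eta>' \<in> colourings U' \<and> restrict \<eta>' U = \<eta>}. cyl V U' \<eta>')"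
proof (intro set_eqI iffI)
  fix \<psi> assume \<psi>: "\<psi> \<in> cyl V U \<eta>"
  have "restrict \<psi> U' \<in> colourings U'" using \<psi> assms by (auto simp: cyl_def PiE_iff)
  moreover have "restrict (restrict \<psi> U') U = \<eta>"
    using \<psi> assms by (simp add: restrict_restrict Int_absorb1 cyl_def)
  ultimately show "\<psi> \<in> (\<Union>\<eta>'\<in>{\<eta>'. \<eta>' \<in> colourings U' \<and> restrict \<eta>' U = \<eta>}. cyl V U' \<eta>')"
    using \<psi> unfolding cyl_def by blast
next
  fix \<psi> assume "\<psi> \<in> (\<Union>\<eta>'\<in>{\<eta>'. \<eta>' \<in> colourings U' \<and> restrict \<eta>' U = \<eta>}. cyl V U' \<eta>')"
  then have "\<psi> \<in> colourings V" "restrict (restrict \<psi> U') U = \<eta>" unfolding cyl_def by blast+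
  then show "\<psi> \<in> cyl V U \<eta>" using assms by (simp add: restrict_restrict Int_absorb1 cyl_def)
qed

lemma measure_cyl_decompose:
  assumes M: "finite_measure \<mu>" "sets \<mu> = sets (config_space 4 V)"
    and U: "finite U'" "U \<subseteq> U'" "U' \<subseteq> V"
  shows "measure \<mu> (cyl V U \<eta>)
    = (\<Sum>\<eta>' | \<eta>' \<in> colourings U' \<and> restrict \<eta>' U = \<eta>. measure \<mu> (cyl V U' \<eta>'))"
proof -
  interpret finite_measure \<mu> by (rule M(1))
  have "finite (colourings U')" using U by (intro finite_PiE) auto
  then have "finite {\<eta>'. \<eta>' \<in> colourings U' \<and> restrict \<eta>' U = \<eta>}"
    by (rule rev_finite_subset) blast
  then show ?thesis
    unfolding cyl_decompose[OF U(2,3)] using cyl_in_sets[OF U(1,3)] M(2)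
    by (intro finite_measure_finite_Union) (auto simp: disjoint_family_on_def cyl_def)
qed

lemma measure_cyl_sum_1:
  assumes M: "prob_space \<mu>" "sets \<mu> = sets (config_space 4 V)" and U: "finite U" "U \<subseteq> V"
  shows "(\<Sum>\<eta>\<in>colourings U. measure \<mu> (cyl V U \<eta>)) = 1"
proof -
  interpret prob_space \<mu> by (rule M(1))
  have "space \<mu> = colourings V"
    using sets_eq_imp_space_eq[OF M(2)] by (simp add: space_config_space)
  then have "cyl V {} (\<lambda>_. undefined) = space \<mu>" by (auto simp: cyl_def restrict_def)
  then have "1 = measure \<mu> (cyl V {} (\<lambda>_. undefined))" using prob_space by simp
  also have "\<dots> = (\<Sum>\<eta>\<in>colourings U. measure \<mu> (cyl V U \<eta>))"
    by (subst measure_cyl_decompose[OF finite_measure_axioms M(2) U(1) _ U(2)])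
      (auto intro!: sum.cong simp: restrict_def)
  finally show ?thesis by simp
qed

lemma restrict_eq_iff: "restrict f U = restrict g U \<longleftrightarrow> (\<forall>x\<in>U. f x = g x)"
  by (auto simp: restrict_def fun_eq_iff)

definition finite_cylinders :: "'v set \<Rightarrow> ('v \<Rightarrow> nat) set set" where
  "finite_cylinders V = insert {} {cyl V U \<zeta> | U \<zeta>. finite U \<and> U \<subseteq> V}"

lemma space_in_finite_cylinders: "colourings V \<in> finite_cylinders V"
proof -
  have "colourings V = cyl V {} (\<lambda>_. undefined)" by (auto simp: cyl_def restrict_def)
  then show ?thesis unfolding finite_cylinders_def by blast
qed

text \<open>Any element of a non-empty intersection supplies the pattern on the union of the two
  windows.\<close>

lemma Int_stable_finite_cylinders: "Int_stable (finite_cylinders V)"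
proof (rule Int_stableI)
  fix A B assume AB: "A \<in> finite_cylinders V" "B \<in> finite_cylinders V"
  show "A \<inter> B \<in> finite_cylinders V"
  proof (cases "A \<inter> B = {}")
    case False
    then obtain \<psi> where \<psi>: "\<psi> \<in> A" "\<psi> \<in> B" by blast
    then obtain U \<zeta> U' \<zeta>' where A: "A = cyl V U \<zeta>" "finite U" "U \<subseteq> V"
      and B: "B = cyl V U' \<zeta>'" "finite U'" "U' \<subseteq> V"
      using AB unfolding finite_cylinders_def by blast
    have "A \<inter> B = cyl V (U \<union> U') (restrict \<psi> (U \<union> U'))"
    proof -
      have "\<zeta> = restrict \<psi> U" "\<zeta>' = restrict \<psi> U'" using \<psi> by (auto simp: A(1) B(1) cyl_def)
      then show ?thesis unfolding A(1) B(1) cyl_def by (auto simp: restrict_eq_iff)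
    qed
    then show ?thesis using A B unfolding finite_cylinders_def by blast
  qed (simp add: finite_cylinders_def)
qed

lemma sets_config_space_eq_finite_cylinders:
  "sets (config_space 4 V) = sigma_sets (colourings V) (finite_cylinders V)"
proof
  show "sets (config_space 4 V) \<subseteq> sigma_sets (colourings V) (finite_cylinders V)"
    unfolding sets_config_space
    by (rule sigma_sets_mono') (unfold finite_cylinders_def cyl_def, blast)
  have "finite_cylinders V \<subseteq> sets (config_space 4 V)"
    using cyl_in_sets by (auto simp: finite_cylinders_def)
  then show "sigma_sets (colourings V) (finite_cylinders V) \<subseteq> sets (config_space 4 V)"
    using sets.sigma_sets_subset[of "finite_cylinders V" "config_space 4 V"] by (simp add: space_config_space)
qed

lemma potts_boundary_prob_cong:
  assumes "\<And>v. v \<in> U \<Longrightarrow> \<phi> v = \<phi>' v"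
  shows "potts_boundary_prob q w V E U \<phi> = potts_boundary_prob q w V E U \<phi>'"
proof -
  have *: "\<phi> v = \<phi>' v" if "v \<in> inner_boundary V E U" for v
    using that assms by (auto simp: inner_boundary_def)
  have "{\<sigma> \<in> U \<rightarrow>\<^sub>E {1..q}. \<forall>v\<in>inner_boundary V E U. \<sigma> v = \<phi> v}
      = {\<sigma> \<in> U \<rightarrow>\<^sub>E {1..q}. \<forall>v\<in>inner_boundary V E U. \<sigma> v = \<phi>' v}"
    by (intro Collect_cong conj_cong refl ball_cong) (simp only: *)
  then show ?thesis
    unfolding potts_boundary_prob_def by (simp only: potts_weight_cong[OF assms])
qed

lemma inner_boundary_cyl_in_sets:
  fixes E :: "'v set set"
  assumes U: "finite U" "U \<subseteq> V"
  defines "B \<equiv> inner_boundary V E U"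
  shows "cyl V B \<xi> \<in> sets (restriction_algebra 4 V (V - graph_interior V E U))"
proof -
  define W where "W = V - graph_interior V E U"
  have BW: "B \<subseteq> W" using U by (auto simp: W_def graph_interior_def B_def inner_boundary_def)
  have "finite B" using U(1) by (rule rev_finite_subset) (auto simp: B_def inner_boundary_def)
  then have "cyl W B \<xi> \<in> sets (config_space 4 W)" by (rule cyl_in_sets[OF _ BW])
  then have "(\<lambda>\<psi>. restrict \<psi> W) -` cyl W B \<xi> \<inter> (colourings V) \<in> sets (restriction_algebra 4 V W)"
    unfolding restriction_algebra_def by (rule in_vimage_algebra)
  also have "(\<lambda>\<psi>. restrict \<psi> W) -` cyl W B \<xi> \<inter> (colourings V) = cyl V B \<xi>"
  proof (intro set_eqI)
    fix \<psi>
    have "restrict \<psi> W \<in> colourings W" if "\<psi> \<in> colourings V"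
      using that by (auto simp: W_def PiE_iff)
    moreover have "restrict (restrict \<psi> W) B = restrict \<psi> B"
      using BW by (simp add: restrict_restrict Int_absorb1)
    ultimately show "\<psi> \<in> (\<lambda>\<psi>. restrict \<psi> W) -` cyl W B \<xi> \<inter> (colourings V) \<longleftrightarrow> \<psi> \<in> cyl V B \<xi>"
      unfolding cyl_def by auto
  qed
  finally show ?thesis by (simp only: W_def)
qed

text \<open>The Gibbs property at \<open>\<phi>\<close> concerns the cylinder of
  \<open>\<phi>\<close> itself, so it identifies the conditional probability \<open>g\<close> of
  \<open>C\<close> with \<open>P\<close> only on \<open>C\<close>. The part \<open>N\<close> of
  \<open>D\<close> where \<open>g\<close> exceeds \<open>P\<close> is measurable for the
  conditioning algebra and meets \<open>C\<close> in a null set; integrating \<open>g\<close> over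
  it gives 0, although \<open>g > P > 0\<close> there, so it is null. The set where \<open>g\<close>
  is less than \<open>P\<close> cannot be excluded in this way, hence an inequality.\<close>

lemma gibbs_measure_le:
  fixes \<mu> :: "('v \<Rightarrow> nat) measure"
  assumes gibbs: "potts_gibbs_measure 4 w V E \<mu>" and w: "0 < w"
    and U: "finite U" "U \<subseteq> V" and \<eta>: "\<eta> \<in> colourings U"
  defines "B \<equiv> inner_boundary V E U"
  shows "measure \<mu> (cyl V U \<eta>)
    \<le> potts_boundary_prob 4 w V E U \<eta> * measure \<mu> (cyl V B (restrict \<eta> B))"
proof -
  define W where "W = V - graph_interior V E U"
  define F where "F = restriction_algebra 4 V W"
  define P where "P = potts_boundary_prob 4 w V E U \<eta>"
  define C where "C = cyl V U \<eta>"
  define D where "D = cyl V B (restrict \<eta> B)"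
  have BU: "B \<subseteq> U" by (auto simp: B_def inner_boundary_def)
  have sets: "sets \<mu> = sets (config_space 4 V)" using gibbs by (simp add: potts_gibbs_measure_def)
  have space: "space \<mu> = colourings V"
    using sets_eq_imp_space_eq[OF sets] by (simp add: space_config_space)
  interpret prob_space \<mu> using gibbs by (simp add: potts_gibbs_measure_def)
  have sub: "subalgebra \<mu> F"
    unfolding F_def by (rule subalgebra_restriction_algebra[OF sets]) (auto simp: W_def)
  interpret finite_measure_subalgebra \<mu> F by unfold_locales (rule sub)
  define g where "g = real_cond_exp \<mu> F (indicator C)"
  have C_sets: "C \<in> sets \<mu>" unfolding C_def sets by (rule cyl_in_sets[OF U])
  have int_C: "integrable \<mu> (indicator C :: _ \<Rightarrow> real)" using C_sets by (simp add: less_top[symmetric])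
  have g_meas: "g \<in> borel_measurable F" unfolding g_def by (rule borel_measurable_cond_exp)
  have g_int: "integrable \<mu> g" unfolding g_def using int_C by (rule real_cond_exp_int)
  have CD: "C \<subseteq> D"
  proof
    fix \<psi> assume "\<psi> \<in> C"
    then have "\<psi> \<in> colourings V" "restrict \<psi> U = \<eta>" by (auto simp: C_def cyl_def)
    then show "\<psi> \<in> D" using BU by (auto simp: D_def cyl_def restrict_restrict Int_absorb1)
  qed
  have D_F: "D \<in> sets F"
    unfolding D_def F_def W_def B_def by (rule inner_boundary_cyl_in_sets[OF U])
  have D_sets: "D \<in> sets \<mu>" using D_F sub by (auto simp: subalgebra_def)
  have P_pos: "0 < P"
  proof -
    have "finite (colourings U)" using U by (intro finite_PiE) auto
    then have "finite {\<sigma> \<in> colourings U. \<forall>v\<in>inner_boundary V E U. \<sigma> v = \<eta> v}" by simp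
    moreover have "{\<sigma> \<in> colourings U. \<forall>v\<in>inner_boundary V E U. \<sigma> v = \<eta> v} \<noteq> {}" using \<eta> by blast
    ultimately show ?thesis
      unfolding P_def potts_boundary_prob_def using potts_weight_pos[OF w]
      by (intro divide_pos_pos sum_pos) auto
  qed
  have AE_C: "AE \<phi> in \<mu>. \<phi> \<in> C \<longrightarrow> g \<phi> = P"
  proof -
    have "AE \<phi> in \<mu>. real_cond_exp \<mu> F (indicator {\<psi> \<in> space \<mu>. restrict \<psi> U = restrict \<phi> U}) \<phi>
        = potts_boundary_prob 4 w V E U \<phi>"
      using gibbs U by (auto simp: potts_gibbs_measure_def F_def W_def)
    then show ?thesis
    proof (rule AE_mp, intro AE_I2 impI)
      fix \<phi> assume eq: "real_cond_exp \<mu> F (indicator {\<psi> \<in> space \<mu>. restrict \<psi> U = restrict \<phi> U}) \<phi>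
        = potts_boundary_prob 4 w V E U \<phi>" and "\<phi> \<in> C"
      then have \<phi>: "restrict \<phi> U = \<eta>" by (auto simp: C_def cyl_def)
      have "{\<psi> \<in> space \<mu>. restrict \<psi> U = restrict \<phi> U} = C"
        unfolding \<phi> by (simp only: C_def cyl_def space)
      moreover have "potts_boundary_prob 4 w V E U \<phi> = P"
        unfolding P_def by (rule potts_boundary_prob_cong) (auto simp flip: \<phi>)
      ultimately show "g \<phi> = P" using eq by (simp add: g_def)
    qed
  qed
  define N where "N = {\<phi> \<in> space F. P < g \<phi>} \<inter> D"
  have N_F: "N \<in> sets F"
    unfolding N_def using g_meas D_F by (intro sets.Int) measurable
  then have N_sets: "N \<in> sets \<mu>" using sub by (auto simp: subalgebra_def)
  have "P * measure \<mu> N = (LINT x:N|\<mu>. P)"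
    using N_sets by (simp add: set_lebesgue_integral_def less_top[symmetric])
  also have "\<dots> \<le> (LINT x:N|\<mu>. g x)"
  proof (rule set_integral_mono)
    show "set_integrable \<mu> N (\<lambda>x. P)" unfolding set_integrable_def using N_sets
      by (intro integrable_mult_indicator) auto
    show "set_integrable \<mu> N g" unfolding set_integrable_def using N_sets g_int
      by (intro integrable_mult_indicator)
    show "P \<le> g x" if "x \<in> N" for x using that by (simp add: N_def)
  qed
  also have "\<dots> = (LINT x:N|\<mu>. indicator C x)"
    unfolding g_def by (rule real_cond_exp_intA[OF int_C N_F, symmetric])
  also have "\<dots> = (LINT x|\<mu>. 0)"
    unfolding set_lebesgue_integral_def
  proof (rule integral_cong_AE)
    show "AE x in \<mu>. indicator N x *\<^sub>R indicator C x = (0::real)"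
      using AE_C by (rule AE_mp) (auto simp: indicator_def N_def)
    show "(\<lambda>x. indicator N x *\<^sub>R indicator C x :: real) \<in> borel_measurable \<mu>"
      using N_sets C_sets by measurable
  qed auto
  finally have "measure \<mu> N \<le> 0" using P_pos by (simp add: mult_le_0_iff)
  then have "measure \<mu> N = 0" by (simp add: measure_le_0_iff)
  then have "emeasure \<mu> N = 0" by (simp add: emeasure_eq_measure)
  then have "AE x in \<mu>. x \<notin> N" using N_sets by (intro AE_not_in) (auto simp: null_sets_def)
  then have AE_D: "AE x in \<mu>. x \<in> D \<longrightarrow> g x \<le> P"
    by (rule AE_mp) (use sub in \<open>auto simp: N_def subalgebra_def\<close>)
  have "measure \<mu> C = (LINT x:D|\<mu>. indicator C x)"
  proof -
    have "(\<lambda>x. indicator D x *\<^sub>R indicator C x :: real) = indicator C"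
      using CD by (auto simp: indicator_def fun_eq_iff)
    then show ?thesis using C_sets by (simp add: set_lebesgue_integral_def)
  qed
  also have "\<dots> = (LINT x:D|\<mu>. g x)"
    unfolding g_def by (rule real_cond_exp_intA[OF int_C D_F])
  also have "\<dots> \<le> (LINT x:D|\<mu>. P)"
  proof (rule set_integral_mono_AE)
    show "set_integrable \<mu> D (\<lambda>x. P)" unfolding set_integrable_def using D_sets
      by (intro integrable_mult_indicator) auto
    show "set_integrable \<mu> D g" unfolding set_integrable_def using D_sets g_int
      by (intro integrable_mult_indicator)
  qed (use AE_D in auto)
  also have "\<dots> = P * measure \<mu> D"
    using D_sets by (simp add: set_lebesgue_integral_def)
  finally show ?thesis by (simp add: C_def D_def P_def)
qed

primrec contraction_seq :: "nat \<Rightarrow> real" where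
  "contraction_seq 0 = 1"
| "contraction_seq (Suc k) = contraction_seq k - contraction_seq k ^ 3 / 100"

lemma contraction_seq_bounds: "0 < contraction_seq k \<and> contraction_seq k \<le> 1"
proof (induction k)
  case (Suc k)
  then have "0 < contraction_seq k" "contraction_seq k \<le> 1" by auto
  from contraction_constant[OF this] show ?case by simp
qed simp

lemma contraction_seq_less_1: "contraction_seq (Suc k) < 1"
proof -
  have "0 < contraction_seq k" "contraction_seq k \<le> 1" using contraction_seq_bounds by auto
  from contraction_constant(2)[OF this] show ?thesis by simp
qed

lemma contraction_seq_tendsto: "contraction_seq \<longlonglongrightarrow> 0"
proof -
  have "contraction_seq (Suc k) \<le> contraction_seq k" for k
    using contraction_seq_bounds[of k] by simp
  then have "decseq contraction_seq" by (rule decseq_SucI)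
  moreover have "norm (contraction_seq k) \<le> 1" for k using contraction_seq_bounds[of k] by simp
  then have "Bseq contraction_seq" by (rule BseqI')
  ultimately obtain L where L: "contraction_seq \<longlonglongrightarrow> L"
    using Bseq_monoseq_convergent[of contraction_seq] decseq_imp_monoseq by (auto simp: convergent_def)
  have "(\<lambda>k. contraction_seq (Suc k)) \<longlonglongrightarrow> L - L ^ 3 / 100"
    using L by (auto intro!: tendsto_intros)
  then have "L = L - L ^ 3 / 100"
    using LIMSEQ_Suc[OF L] LIMSEQ_unique by blast
  then show ?thesis using L by simp
qed

lemma factor_cong:
  assumes "\<And>b. b \<in> colours \<Longrightarrow> x b = y b" "a \<in> colours"
  shows "factor \<omega> x a = factor \<omega> y a"
proof -
  have "sum x colours = sum y colours" by (rule sum.cong[OF refl assms(1)])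
  then show ?thesis using assms(1)[OF assms(2)] by (simp only: factor_def)
qed

lemma sum_interaction:
  assumes "a \<in> colours"
  shows "(\<Sum>b\<in>colours. interaction w a b * f b) = factor (1 - w) f a"
proof -
  have "(\<Sum>b\<in>colours. interaction w a b * f b) = (\<Sum>b\<in>colours. f b - (if a = b then (1 - w) * f b else 0))"
    by (intro sum.cong refl) (simp add: algebra_simps)
  also have "\<dots> = factor (1 - w) f a"
    using assms by (simp add: sum_subtractf factor_def sum.delta')
  finally show ?thesis .
qed

context rooted_regular_tree
begin

text \<open>Zero entries are allowed so that the indicator of a prescribed boundary colour
  qualifies; for \<open>w > 0\<close> one step makes all entries positive.\<close>

definition admissible :: "('v \<Rightarrow> nat \<Rightarrow> real) \<Rightarrow> bool" where
  "admissible f \<longleftrightarrow> (\<forall>v\<in>V. (\<forall>a\<in>colours. 0 \<le> f v a) \<and> 0 < sum (f v) colours)"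

lemma children_subset: "children v \<subseteq> V"
  by (auto simp: children_def sphere_def)

lemma children_not_root: "u \<in> children v \<Longrightarrow> u \<noteq> r"
  by (auto simp: children_def sphere_def)

lemma message_step_eq:
  "a \<in> colours \<Longrightarrow> message_step w f v a = (\<Prod>u\<in>children v. factor (1 - w) (f u) a)"
  unfolding message_step_def by (intro prod.cong refl sum_interaction)

lemma message_step_pos:
  assumes "admissible f" "0 < w" "w \<le> 1" "a \<in> colours"
  shows "0 < message_step w f v a"
  unfolding message_step_eq[OF assms(4)]
  using assms subsetD[OF children_subset] by (intro prod_pos factor_pos) (auto simp: admissible_def)

lemma admissible_message_step:
  assumes "admissible f" "0 < w" "w \<le> 1"
  shows "admissible (message_step w f)"
  unfolding admissible_def
  using message_step_pos[OF assms] by (auto simp: less_imp_le intro!: sum_pos)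

lemma message_iterate_pos:
  assumes "admissible f" "0 < w" "w \<le> 1" "a \<in> colours" "0 < k"
  shows "0 < (message_step w ^^ k) f v a"
proof -
  have adm: "admissible ((message_step w ^^ j) f)" for j
    by (induction j) (auto intro: admissible_message_step assms)
  obtain j where "k = Suc j" using assms by (cases k) auto
  then show ?thesis using message_step_pos[OF adm assms(2-4)] by simp
qed

text \<open>The root is excluded because it has \<open>d + 1\<close> children, while the contraction
  is proved for \<open>d\<close>.\<close>

lemma spread_messages:
  assumes d: "4 \<le> d" and w: "1 - 4 / (real d + 1) \<le> w" "w \<le> 1"
    and f: "admissible f" and v: "v \<in> V" "v \<noteq> r"
  shows "spread (contraction_seq k) ((message_step w ^^ (2 * k)) f v)"
  using v
proof (induction k arbitrary: v)
  case 0
  then show ?case using f by (auto simp: spread_def admissible_def)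
next
  case (Suc k)
  have "4 / (real d + 1) < 1" using d by simp
  then have w0: "0 < w" using w by linarith
  define x where "x = (message_step w ^^ (2 * k)) f"
  have adm: "admissible ((message_step w ^^ j) f)" for j
    by (induction j) (auto intro: admissible_message_step f w0 w)
  have "spread (contraction_seq k - contraction_seq k ^ 3 / 100)
    (\<lambda>a. \<Prod>i\<in>children v. factor (1 - w) (\<lambda>b. \<Prod>j\<in>children i. factor (1 - w) (x j) b) a)"
  proof (rule two_step_contraction[where d = d])
    show "finite (children v)" "card (children v) = d"
      using Suc.prems finite_children card_children by auto
    show "finite (children i)" "card (children i) = d" if "i \<in> children v" for i
      using that children_subset children_not_root finite_children card_children by blast+
    show "0 < contraction_seq k" "contraction_seq k \<le> 1" using contraction_seq_bounds by auto
    show "0 \<le> x j a" if "j \<in> children i" "a \<in> colours" for i j a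
      using adm[of "2 * k"] that children_subset unfolding x_def admissible_def by blast
    show "0 < sum (x j) colours" if "j \<in> children i" for i j
      using adm[of "2 * k"] that children_subset unfolding x_def admissible_def by blast
    show "spread (contraction_seq k) (x j)" if "j \<in> children i" for i j
      unfolding x_def using that children_subset children_not_root by (intro Suc.IH) blast+
  qed (use d w in auto)
  moreover have "(message_step w ^^ (2 * Suc k)) f v a
      = (\<Prod>i\<in>children v. factor (1 - w) (\<lambda>b. \<Prod>j\<in>children i. factor (1 - w) (x j) b) a)"
    if a: "a \<in> colours" for a
  proof -
    have "factor (1 - w) (message_step w x i) a = factor (1 - w) (\<lambda>b. \<Prod>j\<in>children i. factor (1 - w) (x j) b) a" for i
      using a message_step_eq by (intro factor_cong) auto
    then show ?thesis by (simp add: x_def[symmetric] message_step_eq[OF a])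
  qed
  ultimately show ?case by (simp add: spread_def)
qed

lemma spread_ratio:
  assumes "spread s x" "s < 1" "a \<in> colours" "b \<in> colours"
  shows "x a \<le> (1 + s) / (1 - s) * x b"
proof -
  have "x a - x b \<le> s * (x a + x b)" using assms by (auto simp: spread_def)
  then have "(1 - s) * x a \<le> (1 + s) * x b" by (simp add: algebra_simps)
  then show ?thesis using assms(2) by (simp add: field_simps)
qed

text \<open>The finite-volume law with free boundary, which is what remains when the messages
  reaching the ball no longer depend on the colour.\<close>

definition ball_prob :: "real \<Rightarrow> nat \<Rightarrow> ('v \<Rightarrow> nat) \<Rightarrow> real" where
  "ball_prob w m \<tau> = potts_weight w E (ball m) \<tau> / (\<Sum>\<tau>'\<in>configs (ball m). potts_weight w E (ball m) \<tau>')"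

lemma configs_nonempty: "configs U \<noteq> {}"
  unfolding configs_def by (simp add: PiE_eq_empty_iff)

text \<open>Condition on the colours \<open>\<xi>\<close> of a sphere \<open>2 * Suc k\<close>
  levels further out. The mass of \<open>\<tau>\<close> is then proportional to its weight times the
  messages on \<open>sphere m\<close>. These vary with the colour by a factor of at most
  \<open>(1 + s k) / (1 - s k)\<close> per vertex, whatever \<open>\<xi>\<close> is, so the bound
  survives averaging over \<open>\<xi>\<close>. The index \<open>Suc k\<close> makes
  \<open>s k < 1\<close>, and \<open>1 \<le> m\<close> keeps the root off the sphere.\<close>

lemma gibbs_ball_le:
  fixes \<mu> :: "('v \<Rightarrow> nat) measure"
  assumes d: "4 \<le> d" and w: "1 - 4 / (real d + 1) \<le> w" "w \<le> 1"
    and gibbs: "potts_gibbs_measure 4 w V E \<mu>" and m: "1 \<le> m" and \<tau>: "\<tau> \<in> configs (ball m)"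
  defines "s \<equiv> \<lambda>k. contraction_seq (Suc k)"
  shows "measure \<mu> (cyl V (ball m) \<tau>) \<le> ((1 + s k) / (1 - s k)) ^ card (sphere m) * ball_prob w m \<tau>"
proof -
  define K where "K = ((1 + s k) / (1 - s k)) ^ card (sphere m)"
  define n where "n = m + 2 * Suc k"
  define W where "W = potts_weight w E"
  define Z where "Z \<xi> = (\<Sum>\<eta> | \<eta> \<in> configs (ball n) \<and> restrict \<eta> (sphere n) = \<xi>. W (ball n) \<eta>)" for \<xi>
  \<comment> \<open>Prescribed boundary colours are encoded as indicator messages; colour 1 off the
    sphere makes \<open>f\<close> admissible at every vertex.\<close>
  define f :: "('v \<Rightarrow> nat) \<Rightarrow> 'v \<Rightarrow> nat \<Rightarrow> real" where "f \<xi> u b = of_bool (b = (if u \<in> sphere n then \<xi> u else 1))" for \<xi> u b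
  define X where "X \<xi> = (message_step w ^^ (2 * Suc k)) (f \<xi>)" for \<xi>
  define A where "A \<xi> \<tau>' = W (ball m) \<tau>' * (\<Prod>v\<in>sphere m. X \<xi> v (\<tau>' v))" for \<xi> \<tau>'
  have "4 / (real d + 1) < 1" using d by simp
  then have w0: "0 < w" using w by linarith
  have prob: "prob_space \<mu>" and sets: "sets \<mu> = sets (config_space 4 V)"
    using gibbs by (auto simp: potts_gibbs_measure_def)
  interpret prob_space \<mu> by (rule prob)
  have W_pos: "0 < W U \<eta>" for U \<eta> unfolding W_def by (rule potts_weight_pos[OF w0])
  have fin: "finite (configs (ball j))" "finite (configs (sphere j))" for j
    using finite_configs finite_ball finite_sphere by auto
  have sub: "sphere n \<subseteq> ball n" "ball m \<subseteq> ball n" "sphere n \<subseteq> V"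
    using sphere_subset_ball ball_mono[of m n] by (auto simp: n_def sphere_def)
  have indicator_prod: "(\<Prod>u\<in>sphere n. f \<xi> u (\<eta> u)) = of_bool (restrict \<eta> (sphere n) = \<xi>)"
    if "\<xi> \<in> configs (sphere n)" for \<xi> \<eta>
  proof -
    have "(\<Prod>u\<in>sphere n. f \<xi> u (\<eta> u)) = of_bool (\<forall>u\<in>sphere n. \<eta> u = \<xi> u)"
    proof (cases "\<forall>u\<in>sphere n. \<eta> u = \<xi> u")
      case False
      then have "\<exists>u\<in>sphere n. f \<xi> u (\<eta> u) = 0" by (auto simp: f_def)
      then have "(\<Prod>u\<in>sphere n. f \<xi> u (\<eta> u)) = 0" using finite_sphere by (intro prod_zero)
      moreover have "of_bool (\<forall>u\<in>sphere n. \<eta> u = \<xi> u) = (0::real)"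
        using False by (simp only: of_bool_eq_0_iff not_False_eq_True)
      ultimately show ?thesis by (simp only:)
    qed (simp add: f_def)
    also have "(\<forall>u\<in>sphere n. \<eta> u = \<xi> u) \<longleftrightarrow> restrict \<eta> (sphere n) = \<xi>"
      using that by (auto simp: configs_def PiE_def extensional_def fun_eq_iff)
    finally show ?thesis .
  qed
  have A_eq: "(\<Sum>\<eta> | \<eta> \<in> configs (ball n) \<and> restrict \<eta> (ball m) = \<tau>'. W (ball n) \<eta> * of_bool (restrict \<eta> (sphere n) = \<xi>)) = A \<xi> \<tau>'"
    if "\<xi> \<in> configs (sphere n)" "\<tau>' \<in> configs (ball m)" for \<xi> \<tau>'
    using sum_weights_eq_messages[OF that(2), where k = "2 * Suc k" and w = w and f = "f \<xi>"]
    unfolding A_def X_def W_def n_def[symmetric] indicator_prod[OF that(1)] .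
  have Z_eq: "Z \<xi> = (\<Sum>\<tau>'\<in>configs (ball m). A \<xi> \<tau>')" if "\<xi> \<in> configs (sphere n)" for \<xi>
  proof -
    have "Z \<xi> = (\<Sum>\<eta>\<in>configs (ball n). W (ball n) \<eta> * of_bool (restrict \<eta> (sphere n) = \<xi>))"
      unfolding Z_def using fin by (subst sum.inter_filter) (auto intro!: sum.cong simp: of_bool_def)
    also have "\<dots> = (\<Sum>\<tau>'\<in>configs (ball m). \<Sum>\<eta> | \<eta> \<in> configs (ball n) \<and> restrict \<eta> (ball m) = \<tau>'.
        W (ball n) \<eta> * of_bool (restrict \<eta> (sphere n) = \<xi>))"
      using fin sub by (intro sum.group[symmetric]) (auto simp: configs_def PiE_iff)
    also have "\<dots> = (\<Sum>\<tau>'\<in>configs (ball m). A \<xi> \<tau>')"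
      using A_eq[OF that] by (intro sum.cong) auto
    finally show ?thesis .
  qed
  have adm: "admissible (f \<xi>)" if "\<xi> \<in> configs (sphere n)" for \<xi>
    unfolding admissible_def f_def
  proof (intro ballI conjI)
    fix v assume "v \<in> V"
    define c where "c = (if v \<in> sphere n then \<xi> v else 1)"
    have "c \<in> colours" using that by (auto simp: c_def configs_def)
    then show "0 < (\<Sum>b\<in>colours. of_bool (b = (if v \<in> sphere n then \<xi> v else 1)) :: real)"
      unfolding c_def[symmetric] by (intro sum_pos2[of _ c]) auto
  qed auto
  have s1: "s k < 1" "0 < s k" using contraction_seq_less_1 contraction_seq_bounds[of "Suc k"] by (auto simp: s_def)
  have ratio: "X \<xi> v a \<le> (1 + s k) / (1 - s k) * X \<xi> v b"
    if "\<xi> \<in> configs (sphere n)" "v \<in> sphere m" "a \<in> colours" "b \<in> colours" for \<xi> v a b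
  proof (rule spread_ratio[OF _ s1(1) that(3,4)])
    have "v \<in> V" "v \<noteq> r" using that(2) m by (auto simp: sphere_def)
    then show "spread (s k) (X \<xi> v)"
      unfolding s_def X_def by (rule spread_messages[OF d w adm[OF that(1)]])
  qed
  have X_pos: "0 < X \<xi> v a" if "\<xi> \<in> configs (sphere n)" "a \<in> colours" for \<xi> v a
    unfolding X_def by (rule message_iterate_pos[OF adm[OF that(1)] w0 w(2) that(2)]) simp
  have in_col: "\<tau>' v \<in> colours" if "\<tau>' \<in> configs (ball m)" "v \<in> sphere m" for \<tau>' v
    using that subsetD[OF sphere_subset_ball] unfolding configs_def by (blast intro: PiE_mem)
  have Z_pos: "0 < Z \<xi>" if "\<xi> \<in> configs (sphere n)" for \<xi>
    unfolding Z_eq[OF that] using W_pos X_pos[OF that] in_col configs_nonempty fin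
    by (intro sum_pos) (auto simp: A_def intro!: mult_pos_pos prod_pos)
  have A_le: "A \<xi> \<tau> * (\<Sum>\<tau>'\<in>configs (ball m). W (ball m) \<tau>') \<le> K * W (ball m) \<tau> * Z \<xi>"
    if \<xi>: "\<xi> \<in> configs (sphere n)" for \<xi>
    unfolding Z_eq[OF \<xi>] sum_distrib_left
  proof (rule sum_mono)
    fix \<tau>' assume \<tau>': "\<tau>' \<in> configs (ball m)"
    have "(\<Prod>v\<in>sphere m. X \<xi> v (\<tau> v)) \<le> (\<Prod>v\<in>sphere m. (1 + s k) / (1 - s k) * X \<xi> v (\<tau>' v))"
      using ratio[OF \<xi>] X_pos[OF \<xi>] in_col \<tau> \<tau>' by (intro prod_mono conjI) (auto simp: less_imp_le)
    also have "\<dots> = K * (\<Prod>v\<in>sphere m. X \<xi> v (\<tau>' v))" by (simp only: prod.distrib prod_constant K_def)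
    finally have "(W (ball m) \<tau> * W (ball m) \<tau>') * (\<Prod>v\<in>sphere m. X \<xi> v (\<tau> v))
        \<le> (W (ball m) \<tau> * W (ball m) \<tau>') * (K * (\<Prod>v\<in>sphere m. X \<xi> v (\<tau>' v)))"
      using W_pos by (intro mult_left_mono) (auto simp: less_imp_le)
    then show "A \<xi> \<tau> * W (ball m) \<tau>' \<le> K * W (ball m) \<tau> * A \<xi> \<tau>'"
      by (simp add: A_def mult_ac)
  qed
  define M where "M \<xi> = measure \<mu> (cyl V (sphere n) \<xi>)" for \<xi>
  have A_quot: "M \<xi> / Z \<xi> * A \<xi> \<tau> \<le> M \<xi> * (K * ball_prob w m \<tau>)" if \<xi>: "\<xi> \<in> configs (sphere n)" for \<xi>
  proof -
    have "0 < (\<Sum>\<tau>'\<in>configs (ball m). W (ball m) \<tau>')"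
      using W_pos configs_nonempty fin by (intro sum_pos) auto
    then have "A \<xi> \<tau> / Z \<xi> \<le> K * ball_prob w m \<tau>"
      using A_le[OF \<xi>] Z_pos[OF \<xi>] unfolding ball_prob_def W_def[symmetric] by (simp add: field_simps)
    then have "M \<xi> * (A \<xi> \<tau> / Z \<xi>) \<le> M \<xi> * (K * ball_prob w m \<tau>)"
      by (intro mult_left_mono) (auto simp: M_def)
    then show ?thesis by simp
  qed
  have cyl_le: "measure \<mu> (cyl V (ball n) \<eta>)
      \<le> (\<Sum>\<xi>\<in>configs (sphere n). M \<xi> / Z \<xi> * (W (ball n) \<eta> * of_bool (restrict \<eta> (sphere n) = \<xi>)))"
    if \<eta>: "\<eta> \<in> configs (ball n)" for \<eta>
  proof -
    define \<xi>0 where "\<xi>0 = restrict \<eta> (sphere n)"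
    have \<xi>0: "\<xi>0 \<in> configs (sphere n)" using \<eta> sub by (auto simp: \<xi>0_def configs_def PiE_iff)
    have "{\<sigma> \<in> ball n \<rightarrow>\<^sub>E colours. \<forall>v\<in>sphere n. \<sigma> v = \<eta> v} = {\<sigma>. \<sigma> \<in> configs (ball n) \<and> restrict \<sigma> (sphere n) = \<xi>0}"
      by (auto simp: configs_def \<xi>0_def fun_eq_iff restrict_def split: if_splits)
    then have "potts_boundary_prob 4 w V E (ball n) \<eta> = W (ball n) \<eta> / Z \<xi>0"
      unfolding potts_boundary_prob_def inner_boundary_ball Z_def W_def by (simp only:)
    then have "measure \<mu> (cyl V (ball n) \<eta>) \<le> W (ball n) \<eta> / Z \<xi>0 * M \<xi>0"
      using gibbs_measure_le[OF gibbs w0 finite_ball ball_subset, of \<eta> n] \<eta>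
      unfolding inner_boundary_ball M_def \<xi>0_def configs_def by (simp only:)
    also have "\<dots> = (\<Sum>\<xi>\<in>configs (sphere n). if \<xi> = \<xi>0 then W (ball n) \<eta> / Z \<xi>0 * M \<xi>0 else 0)"
      using \<xi>0 fin by (simp add: sum.delta')
    also have "\<dots> = (\<Sum>\<xi>\<in>configs (sphere n). M \<xi> / Z \<xi> * (W (ball n) \<eta> * of_bool (\<xi>0 = \<xi>)))"
      by (intro sum.cong refl) (auto simp: of_bool_def)
    finally show ?thesis by (simp only: \<xi>0_def)
  qed
  have "measure \<mu> (cyl V (ball m) \<tau>) = (\<Sum>\<eta> | \<eta> \<in> configs (ball n) \<and> restrict \<eta> (ball m) = \<tau>. measure \<mu> (cyl V (ball n) \<eta>))"
    unfolding configs_def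
    by (rule measure_cyl_decompose[OF finite_measure_axioms sets finite_ball sub(2) ball_subset])
  also have "\<dots> \<le> (\<Sum>\<eta> | \<eta> \<in> configs (ball n) \<and> restrict \<eta> (ball m) = \<tau>.
      \<Sum>\<xi>\<in>configs (sphere n). M \<xi> / Z \<xi> * (W (ball n) \<eta> * of_bool (restrict \<eta> (sphere n) = \<xi>)))"
    using cyl_le by (intro sum_mono) auto
  also have "\<dots> = (\<Sum>\<xi>\<in>configs (sphere n). M \<xi> / Z \<xi> * A \<xi> \<tau>)"
    by (subst sum.swap) (intro sum.cong refl, simp only: sum_distrib_left[symmetric] A_eq \<tau>)
  also have "\<dots> \<le> (\<Sum>\<xi>\<in>configs (sphere n). M \<xi> * (K * ball_prob w m \<tau>))"
    using A_quot by (intro sum_mono) auto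
  also have "\<dots> = (\<Sum>\<xi>\<in>configs (sphere n). M \<xi>) * (K * ball_prob w m \<tau>)"
    by (simp only: sum_distrib_right)
  also have "(\<Sum>\<xi>\<in>configs (sphere n). M \<xi>) = 1"
    unfolding M_def configs_def by (rule measure_cyl_sum_1[OF prob sets finite_sphere sub(3)])
  finally show ?thesis by (simp add: K_def)
qed

text \<open>In the limit the constants tend to 1. Both sides sum to 1 over the configurations of the
  ball, so the termwise inequalities are equalities.\<close>

lemma gibbs_ball_eq:
  fixes \<mu> :: "('v \<Rightarrow> nat) measure"
  assumes d: "4 \<le> d" and w: "1 - 4 / (real d + 1) \<le> w" "w \<le> 1"
    and gibbs: "potts_gibbs_measure 4 w V E \<mu>" and m: "1 \<le> m" and \<tau>: "\<tau> \<in> configs (ball m)"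
  shows "measure \<mu> (cyl V (ball m) \<tau>) = ball_prob w m \<tau>"
proof -
  have "4 / (real d + 1) < 1" using d by simp
  then have w0: "0 < w" using w by linarith
  have le: "measure \<mu> (cyl V (ball m) \<tau>) \<le> ball_prob w m \<tau>" if "\<tau> \<in> configs (ball m)" for \<tau>
  proof (rule LIMSEQ_le_const)
    have "(\<lambda>k. contraction_seq (Suc k)) \<longlonglongrightarrow> 0" by (rule LIMSEQ_Suc[OF contraction_seq_tendsto])
    then have "(\<lambda>k. ((1 + contraction_seq (Suc k)) / (1 - contraction_seq (Suc k))) ^ card (sphere m) * ball_prob w m \<tau>)
      \<longlonglongrightarrow> ((1 + 0) / (1 - 0)) ^ card (sphere m) * ball_prob w m \<tau>"
      by (intro tendsto_intros) auto
    then show "(\<lambda>k. ((1 + contraction_seq (Suc k)) / (1 - contraction_seq (Suc k))) ^ card (sphere m) * ball_prob w m \<tau>)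
      \<longlonglongrightarrow> ball_prob w m \<tau>" by simp
    show "\<exists>N. \<forall>k\<ge>N. measure \<mu> (cyl V (ball m) \<tau>) \<le> ((1 + contraction_seq (Suc k)) / (1 - contraction_seq (Suc k))) ^ card (sphere m) * ball_prob w m \<tau>"
      using gibbs_ball_le[OF d w gibbs m that] by blast
  qed
  have "(\<Sum>\<tau>\<in>configs (ball m). measure \<mu> (cyl V (ball m) \<tau>)) = 1"
    unfolding configs_def using gibbs
    by (intro measure_cyl_sum_1 finite_ball ball_subset) (auto simp: potts_gibbs_measure_def)
  also have "1 = (\<Sum>\<tau>\<in>configs (ball m). ball_prob w m \<tau>)"
  proof -
    have "0 < (\<Sum>\<tau>'\<in>configs (ball m). potts_weight w E (ball m) \<tau>')"
      using potts_weight_pos[OF w0] configs_nonempty finite_configs[OF finite_ball] by (intro sum_pos) auto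
    then show ?thesis unfolding ball_prob_def sum_divide_distrib[symmetric] by simp
  qed
  finally show ?thesis
    by (rule sum_mono_inv[OF _ le \<tau> finite_configs[OF finite_ball]])
qed

theorem gibbs_measure_unique:
  fixes \<mu> \<nu> :: "('v \<Rightarrow> nat) measure"
  assumes d: "4 \<le> d" and w: "1 - 4 / (real d + 1) \<le> w" "w \<le> 1"
    and \<mu>: "potts_gibbs_measure 4 w V E \<mu>" and \<nu>: "potts_gibbs_measure 4 w V E \<nu>"
  shows "\<mu> = \<nu>"
proof -
  interpret \<mu>: prob_space \<mu> using \<mu> by (simp add: potts_gibbs_measure_def)
  interpret \<nu>: prob_space \<nu> using \<nu> by (simp add: potts_gibbs_measure_def)
  have sets: "sets \<mu> = sets (config_space 4 V)" "sets \<nu> = sets (config_space 4 V)"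
    using \<mu> \<nu> by (auto simp: potts_gibbs_measure_def)
  have space: "space \<mu> = colourings V" "space \<nu> = colourings V"
    using sets[THEN sets_eq_imp_space_eq] by (simp_all add: space_config_space)
  show ?thesis
  proof (rule measure_eqI_generator_eq[OF Int_stable_finite_cylinders[of V]])
    show "finite_cylinders V \<subseteq> Pow (colourings V)" by (auto simp: finite_cylinders_def cyl_def)
    show "sets \<mu> = sigma_sets (colourings V) (finite_cylinders V)"
      "sets \<nu> = sigma_sets (colourings V) (finite_cylinders V)"
      using sets sets_config_space_eq_finite_cylinders by simp_all
    show "range (\<lambda>_::nat. colourings V) \<subseteq> finite_cylinders V" using space_in_finite_cylinders by auto
    show "(\<Union>i::nat. colourings V) = colourings V" by simp
    show "emeasure \<mu> (colourings V) \<noteq> \<infinity>" by simp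
    fix X assume "X \<in> finite_cylinders V"
    then consider "X = {}" | U \<zeta> where "X = cyl V U \<zeta>" "finite U" "U \<subseteq> V"
      by (auto simp: finite_cylinders_def)
    then show "emeasure \<mu> X = emeasure \<nu> X"
    proof cases
      case (2 U \<zeta>)
      obtain n where "U \<subseteq> ball n" using finite_subset_ball[OF 2(2,3)] .
      then have n: "U \<subseteq> ball (Suc n)" using ball_mono[of n "Suc n"] by auto
      have "measure \<mu> X = measure \<nu> X"
        unfolding 2(1) measure_cyl_decompose[OF \<mu>.finite_measure_axioms sets(1) finite_ball n ball_subset]
          measure_cyl_decompose[OF \<nu>.finite_measure_axioms sets(2) finite_ball n ball_subset]
      proof (intro sum.cong refl)
        fix \<eta> assume "\<eta> \<in> {\<eta>'. \<eta>' \<in> ball (Suc n) \<rightarrow>\<^sub>E colours \<and> restrict \<eta>' U = \<zeta>}"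
        then have \<eta>: "\<eta> \<in> configs (ball (Suc n))" by (simp only: configs_def mem_Collect_eq)
        have "1 \<le> Suc n" by simp
        then show "measure \<mu> (cyl V (ball (Suc n)) \<eta>) = measure \<nu> (cyl V (ball (Suc n)) \<eta>)"
          using gibbs_ball_eq[OF d w \<mu> _ \<eta>] gibbs_ball_eq[OF d w \<nu> _ \<eta>] by simp
      qed
      then show ?thesis by (simp add: \<mu>.emeasure_eq_measure \<nu>.emeasure_eq_measure)
    qed simp
  qed
qed

end
section \<open>Gibbs measures from boundary laws\<close>

context rooted_regular_tree
begin

text \<open>Consequently an edge not contained in \<open>U\<close> has both ends outside the
  interior, and resampling the interior does not affect it.\<close>

lemma edge_meets_interior:
  assumes "e \<in> E" "u \<in> e" "u \<in> graph_interior V E U"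
  shows "e \<subseteq> U"
proof (rule ccontr)
  assume "\<not> e \<subseteq> U"
  then obtain v where v: "v \<in> e" "v \<notin> U" by blast
  have "u \<in> U" using assms(3) by (simp add: graph_interior_def)
  then have "e = {u, v}" using assms(2) v edge_card[OF assms(1)] by (auto simp: card_2_iff)
  then have "u \<in> inner_boundary V E U"
    using \<open>u \<in> U\<close> v assms(1) edge_subset[OF assms(1)] by (auto simp: inner_boundary_def)
  then show False using assms(3) by (simp add: graph_interior_def)
qed

lemma potts_weight_ball_0: "potts_weight w E (ball 0) \<tau> = 1"
proof -
  have "\<not> e \<subseteq> {r}" if "e \<in> E" for e
  proof
    assume "e \<subseteq> {r}"
    then have "card e \<le> card {r}" by (intro card_mono) auto
    then show False using edge_card[OF that] by simp
  qed
  then have "monochromatic_edges E (ball 0) \<tau> = {}" by (auto simp: monochromatic_edges_def ball_0)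
  then show ?thesis by (simp add: potts_weight_def)
qed

end

text \<open>Proportionality suffices, with a constant that may vary from vertex to vertex. The root
  is exempt: its step involves one more child, and it has no parent to send a message to.\<close>

locale boundary_law = rooted_regular_tree d V E r
  for d :: nat and V :: "'v set" and E :: "'v set set" and r :: 'v +
  fixes w :: real and l :: "'v \<Rightarrow> nat \<Rightarrow> real"
  assumes w_nonneg: "0 \<le> w"
    and l_pos: "\<And>v a. v \<in> V \<Longrightarrow> a \<in> colours \<Longrightarrow> 0 < l v a"
    and l_step: "\<And>v. v \<in> V \<Longrightarrow> v \<noteq> r \<Longrightarrow> \<exists>c>0. \<forall>a\<in>colours. message_step w l v a = c * l v a"
begin

definition weight :: "nat \<Rightarrow> ('v \<Rightarrow> nat) \<Rightarrow> real" where
  "weight n \<eta> = potts_weight w E (ball n) \<eta> * (\<Prod>u\<in>sphere n. l u (\<eta> u))"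

definition partition_fn :: "nat \<Rightarrow> real" where
  "partition_fn n = (\<Sum>\<eta>\<in>configs (ball n). weight n \<eta>)"

definition marginal :: "nat \<Rightarrow> ('v \<Rightarrow> nat) \<Rightarrow> real" where
  "marginal n \<eta> = weight n \<eta> / partition_fn n"

definition scaling :: "'v \<Rightarrow> real" where
  "scaling v = (SOME c. 0 < c \<and> (\<forall>a\<in>colours. message_step w l v a = c * l v a))"

lemma scaling:
  assumes "v \<in> V" "v \<noteq> r"
  shows "0 < scaling v" "\<And>a. a \<in> colours \<Longrightarrow> message_step w l v a = scaling v * l v a"
proof -
  have "\<exists>c. 0 < c \<and> (\<forall>a\<in>colours. message_step w l v a = c * l v a)"
    using l_step[OF assms] by blast
  from someI_ex[OF this] show "0 < scaling v" "\<And>a. a \<in> colours \<Longrightarrow> message_step w l v a = scaling v * l v a"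
    unfolding scaling_def by blast+
qed

text \<open>For \<open>w = 0\<close> the positive contribution comes from a colour different from
  \<open>a\<close>.\<close>

lemma message_pos: "0 < message_step w l v a"
  unfolding message_step_def
proof (intro prod_pos)
  fix u assume "u \<in> children v"
  then have u: "u \<in> V" using children_subset by blast
  define b :: nat where "b = (if a = 1 then 2 else 1)"
  have "b \<in> colours" "a \<noteq> b" by (auto simp: b_def)
  then show "0 < (\<Sum>b\<in>colours. interaction w a b * l u b)"
    using l_pos[OF u] w_nonneg by (intro sum_pos2[of _ b]) (auto simp: less_imp_le)
qed

lemma weight_nonneg: "\<eta> \<in> configs (ball n) \<Longrightarrow> 0 \<le> weight n \<eta>"
  unfolding weight_def using w_nonneg l_pos sphere_subset_ball[of n] ball_subset[of n]
  by (intro mult_nonneg_nonneg potts_weight_nonneg prod_nonneg) (auto simp: configs_def PiE_iff less_imp_le subset_iff)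

text \<open>The boundary law makes the factor gained from the outer sphere independent of
  \<open>\<eta>\<close>, so the normalised weights are consistent. Consistency starts at radius 1,
  where the sphere no longer contains the root.\<close>

lemma sum_weight_extend:
  assumes "1 \<le> n" "\<eta> \<in> configs (ball n)"
  shows "(\<Sum>\<eta>' | \<eta>' \<in> configs (ball (Suc n)) \<and> restrict \<eta>' (ball n) = \<eta>. weight (Suc n) \<eta>')
    = (\<Prod>v\<in>sphere n. scaling v) * weight n \<eta>"
proof -
  have "(\<Sum>\<eta>' | \<eta>' \<in> configs (ball (Suc n)) \<and> restrict \<eta>' (ball n) = \<eta>. weight (Suc n) \<eta>')
      = potts_weight w E (ball n) \<eta> * (\<Prod>v\<in>sphere n. message_step w l v (\<eta> v))"
    using sum_weights_eq_messages[OF assms(2), where k = 1 and w = w and f = l]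
    by (simp only: weight_def Suc_eq_plus1[symmetric] One_nat_def add_Suc_right add_0_right funpow.simps o_id)
  also have "(\<Prod>v\<in>sphere n. message_step w l v (\<eta> v)) = (\<Prod>v\<in>sphere n. scaling v * l v (\<eta> v))"
  proof (intro prod.cong refl)
    fix v assume v: "v \<in> sphere n"
    then have "\<eta> v \<in> colours" using assms(2) subsetD[OF sphere_subset_ball v]
      unfolding configs_def by (blast intro: PiE_mem)
    moreover have "v \<in> V" "v \<noteq> r" using v assms(1) by (auto simp: sphere_def)
    ultimately show "message_step w l v (\<eta> v) = scaling v * l v (\<eta> v)" by (intro scaling)
  qed
  finally show ?thesis by (simp only: prod.distrib weight_def mult_ac)
qed

lemma sum_group_restrict:
  assumes "m \<le> n"
  shows "(\<Sum>\<eta>\<in>configs (ball n). F \<eta>)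
    = (\<Sum>\<tau>\<in>configs (ball m). \<Sum>\<eta> | \<eta> \<in> configs (ball n) \<and> restrict \<eta> (ball m) = \<tau>. F \<eta> :: real)"
  using finite_configs[OF finite_ball] ball_mono[OF assms]
  by (intro sum.group[symmetric]) (auto simp: configs_def PiE_iff)

lemma partition_fn_Suc: "1 \<le> n \<Longrightarrow> partition_fn (Suc n) = (\<Prod>v\<in>sphere n. scaling v) * partition_fn n"
  unfolding partition_fn_def sum_group_restrict[OF le_SucI[OF order_refl], of _ n] sum_distrib_left
  by (intro sum.cong refl sum_weight_extend)

lemma partition_fn_pos: "1 \<le> n \<Longrightarrow> 0 < partition_fn n"
proof (induction n rule: dec_induct)
  case base
  have "partition_fn 1 = (\<Sum>\<tau>\<in>configs (ball 0). potts_weight w E (ball 0) \<tau> * (\<Prod>v\<in>sphere 0. message_step w l v (\<tau> v)))"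
    unfolding partition_fn_def sum_group_restrict[OF zero_le_one]
  proof (intro sum.cong refl)
    fix \<tau> assume "\<tau> \<in> configs (ball 0)"
    from sum_weights_eq_messages[OF this, where k = 1 and w = w and f = l]
    show "(\<Sum>\<eta> | \<eta> \<in> configs (ball 1) \<and> restrict \<eta> (ball 0) = \<tau>. weight 1 \<eta>)
        = potts_weight w E (ball 0) \<tau> * (\<Prod>v\<in>sphere 0. message_step w l v (\<tau> v))"
      by (simp only: weight_def add_0 One_nat_def funpow.simps o_id)
  qed
  also have "\<dots> > 0"
  proof (rule sum_pos)
    show "0 < potts_weight w E (ball 0) \<tau> * (\<Prod>v\<in>sphere 0. message_step w l v (\<tau> v))" for \<tau>
      using message_pos by (simp add: potts_weight_ball_0 prod_pos)
  qed (use finite_configs[OF finite_ball] configs_nonempty in auto)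
  finally show ?case .
next
  case (step n)
  have "partition_fn (Suc n) = (\<Prod>v\<in>sphere n. scaling v) * partition_fn n"
    using step.hyps(1) by (rule partition_fn_Suc)
  moreover have "0 < (\<Prod>v\<in>sphere n. scaling v)"
    using step.hyps(1) by (intro prod_pos scaling) (auto simp: sphere_def)
  ultimately show ?case using step.IH by simp
qed

lemma sum_marginal_extend:
  assumes "1 \<le> n" "\<eta> \<in> configs (ball n)"
  shows "(\<Sum>\<eta>' | \<eta>' \<in> configs (ball (Suc n)) \<and> restrict \<eta>' (ball n) = \<eta>. marginal (Suc n) \<eta>') = marginal n \<eta>"
proof -
  have "0 < (\<Prod>v\<in>sphere n. scaling v)"
    using assms(1) by (intro prod_pos scaling) (auto simp: sphere_def)
  then show ?thesis
    unfolding marginal_def sum_divide_distrib[symmetric] sum_weight_extend[OF assms] partition_fn_Suc[OF assms(1)]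
    by simp
qed

section \<open>Kolmogorov extension of the marginals on balls\<close>

definition marginal_pmf :: "nat \<Rightarrow> ('v \<Rightarrow> nat) pmf" where
  "marginal_pmf n = embed_pmf (\<lambda>\<eta>. if \<eta> \<in> configs (ball n) then marginal n \<eta> else 0)"

lemma pmf_marginal:
  assumes "1 \<le> n"
  shows "pmf (marginal_pmf n) \<eta> = (if \<eta> \<in> configs (ball n) then marginal n \<eta> else 0)"
  unfolding marginal_pmf_def
proof (rule pmf_embed_pmf)
  have nn: "0 \<le> marginal n \<eta>" if "\<eta> \<in> configs (ball n)" for \<eta>
    unfolding marginal_def using weight_nonneg[OF that] partition_fn_pos[OF assms] by simp
  then show "0 \<le> (if \<eta> \<in> configs (ball n) then marginal n \<eta> else 0)" for \<eta> by simp
  have fin: "finite (configs (ball n))" by (rule finite_configs[OF finite_ball])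
  have "(\<integral>\<^sup>+\<eta>. ennreal (if \<eta> \<in> configs (ball n) then marginal n \<eta> else 0) \<partial>count_space UNIV)
      = (\<Sum>\<eta>\<in>configs (ball n). ennreal (marginal n \<eta>))"
    using fin by (subst nn_integral_count_space'[where A = "configs (ball n)"]) (auto intro!: sum.cong)
  also have "\<dots> = ennreal (\<Sum>\<eta>\<in>configs (ball n). marginal n \<eta>)"
    using nn by (intro sum_ennreal) auto
  also have "(\<Sum>\<eta>\<in>configs (ball n). marginal n \<eta>) = 1"
    unfolding marginal_def sum_divide_distrib[symmetric] partition_fn_def[symmetric]
    using partition_fn_pos[OF assms] by simp
  finally show "(\<integral>\<^sup>+\<eta>. ennreal (if \<eta> \<in> configs (ball n) then marginal n \<eta> else 0) \<partial>count_space UNIV) = 1"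
    by simp
qed

lemma set_marginal_pmf: "1 \<le> n \<Longrightarrow> set_pmf (marginal_pmf n) \<subseteq> configs (ball n)"
  by (auto simp: set_pmf_eq pmf_marginal split: if_splits)

lemma measure_marginal_pmf:
  assumes "1 \<le> n"
  shows "measure (marginal_pmf n) X = (\<Sum>\<eta> | \<eta> \<in> configs (ball n) \<and> \<eta> \<in> X. marginal n \<eta>)"
proof -
  have fin: "finite {\<eta>. \<eta> \<in> configs (ball n) \<and> \<eta> \<in> X}" using finite_configs[OF finite_ball] by simp
  have "measure (marginal_pmf n) X = measure (marginal_pmf n) {\<eta>. \<eta> \<in> configs (ball n) \<and> \<eta> \<in> X}"
    using set_marginal_pmf[OF assms] by (intro measure_eq_AE) (auto simp: AE_measure_pmf_iff)
  also have "\<dots> = (\<Sum>\<eta> | \<eta> \<in> configs (ball n) \<and> \<eta> \<in> X. marginal n \<eta>)"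
    using fin by (subst measure_measure_pmf_finite) (auto simp: pmf_marginal[OF assms] intro!: sum.cong)
  finally show ?thesis .
qed

lemma map_marginal_pmf_Suc:
  assumes "1 \<le> n"
  shows "map_pmf (\<lambda>\<eta>. restrict \<eta> (ball n)) (marginal_pmf (Suc n)) = marginal_pmf n"
proof (rule pmf_eqI)
  fix \<eta>
  have "pmf (map_pmf (\<lambda>\<eta>. restrict \<eta> (ball n)) (marginal_pmf (Suc n))) \<eta>
    = (\<Sum>\<eta>' | \<eta>' \<in> configs (ball (Suc n)) \<and> restrict \<eta>' (ball n) = \<eta>. marginal (Suc n) \<eta>')"
    by (simp only: pmf_map measure_marginal_pmf[OF le_SucI[OF assms]] vimage_singleton_eq)
  also have "\<dots> = pmf (marginal_pmf n) \<eta>"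
  proof (cases "\<eta> \<in> configs (ball n)")
    case True
    then show ?thesis using sum_marginal_extend[OF assms] by (simp only: pmf_marginal[OF assms] if_True)
  next
    case False
    have "restrict \<eta>' (ball n) \<in> configs (ball n)" if "\<eta>' \<in> configs (ball (Suc n))" for \<eta>'
      using that ball_mono[of n "Suc n"] by (auto simp: configs_def PiE_iff)
    then have "{\<eta>'. \<eta>' \<in> configs (ball (Suc n)) \<and> restrict \<eta>' (ball n) = \<eta>} = {}" using False by blast
    then show ?thesis using False by (simp only: pmf_marginal[OF assms] if_False sum.empty)
  qed
  finally show "pmf (map_pmf (\<lambda>\<eta>. restrict \<eta> (ball n)) (marginal_pmf (Suc n))) \<eta> = pmf (marginal_pmf n) \<eta>" .
qed

lemma map_marginal_pmf:
  assumes "1 \<le> n" "n \<le> n'" "U \<subseteq> ball n"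
  shows "map_pmf (\<lambda>\<eta>. restrict \<eta> U) (marginal_pmf n') = map_pmf (\<lambda>\<eta>. restrict \<eta> U) (marginal_pmf n)"
  using assms(2)
proof (induction n' rule: dec_induct)
  case (step k)
  have U: "U \<subseteq> ball k" using assms(3) ball_mono[OF step.hyps(1)] by blast
  have "1 \<le> k" using assms(1) step.hyps(1) by simp
  have "map_pmf (\<lambda>\<eta>. restrict \<eta> U) (marginal_pmf (Suc k))
      = map_pmf (\<lambda>\<eta>. restrict \<eta> U) (map_pmf (\<lambda>\<eta>. restrict \<eta> (ball k)) (marginal_pmf (Suc k)))"
    using U by (simp add: map_pmf_comp restrict_restrict Int_absorb1)
  then show ?case by (simp only: step.IH map_marginal_pmf_Suc[OF \<open>1 \<le> k\<close>])
qed simp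

text \<open>A canonical ball around \<open>J\<close>; the successor keeps its radius at least 1,
  where the marginals are consistent.\<close>

definition radius :: "'v set \<Rightarrow> nat" where
  "radius J = Suc (Max (insert 0 (level ` J)))"

lemma radius:
  assumes "finite J" "J \<subseteq> V"
  shows "1 \<le> radius J" "J \<subseteq> ball (radius J)"
proof -
  have "level v \<le> Max (insert 0 (level ` J))" if "v \<in> J" for v using assms that by (intro Max_ge) auto
  then show "J \<subseteq> ball (radius J)" using assms by (auto simp: ball_def radius_def le_SucI)
qed (simp add: radius_def)

text \<open>The type \<open>nat discrete\<close> carries the discrete topology, so that the
  projective limit for Polish spaces applies. By \<open>finite_marginal_eq\<close> any larger ball
  yields the same measure.\<close>

definition finite_marginal :: "'v set \<Rightarrow> ('v \<Rightarrow> nat discrete) measure" where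
  "finite_marginal J = distr (marginal_pmf (radius J)) (PiM J (\<lambda>_. borel)) (\<lambda>\<eta>. \<lambda>v\<in>J. discrete (\<eta> v))"

lemma finite_marginal_measurable:
  "(\<lambda>\<eta>. \<lambda>v\<in>J. discrete (\<eta> v)) \<in> measure_pmf p \<rightarrow>\<^sub>M PiM J (\<lambda>_. borel)"
  by (auto simp: measurable_def space_PiM)

lemma finite_marginal_eq:
  assumes "finite J" "J \<subseteq> ball n" "1 \<le> n"
  shows "finite_marginal J = distr (marginal_pmf n) (PiM J (\<lambda>_. borel)) (\<lambda>\<eta>. \<lambda>v\<in>J. discrete (\<eta> v))"
proof -
  have JV: "J \<subseteq> V" using assms ball_subset by blast
  define g :: "('v \<Rightarrow> nat) \<Rightarrow> 'v \<Rightarrow> nat discrete" where "g = (\<lambda>\<eta>. \<lambda>v\<in>J. discrete (\<eta> v))"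
  have g: "g (restrict \<eta> J) = g \<eta>" for \<eta> by (auto simp: g_def)
  have via: "distr (marginal_pmf k) (PiM J (\<lambda>_. borel)) g
      = distr (map_pmf (\<lambda>\<eta>. restrict \<eta> J) (marginal_pmf k)) (PiM J (\<lambda>_. borel)) g" for k
  proof -
    have "g \<in> count_space UNIV \<rightarrow>\<^sub>M PiM J (\<lambda>_. borel)" by (auto simp: g_def space_PiM)
    moreover have "(\<lambda>\<eta>. restrict \<eta> J) \<in> measure_pmf (marginal_pmf k) \<rightarrow>\<^sub>M count_space UNIV" by simp
    ultimately show ?thesis unfolding map_pmf_rep_eq by (simp only: distr_distr o_def g)
  qed
  have "map_pmf (\<lambda>\<eta>. restrict \<eta> J) (marginal_pmf (radius J)) = map_pmf (\<lambda>\<eta>. restrict \<eta> J) (marginal_pmf n)"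
    using map_marginal_pmf[OF radius(1)[OF assms(1) JV] _ radius(2)[OF assms(1) JV], of n]
      map_marginal_pmf[OF assms(3) _ assms(2), of "radius J"] by (cases "radius J \<le> n") auto
  then show ?thesis
    unfolding finite_marginal_def g_def[symmetric] via[of "radius J"] via[of n] by simp
qed

sublocale polish_projective V finite_marginal
proof (intro polish_projective.intro projective_family.intro)
  fix J H assume JH: "J \<subseteq> H" "finite H" "H \<subseteq> V"
  have J: "finite J" "J \<subseteq> ball (radius H)" using JH radius(2)[OF JH(2,3)] finite_subset by auto
  have "distr (finite_marginal H) (PiM J (\<lambda>_. borel)) (\<lambda>f. restrict f J)
      = distr (marginal_pmf (radius H)) (PiM J (\<lambda>_. borel)) (\<lambda>\<eta>. \<lambda>v\<in>J. discrete (\<eta> v))"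
    unfolding finite_marginal_def
  proof (subst distr_distr)
    show "(\<lambda>f. restrict f J) \<in> PiM H (\<lambda>_. borel) \<rightarrow>\<^sub>M PiM J (\<lambda>_. borel :: nat discrete measure)"
      using JH(1) by (rule measurable_restrict_subset)
    show "distr (marginal_pmf (radius H)) (PiM J (\<lambda>_. borel)) ((\<lambda>f. restrict f J) \<circ> (\<lambda>\<eta>. \<lambda>v\<in>H. discrete (\<eta> v)))
      = distr (marginal_pmf (radius H)) (PiM J (\<lambda>_. borel)) (\<lambda>\<eta>. \<lambda>v\<in>J. discrete (\<eta> v))"
      using JH(1) by (intro arg_cong[of _ _ "distr _ _"]) (auto simp: fun_eq_iff restrict_def)
  qed (rule finite_marginal_measurable)
  then show "finite_marginal J = distr (finite_marginal H) (PiM J (\<lambda>_. borel)) (\<lambda>f. restrict f J)"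
    using finite_marginal_eq[OF J radius(1)[OF JH(2,3)]] by simp
next
  fix J :: "'v set"
  assume "finite J" "J \<subseteq> V"
  show "prob_space (finite_marginal J)"
    unfolding finite_marginal_def by (intro prob_space.prob_space_distr finite_marginal_measurable) (rule measure_pmf.prob_space_axioms)
qed

text \<open>The projective limit takes values in all natural numbers. Each coordinate is almost
  surely a colour, and the default 1 only forces the image into the configuration space.\<close>

definition decode :: "nat discrete \<Rightarrow> nat" where
  "decode x = (if of_discrete x \<in> colours then of_discrete x else 1)"

definition gibbs :: "('v \<Rightarrow> nat) measure" where
  "gibbs = distr lim (config_space 4 V) (\<lambda>f. \<lambda>v\<in>V. decode (f v))"

lemma decode_colours: "decode x \<in> colours"
  by (auto simp: decode_def)

lemma decode_measurable: "decode \<in> borel \<rightarrow>\<^sub>M count_space colours"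
  using decode_colours by (auto simp: measurable_def sets_borel_eq_count_space)

lemma decode_restrict_measurable: "(\<lambda>f. \<lambda>v\<in>J. decode (f v)) \<in> PiM J (\<lambda>_. borel) \<rightarrow>\<^sub>M config_space 4 J"
  unfolding config_space_def
proof (rule measurable_restrict)
  fix v assume "v \<in> J"
  then have "(\<lambda>f. f v) \<in> PiM J (\<lambda>_. borel :: nat discrete measure) \<rightarrow>\<^sub>M borel"
    by (rule measurable_component_singleton)
  then show "(\<lambda>f. decode (f v)) \<in> PiM J (\<lambda>_. borel) \<rightarrow>\<^sub>M count_space colours"
    by (rule measurable_compose[OF _ decode_measurable])
qed

lemma prob_space_gibbs: "prob_space gibbs"
  unfolding gibbs_def
proof (rule P.prob_space_distr)
  show "(\<lambda>f. \<lambda>v\<in>V. decode (f v)) \<in> lim \<rightarrow>\<^sub>M config_space 4 V"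
    using decode_restrict_measurable[of V] measurable_cong_sets[OF sets_lim refl] by blast
qed

lemma sets_gibbs: "sets gibbs = sets (config_space 4 V)"
  by (simp add: gibbs_def)

lemma measure_gibbs:
  assumes n: "1 \<le> n"
  shows "measure gibbs {\<psi> \<in> colourings V. restrict \<psi> (ball n) \<in> X} = measure (marginal_pmf n) X"
proof -
  let ?B = "ball n"
  define X' where "X' = {\<psi> \<in> colourings ?B. restrict \<psi> ?B \<in> X}"
  have X'_iff: "\<eta> \<in> X' \<longleftrightarrow> \<eta> \<in> configs ?B \<and> \<eta> \<in> X" for \<eta>
    by (auto simp: X'_def configs_def PiE_restrict)
  define Y where "Y = (\<lambda>f. \<lambda>v\<in>?B. decode (f v)) -` X' \<inter> space (PiM ?B (\<lambda>_. borel))"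
  have X': "X' \<in> sets (config_space 4 ?B)"
    unfolding X'_def by (rule restrict_mem_in_sets[OF finite_ball order_refl])
  have Y: "Y \<in> sets (PiM ?B (\<lambda>_. borel))"
    unfolding Y_def by (rule measurable_sets[OF decode_restrict_measurable X'])
  have m: "(\<lambda>f. \<lambda>v\<in>V. decode (f v)) \<in> lim \<rightarrow>\<^sub>M config_space 4 V"
    using decode_restrict_measurable[of V] measurable_cong_sets[OF sets_lim refl] by blast
  note S = restrict_mem_in_sets[OF finite_ball ball_subset, of n X]
  have pre: "(\<lambda>f. \<lambda>v\<in>V. decode (f v)) -` {\<psi> \<in> colourings V. restrict \<psi> ?B \<in> X} \<inter> space lim = emb V ?B Y"
  proof (intro set_eqI)
    fix f
    have "restrict (\<lambda>v\<in>V. decode (f v)) ?B = (\<lambda>v\<in>?B. decode (restrict f ?B v))"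
      using ball_subset by (auto simp: restrict_def fun_eq_iff)
    moreover have "(\<lambda>v\<in>?B. decode (restrict f ?B v)) \<in> configs ?B"
      using decode_colours by (auto simp: configs_def)
    moreover have "(\<lambda>v\<in>V. decode (f v)) \<in> colourings V" using decode_colours by auto
    ultimately show "f \<in> (\<lambda>f. \<lambda>v\<in>V. decode (f v)) -` {\<psi> \<in> colourings V. restrict \<psi> ?B \<in> X} \<inter> space lim
        \<longleftrightarrow> f \<in> emb V ?B Y"
      unfolding prod_emb_def Y_def by (auto simp: space_PiM X'_iff)
  qed
  have "emeasure gibbs {\<psi> \<in> colourings V. restrict \<psi> ?B \<in> X} = emeasure lim (emb V ?B Y)"
    unfolding gibbs_def by (subst emeasure_distr[OF m S]) (simp only: pre)
  also have "\<dots> = emeasure (finite_marginal ?B) Y"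
    by (rule emeasure_lim_emb[OF ball_subset finite_ball Y])
  also have "\<dots> = emeasure (marginal_pmf n) ((\<lambda>\<eta>. \<lambda>v\<in>?B. discrete (\<eta> v)) -` Y)"
    unfolding finite_marginal_eq[OF finite_ball order_refl n]
    by (subst emeasure_distr[OF finite_marginal_measurable Y]) simp
  also have "\<dots> = emeasure (marginal_pmf n) X"
  proof (rule emeasure_eq_AE)
    show "AE \<eta> in marginal_pmf n. \<eta> \<in> (\<lambda>\<eta>. \<lambda>v\<in>?B. discrete (\<eta> v)) -` Y \<longleftrightarrow> \<eta> \<in> X"
    proof (intro AE_pmfI)
      fix \<eta> assume "\<eta> \<in> set_pmf (marginal_pmf n)"
      then have \<eta>: "\<eta> \<in> configs ?B" using set_marginal_pmf[OF n] by blast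
      have "(\<lambda>v\<in>?B. decode ((\<lambda>v\<in>?B. discrete (\<eta> v)) v)) = \<eta>"
        using \<eta> by (intro ext) (auto simp: configs_def decode_def discrete_inverse PiE_iff extensional_def)
      then show "\<eta> \<in> (\<lambda>\<eta>. \<lambda>v\<in>?B. discrete (\<eta> v)) -` Y \<longleftrightarrow> \<eta> \<in> X"
        using \<eta> unfolding Y_def by (auto simp: space_PiM X'_iff)
    qed
  qed auto
  finally show ?thesis by (simp add: measure_def)
qed

section \<open>The Gibbs property of the limit measure\<close>

lemma weight_exchange:
  assumes U: "U \<subseteq> ball n" and agree: "\<And>v. v \<in> ball (Suc n) - graph_interior V E U \<Longrightarrow> \<eta> v = \<eta>' v"
  shows "weight (Suc n) \<eta> * potts_weight w E U \<eta>' = weight (Suc n) \<eta>' * potts_weight w E U \<eta>"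
proof -
  let ?B = "ball (Suc n)"
  have UB: "U \<subseteq> ?B" using U ball_mono[of n "Suc n"] by auto
  \<comment> \<open>The edges outside \<open>U\<close> avoid the interior, where alone the two
    configurations may differ, so their contribution cancels. The boundary-law factors cancel too,
    because \<open>U \<subseteq> ball n\<close> does not meet \<open>sphere (Suc n)\<close>.\<close>
  define out where "out \<sigma> = {e \<in> monochromatic_edges E ?B \<sigma>. \<not> e \<subseteq> U}" for \<sigma>
  have split: "potts_weight w E ?B \<sigma> = potts_weight w E U \<sigma> * w ^ card (out \<sigma>)" for \<sigma>
  proof -
    have "finite (monochromatic_edges E ?B \<sigma>)"
      by (rule finite_subset[of _ "Pow ?B"]) (auto simp: monochromatic_edges_def finite_ball)
    moreover have "monochromatic_edges E ?B \<sigma> = monochromatic_edges E U \<sigma> \<union> out \<sigma>"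
      "monochromatic_edges E U \<sigma> \<inter> out \<sigma> = {}"
      using UB by (auto simp: monochromatic_edges_def out_def)
    ultimately have "card (monochromatic_edges E ?B \<sigma>) = card (monochromatic_edges E U \<sigma>) + card (out \<sigma>)"
      by (metis card_Un_disjoint finite_Un)
    then show ?thesis by (simp add: potts_weight_def power_add)
  qed
  have mono: "(\<forall>u\<in>e. \<forall>v\<in>e. \<eta> u = \<eta> v) \<longleftrightarrow> (\<forall>u\<in>e. \<forall>v\<in>e. \<eta>' u = \<eta>' v)"
    if "e \<in> E" "e \<subseteq> ?B" "\<not> e \<subseteq> U" for e
  proof (intro ball_cong refl)
    fix u v assume "u \<in> e" "v \<in> e"
    then have "\<eta> u = \<eta>' u" "\<eta> v = \<eta>' v"
      using that edge_meets_interior[OF that(1)] by (blast intro: agree)+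
    then show "(\<eta> u = \<eta> v) = (\<eta>' u = \<eta>' v)" by (simp only:)
  qed
  have "out \<eta> = out \<eta>'"
  proof (intro set_eqI iffI)
    show "e \<in> out \<eta>'" if "e \<in> out \<eta>" for e
      using that mono[of e] unfolding out_def monochromatic_edges_def by blast
    show "e \<in> out \<eta>" if "e \<in> out \<eta>'" for e
      using that mono[of e] unfolding out_def monochromatic_edges_def by blast
  qed
  moreover have "(\<Prod>u\<in>sphere (Suc n). l u (\<eta> u)) = (\<Prod>u\<in>sphere (Suc n). l u (\<eta>' u))"
  proof (intro prod.cong refl)
    fix u assume "u \<in> sphere (Suc n)"
    then have "u \<in> ?B" "u \<notin> U" using sphere_subset_ball ball_sphere_disjoint U by blast+
    then have "\<eta> u = \<eta>' u" by (intro agree) (auto simp: graph_interior_def)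
    then show "l u (\<eta> u) = l u (\<eta>' u)" by simp
  qed
  ultimately show ?thesis by (simp add: weight_def split)
qed

text \<open>Exchanging the values on \<open>U\<close> between \<open>\<tau>\<close> and
  \<open>\<sigma>\<close> is a bijection of pairs that preserves the product of the weights. The
  identity is cross-multiplied because the sum over \<open>\<sigma>\<close> can vanish when
  \<open>w = 0\<close>.\<close>

lemma sum_weight_exchange:
  assumes U: "U \<subseteq> ball n" and U': "U' \<subseteq> ball n" "U' \<inter> graph_interior V E U = {}"
    and \<eta>: "\<eta> \<in> colourings U"
  defines "B \<equiv> inner_boundary V E U"
  shows "(\<Sum>\<eta>' | \<eta>' \<in> configs (ball (Suc n)) \<and> restrict \<eta>' U' = \<zeta> \<and> restrict \<eta>' U = \<eta>. weight (Suc n) \<eta>')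
      * (\<Sum>\<sigma> \<in> {\<sigma> \<in> colourings U. \<forall>v\<in>B. \<sigma> v = \<eta> v}. potts_weight w E U \<sigma>)
    = potts_weight w E U \<eta>
      * (\<Sum>\<eta>' | \<eta>' \<in> configs (ball (Suc n)) \<and> restrict \<eta>' U' = \<zeta> \<and> restrict \<eta>' B = restrict \<eta> B. weight (Suc n) \<eta>')"
proof -
  let ?N = "ball (Suc n)"
  have UN: "U \<subseteq> ?N" "U' \<subseteq> ?N" using U U' ball_mono[of n "Suc n"] by auto
  have B: "B \<subseteq> U" "x \<in> U \<Longrightarrow> x \<notin> graph_interior V E U \<Longrightarrow> x \<in> B" for x
    by (auto simp: B_def inner_boundary_def graph_interior_def)
  define X1 where "X1 = {\<eta>'. \<eta>' \<in> configs ?N \<and> restrict \<eta>' U' = \<zeta> \<and> restrict \<eta>' U = \<eta>}"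
  define X2 where "X2 = {\<eta>'. \<eta>' \<in> configs ?N \<and> restrict \<eta>' U' = \<zeta> \<and> restrict \<eta>' B = restrict \<eta> B}"
  define S where "S = {\<sigma> \<in> colourings U. \<forall>v\<in>B. \<sigma> v = \<eta> v}"
  define swap :: "('v \<Rightarrow> nat) \<Rightarrow> ('v \<Rightarrow> nat) \<Rightarrow> 'v \<Rightarrow> nat"
    where "swap \<tau> \<sigma> = (\<lambda>x\<in>?N. if x \<in> U then \<sigma> x else \<tau> x)" for \<tau> \<sigma>
  have swap_configs: "swap \<tau> \<sigma> \<in> configs ?N" if "\<tau> \<in> configs ?N" "\<sigma> \<in> colourings U" for \<tau> \<sigma>
    using that by (auto simp: swap_def configs_def PiE_iff)
  have restrict_swap: "restrict (swap \<tau> \<sigma>) U = \<sigma>" if "\<sigma> \<in> colourings U" for \<tau> \<sigma>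
    using that UN by (intro ext) (auto simp: swap_def PiE_iff extensional_def)
  have swap_off: "swap \<tau> \<sigma> x = \<tau> x"
    if "x \<in> ?N - graph_interior V E U" "\<And>v. v \<in> B \<Longrightarrow> \<sigma> v = \<tau> v" for \<tau> \<sigma> x
    using that B(2)[of x] by (auto simp: swap_def)
  have restrict_off: "restrict (swap \<tau> \<sigma>) U' = restrict \<tau> U'" if "\<And>v. v \<in> B \<Longrightarrow> \<sigma> v = \<tau> v" for \<tau> \<sigma>
  proof (intro restrict_ext)
    fix x assume "x \<in> U'"
    then show "swap \<tau> \<sigma> x = \<tau> x" using UN U' that by (intro swap_off) auto
  qed
  have eq_on_B: "\<tau> v = \<eta> v" if "\<tau> \<in> X1 \<or> \<tau> \<in> X2" "v \<in> B" for \<tau> v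
    using that(1)
  proof
    assume "\<tau> \<in> X1"
    then have "restrict \<tau> U = \<eta>" by (simp only: X1_def mem_Collect_eq)
    then have "restrict \<tau> U v = \<eta> v" by (rule fun_cong)
    then show ?thesis using that(2) B(1) by auto
  next
    assume "\<tau> \<in> X2"
    then have "restrict \<tau> B = restrict \<eta> B" by (simp only: X2_def mem_Collect_eq)
    then have "restrict \<tau> B v = restrict \<eta> B v" by (rule fun_cong)
    then show ?thesis using that(2) by simp
  qed
  have "(\<Sum>\<eta>'\<in>X1. weight (Suc n) \<eta>') * (\<Sum>\<sigma>\<in>S. potts_weight w E U \<sigma>)
      = (\<Sum>p\<in>X1 \<times> S. weight (Suc n) (fst p) * potts_weight w E U (snd p))"
    by (simp add: sum_product sum.cartesian_product case_prod_beta)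
  also have "\<dots> = (\<Sum>\<eta>'\<in>X2. potts_weight w E U \<eta> * weight (Suc n) \<eta>')"
  proof (rule sum.reindex_bij_witness[where i = "\<lambda>\<tau>. (swap \<tau> \<eta>, restrict \<tau> U)" and j = "\<lambda>p. swap (fst p) (snd p)"])
    fix p assume "p \<in> X1 \<times> S"
    then obtain \<tau> \<sigma> where p: "p = (\<tau>, \<sigma>)" "\<tau> \<in> X1" "\<sigma> \<in> S" by auto
    have "\<sigma> v = \<tau> v" if "v \<in> B" for v
      using p(2,3) that eq_on_B[of \<tau> v] by (simp add: S_def)
    then have \<sigma>: "\<sigma> \<in> colourings U" "\<And>v. v \<in> B \<Longrightarrow> \<sigma> v = \<tau> v"
      using p(3) by (auto simp: S_def)
    have \<tau>: "\<tau> \<in> configs ?N" "restrict \<tau> U' = \<zeta>" "restrict \<tau> U = \<eta>" using p(2) by (auto simp: X1_def)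
    have "swap (swap \<tau> \<sigma>) \<eta> = \<tau>"
    proof
      fix x
      have "\<eta> x = \<tau> x" if "x \<in> U" using that \<tau>(3) by auto
      then show "swap (swap \<tau> \<sigma>) \<eta> x = \<tau> x"
        using \<tau>(1) by (auto simp: swap_def configs_def PiE_iff extensional_def)
    qed
    then show "(swap (swap (fst p) (snd p)) \<eta>, restrict (swap (fst p) (snd p)) U) = p"
      using restrict_swap[OF \<sigma>(1)] p(1) by simp
    have "restrict (swap \<tau> \<sigma>) B = restrict \<eta> B"
    proof (intro restrict_ext)
      fix v assume v: "v \<in> B"
      then have "swap \<tau> \<sigma> v = \<sigma> v" using B(1) UN by (auto simp: swap_def)
      then show "swap \<tau> \<sigma> v = \<eta> v" using v p(3) by (simp add: S_def)
    qed
    then show "swap (fst p) (snd p) \<in> X2"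
      using restrict_off[OF \<sigma>(2)] \<tau> swap_configs[OF \<tau>(1) \<sigma>(1)] p(1) by (simp add: X2_def)
    have "weight (Suc n) (swap \<tau> \<sigma>) * potts_weight w E U \<tau> = weight (Suc n) \<tau> * potts_weight w E U (swap \<tau> \<sigma>)"
      using U swap_off \<sigma>(2) by (intro weight_exchange) auto
    moreover have "potts_weight w E U \<tau> = potts_weight w E U \<eta>"
      by (rule potts_weight_cong) (use \<tau>(3) in auto)
    moreover have "potts_weight w E U (swap \<tau> \<sigma>) = potts_weight w E U \<sigma>"
      using UN by (intro potts_weight_cong) (auto simp: swap_def)
    ultimately show "potts_weight w E U \<eta> * weight (Suc n) (swap (fst p) (snd p))
        = weight (Suc n) (fst p) * potts_weight w E U (snd p)"
      by (simp add: p(1) mult.commute)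
  next
    fix \<tau> assume \<tau>: "\<tau> \<in> X2"
    have cfg: "\<tau> \<in> configs ?N" "restrict \<tau> U' = \<zeta>" using \<tau> by (auto simp: X2_def)
    have eqB: "\<eta> v = \<tau> v" if "v \<in> B" for v using eq_on_B[of \<tau> v] \<tau> that by simp
    have "swap (swap \<tau> \<eta>) (restrict \<tau> U) = \<tau>"
      using cfg(1) by (intro ext) (auto simp: swap_def configs_def PiE_iff extensional_def)
    then show "swap (fst (swap \<tau> \<eta>, restrict \<tau> U)) (snd (swap \<tau> \<eta>, restrict \<tau> U)) = \<tau>" by simp
    have "restrict \<tau> U \<in> S"
      using cfg(1) UN B(1) eqB by (auto simp: S_def configs_def PiE_iff)
    then show "(swap \<tau> \<eta>, restrict \<tau> U) \<in> X1 \<times> S"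
      using swap_configs[OF cfg(1) \<eta>] restrict_off[OF eqB] cfg(2) restrict_swap[OF \<eta>] by (simp add: X1_def)
  qed
  finally show ?thesis unfolding X1_def X2_def S_def sum_distrib_left .
qed

lemma measure_gibbs_sum:
  assumes "1 \<le> n" "U \<subseteq> ball n" "U' \<subseteq> ball n"
  shows "measure gibbs (cyl V U' \<zeta> \<inter> cyl V U \<eta>)
    = (\<Sum>\<eta>' | \<eta>' \<in> configs (ball n) \<and> restrict \<eta>' U' = \<zeta> \<and> restrict \<eta>' U = \<eta>. weight n \<eta>') / partition_fn n"
proof -
  define X where "X = {\<eta>'. restrict \<eta>' U' = \<zeta> \<and> restrict \<eta>' U = \<eta>}"
  have "cyl V U' \<zeta> \<inter> cyl V U \<eta> = {\<psi> \<in> colourings V. restrict \<psi> (ball n) \<in> X}"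
    using assms(2,3) by (auto simp: X_def cyl_def restrict_restrict Int_absorb1)
  then have "measure gibbs (cyl V U' \<zeta> \<inter> cyl V U \<eta>) = measure (marginal_pmf n) X"
    by (simp only: measure_gibbs[OF assms(1)])
  then show ?thesis
    by (simp only: measure_marginal_pmf[OF assms(1)] marginal_def sum_divide_distrib X_def mem_Collect_eq)
qed

text \<open>Dividing by \<open>Z\<close> is safe: if \<open>Z = 0\<close>, then \<open>w = 0\<close>
  and \<open>\<eta>\<close> has a monochromatic edge inside \<open>U\<close>, so every configuration
  extending \<open>\<eta>\<close> has weight 0 and both sides vanish.\<close>

lemma gibbs_exchange:
  assumes U: "finite U" "U \<subseteq> V" and U': "finite U'" "U' \<subseteq> V - graph_interior V E U"
    and \<eta>: "\<eta> \<in> colourings U"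
  defines "B \<equiv> inner_boundary V E U"
  shows "measure gibbs (cyl V U' \<zeta> \<inter> cyl V U \<eta>)
    = potts_boundary_prob 4 w V E U \<eta> * measure gibbs (cyl V U' \<zeta> \<inter> cyl V B (restrict \<eta> B))"
proof -
  have "finite (U \<union> U')" "U \<union> U' \<subseteq> V" using U U' by auto
  then obtain n where n: "U \<union> U' \<subseteq> ball n" by (rule finite_subset_ball)
  then have UU: "U \<subseteq> ball n" "U' \<subseteq> ball n" "U \<subseteq> ball (Suc n)" "U' \<subseteq> ball (Suc n)" "B \<subseteq> ball (Suc n)"
    using ball_mono[of n "Suc n"] by (auto simp: B_def inner_boundary_def)
  define X1 where "X1 = (\<Sum>\<eta>' | \<eta>' \<in> configs (ball (Suc n)) \<and> restrict \<eta>' U' = \<zeta> \<and> restrict \<eta>' U = \<eta>. weight (Suc n) \<eta>')"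
  define X2 where "X2 = (\<Sum>\<eta>' | \<eta>' \<in> configs (ball (Suc n)) \<and> restrict \<eta>' U' = \<zeta> \<and> restrict \<eta>' B = restrict \<eta> B. weight (Suc n) \<eta>')"
  define Z where "Z = (\<Sum>\<sigma> \<in> {\<sigma> \<in> colourings U. \<forall>v\<in>B. \<sigma> v = \<eta> v}. potts_weight w E U \<sigma>)"
  have "X1 * Z = potts_weight w E U \<eta> * X2"
    unfolding X1_def X2_def Z_def B_def using UU U' \<eta> by (intro sum_weight_exchange) auto
  moreover have "X1 = 0" if "Z = 0"
  proof -
    have "finite (colourings U)" using U by (intro finite_PiE) auto
    then have "\<forall>\<sigma>\<in>{\<sigma> \<in> colourings U. \<forall>v\<in>B. \<sigma> v = \<eta> v}. potts_weight w E U \<sigma> = 0"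
      using that unfolding Z_def by (subst (asm) sum_nonneg_eq_0_iff) (auto simp: potts_weight_nonneg[OF w_nonneg])
    then have w\<eta>: "potts_weight w E U \<eta> = 0" using \<eta> by blast
    then have card_ne: "w = 0" "card (monochromatic_edges E U \<eta>) \<noteq> 0" by (auto simp: potts_weight_def)
    show ?thesis
      unfolding X1_def
    proof (intro sum.neutral ballI)
      fix \<tau> assume "\<tau> \<in> {\<eta>'. \<eta>' \<in> configs (ball (Suc n)) \<and> restrict \<eta>' U' = \<zeta> \<and> restrict \<eta>' U = \<eta>}"
      then have \<tau>U: "restrict \<tau> U = \<eta>" by blast
      have "monochromatic_edges E U \<eta> \<subseteq> monochromatic_edges E (ball (Suc n)) \<tau>"
      proof
        fix e assume "e \<in> monochromatic_edges E U \<eta>"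
        then have e: "e \<in> E" "e \<subseteq> U" "\<And>u v. u \<in> e \<Longrightarrow> v \<in> e \<Longrightarrow> \<eta> u = \<eta> v"
          unfolding monochromatic_edges_def by blast+
        have "\<tau> u = \<eta> u" if "u \<in> e" for u
        proof -
          have "restrict \<tau> U u = \<eta> u" using \<tau>U by (rule fun_cong)
          then show ?thesis using that e(2) by auto
        qed
        then have "\<tau> u = \<tau> v" if "u \<in> e" "v \<in> e" for u v using e(3)[OF that] that by simp
        then show "e \<in> monochromatic_edges E (ball (Suc n)) \<tau>"
          using e(1,2) UU(3) unfolding monochromatic_edges_def by blast
      qed
      moreover have "finite (monochromatic_edges E (ball (Suc n)) \<tau>)"
        by (rule finite_subset[of _ "Pow (ball (Suc n))"]) (auto simp: monochromatic_edges_def finite_ball)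
      ultimately have "card (monochromatic_edges E (ball (Suc n)) \<tau>) \<noteq> 0"
        using card_ne(2) card_mono by (metis le_zero_eq)
      then have "potts_weight w E (ball (Suc n)) \<tau> = 0"
        unfolding potts_weight_def card_ne(1) by (simp add: power_0_left)
      then show "weight (Suc n) \<tau> = 0" by (simp only: weight_def mult_zero_left)
    qed
  qed
  ultimately have "X1 = potts_weight w E U \<eta> / Z * X2" by (cases "Z = 0") (auto simp: field_simps)
  moreover have "measure gibbs (cyl V U' \<zeta> \<inter> cyl V U \<eta>) = X1 / partition_fn (Suc n)"
    unfolding X1_def using UU by (intro measure_gibbs_sum) auto
  moreover have "measure gibbs (cyl V U' \<zeta> \<inter> cyl V B (restrict \<eta> B)) = X2 / partition_fn (Suc n)"
    unfolding X2_def using UU by (intro measure_gibbs_sum) auto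
  moreover have "potts_boundary_prob 4 w V E U \<eta> = potts_weight w E U \<eta> / Z"
    by (simp only: potts_boundary_prob_def Z_def B_def)
  ultimately show ?thesis by simp
qed

text \<open>As functions of \<open>A\<close> both sides are finite measures, and cylinders over
  \<open>W\<close> are an intersection-stable generator on which they agree by
  \<open>gibbs_exchange\<close>; the rest is the Dynkin argument.\<close>

lemma gibbs_exchange_sets:
  assumes U: "finite U" "U \<subseteq> V" and \<eta>: "\<eta> \<in> colourings U"
  defines "B \<equiv> inner_boundary V E U" and "W \<equiv> V - graph_interior V E U"
  assumes A: "A \<in> sets (restriction_algebra 4 V W)"
  shows "measure gibbs (A \<inter> cyl V U \<eta>)
    = potts_boundary_prob 4 w V E U \<eta> * measure gibbs (A \<inter> cyl V B (restrict \<eta> B))"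
proof -
  interpret G: prob_space gibbs by (rule prob_space_gibbs)
  define C where "C = cyl V U \<eta>"
  define D where "D = cyl V B (restrict \<eta> B)"
  define P where "P = potts_boundary_prob 4 w V E U \<eta>"
  define pre where "pre X = (\<lambda>\<psi>. restrict \<psi> W) -` X \<inter> (colourings V)" for X
  have WV: "W \<subseteq> V" by (auto simp: W_def)
  have "B \<subseteq> U" by (auto simp: B_def inner_boundary_def)
  then have C_sets: "C \<in> sets gibbs" and D_sets: "D \<in> sets gibbs"
    unfolding sets_gibbs C_def D_def using U finite_subset[of B U] by (auto intro!: cyl_in_sets)
  have maps: "(\<lambda>\<psi>. restrict \<psi> W) \<in> (colourings V) \<rightarrow> (colourings W)"
    using WV by (auto simp: PiE_iff)
  have pre_sets: "pre X \<in> sets gibbs" if "X \<in> sets (config_space 4 W)" for X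
  proof -
    have "pre X \<in> sets (restriction_algebra 4 V W)"
      unfolding pre_def restriction_algebra_def using that by (rule in_vimage_algebra)
    then show ?thesis using subalgebra_restriction_algebra[OF sets_gibbs WV] by (auto simp: subalgebra_def)
  qed
  have "space (config_space 4 W) = colourings W" by (rule space_config_space)
  then obtain X where X: "X \<in> sets (config_space 4 W)" "A = pre X"
    using A maps unfolding restriction_algebra_def pre_def by (subst (asm) sets_vimage_algebra2) auto
  have cylinder: "measure gibbs (pre (cyl W U' \<zeta>) \<inter> C) = P * measure gibbs (pre (cyl W U' \<zeta>) \<inter> D)"
    if U': "finite U'" "U' \<subseteq> W" for U' \<zeta>
  proof -
    have "pre (cyl W U' \<zeta>) = cyl V U' \<zeta>"
    proof (intro set_eqI)
      fix \<psi> :: "'v \<Rightarrow> nat"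
      have "restrict (restrict \<psi> W) U' = restrict \<psi> U'" using U' by (simp add: restrict_restrict Int_absorb1)
      moreover have "restrict \<psi> W \<in> colourings W" if "\<psi> \<in> colourings V"
        using maps that by blast
      ultimately show "\<psi> \<in> pre (cyl W U' \<zeta>) \<longleftrightarrow> \<psi> \<in> cyl V U' \<zeta>"
        unfolding pre_def cyl_def vimage_eq Int_iff mem_Collect_eq by metis
    qed
    then show ?thesis
      using gibbs_exchange[OF U U'(1) _ \<eta>, of \<zeta>] U' by (simp add: W_def C_def D_def P_def B_def)
  qed
  have whole: "measure gibbs (pre (colourings W) \<inter> C) = P * measure gibbs (pre (colourings W) \<inter> D)"
  proof -
    have "colourings W = cyl W {} (\<lambda>_. undefined)" by (auto simp: cyl_def restrict_def)
    then show ?thesis using cylinder[of "{}"] by simp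
  qed
  have closed: "finite_cylinders W \<subseteq> Pow (colourings W)" by (auto simp: finite_cylinders_def cyl_def)
  have "measure gibbs (pre X \<inter> C) = P * measure gibbs (pre X \<inter> D)"
    using Int_stable_finite_cylinders[of W] closed X(1)[unfolded sets_config_space_eq_finite_cylinders]
  proof (induction X rule: sigma_sets_induct_disjoint)
    case (basic A)
    then show ?case using cylinder by (auto simp: finite_cylinders_def pre_def)
  next
    case empty
    then show ?case by (simp add: pre_def)
  next
    case (compl A)
    have A: "A \<in> sets (config_space 4 W)" using compl sets_config_space_eq_finite_cylinders by blast
    have compl_eq: "measure gibbs (pre ((colourings W) - A) \<inter> S)
        = measure gibbs (pre (colourings W) \<inter> S) - measure gibbs (pre A \<inter> S)" if "S \<in> sets gibbs" for S
    proof -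
      have "colourings W \<in> sets (config_space 4 W)"
        using sets.top[of "config_space 4 W"] by (simp add: space_config_space)
      moreover have "pre A \<subseteq> pre (colourings W)" using maps by (auto simp: pre_def)
      ultimately have "measure gibbs (pre (colourings W) \<inter> S - pre A \<inter> S)
          = measure gibbs (pre (colourings W) \<inter> S) - measure gibbs (pre A \<inter> S)"
        using that pre_sets A by (intro G.finite_measure_Diff) auto
      moreover have "pre ((colourings W) - A) \<inter> S = pre (colourings W) \<inter> S - pre A \<inter> S"
        by (auto simp: pre_def)
      ultimately show ?thesis by simp
    qed
    show ?case
      unfolding compl_eq[OF C_sets] compl_eq[OF D_sets] whole compl.IH by (simp add: right_diff_distrib)
  next
    case (union A)
    have A: "A i \<in> sets (config_space 4 W)" for i using union sets_config_space_eq_finite_cylinders by blast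
    have sums: "(\<lambda>i. measure gibbs (pre (A i) \<inter> S)) sums measure gibbs (pre (\<Union>i. A i) \<inter> S)"
      if "S \<in> sets gibbs" for S
    proof -
      have "disjoint_family (\<lambda>i. pre (A i) \<inter> S)"
        using union(1) by (auto simp: disjoint_family_on_def pre_def)
      moreover have "range (\<lambda>i. pre (A i) \<inter> S) \<subseteq> sets gibbs" using pre_sets[OF A] that by auto
      moreover have "(\<Union>i. pre (A i) \<inter> S) = pre (\<Union>i. A i) \<inter> S" by (auto simp: pre_def)
      ultimately show ?thesis using G.finite_measure_UNION[of "\<lambda>i. pre (A i) \<inter> S"] by simp
    qed
    have "(\<lambda>i. P * measure gibbs (pre (A i) \<inter> D)) sums (P * measure gibbs (pre (\<Union>i. A i) \<inter> D))"
      by (intro sums_mult sums D_sets)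
    then show ?case using sums[OF C_sets] union.IH sums_unique2 by simp
  qed
  then show ?thesis unfolding X(2) C_def D_def P_def .
qed

text \<open>For a fixed pattern \<open>\<eta>\<close> the exchange identity characterises the
  conditional expectation of its cylinder. There are finitely many patterns, so outside one null set
  all these formulas hold, in particular for the restriction of \<open>\<phi>\<close>
  itself.\<close>

theorem potts_gibbs_measure_gibbs: "potts_gibbs_measure 4 w V E gibbs"
  unfolding potts_gibbs_measure_def
proof (intro conjI allI impI)
  show "prob_space gibbs" by (rule prob_space_gibbs)
  show "sets gibbs = sets (config_space 4 V)" by (rule sets_gibbs)
  interpret G: prob_space gibbs by (rule prob_space_gibbs)
  have space: "space gibbs = colourings V"
    using sets_eq_imp_space_eq[OF sets_gibbs] by (simp add: space_config_space)
  fix U assume "finite U \<and> U \<subseteq> V"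
  then have U: "finite U" "U \<subseteq> V" by auto
  define B where "B = inner_boundary V E U"
  define F where "F = restriction_algebra 4 V (V - graph_interior V E U)"
  have BU: "B \<subseteq> U" by (auto simp: B_def inner_boundary_def)
  have sub: "subalgebra gibbs F"
    unfolding F_def by (rule subalgebra_restriction_algebra[OF sets_gibbs]) auto
  interpret S: finite_measure_subalgebra gibbs F by unfold_locales (rule sub)
  have cond: "AE \<phi> in gibbs. real_cond_exp gibbs F (indicator (cyl V U \<eta>)) \<phi>
      = potts_boundary_prob 4 w V E U \<eta> * indicator (cyl V B (restrict \<eta> B)) \<phi>"
    if \<eta>: "\<eta> \<in> colourings U" for \<eta>
  proof (rule S.real_cond_exp_charact)
    let ?C = "cyl V U \<eta>" and ?D = "cyl V B (restrict \<eta> B)" and ?P = "potts_boundary_prob 4 w V E U \<eta>"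
    have C: "?C \<in> sets gibbs" unfolding sets_gibbs by (rule cyl_in_sets[OF U])
    have D: "?D \<in> sets gibbs" unfolding sets_gibbs using U BU finite_subset by (intro cyl_in_sets) auto
    have D_F: "?D \<in> sets F"
      unfolding F_def using inner_boundary_cyl_in_sets[OF U] by (simp only: B_def)
    show "integrable gibbs (indicator ?C :: _ \<Rightarrow> real)" using C by (simp add: less_top[symmetric])
    show "integrable gibbs (\<lambda>\<phi>. ?P * indicator ?D \<phi>)" using D by (simp add: less_top[symmetric])
    show "(\<lambda>\<phi>. ?P * indicator ?D \<phi>) \<in> borel_measurable F" using D_F by measurable
    fix A assume A: "A \<in> sets F"
    then have A': "A \<in> sets gibbs" using sub by (auto simp: subalgebra_def)
    have "(LINT x:A|gibbs. indicator ?C x) = measure gibbs (A \<inter> ?C)"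
      using A' C by (simp add: set_lebesgue_integral_def flip: indicator_inter_arith)
    also have "\<dots> = ?P * measure gibbs (A \<inter> ?D)"
      unfolding B_def using A by (intro gibbs_exchange_sets[OF U \<eta>]) (simp add: F_def)
    also have "\<dots> = (LINT x:A|gibbs. ?P * indicator ?D x)"
    proof -
      have "(\<lambda>x. indicator A x *\<^sub>R (?P * indicator ?D x)) = (\<lambda>x. ?P * indicator (A \<inter> ?D) x)"
        by (auto simp: fun_eq_iff indicator_def)
      then have "(LINT x:A|gibbs. ?P * indicator ?D x) = (LINT x|gibbs. ?P * indicator (A \<inter> ?D) x)"
        unfolding set_lebesgue_integral_def by (simp only:)
      also have "\<dots> = ?P * measure gibbs (A \<inter> ?D)" using A' D by simp
      finally show ?thesis by (rule sym)
    qed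
    finally show "(LINT x:A|gibbs. indicator ?C x) = (LINT x:A|gibbs. ?P * indicator ?D x)" .
  qed
  have "finite (colourings U)" using U by (intro finite_PiE) auto
  then have "AE \<phi> in gibbs. \<forall>\<eta>\<in>colourings U. real_cond_exp gibbs F (indicator (cyl V U \<eta>)) \<phi>
      = potts_boundary_prob 4 w V E U \<eta> * indicator (cyl V B (restrict \<eta> B)) \<phi>"
    using cond by (intro AE_finite_allI)
  then show "AE \<phi> in gibbs. real_cond_exp gibbs (restriction_algebra 4 V (V - graph_interior V E U))
      (indicator {\<psi> \<in> space gibbs. restrict \<psi> U = restrict \<phi> U}) \<phi> = potts_boundary_prob 4 w V E U \<phi>"
  proof (rule AE_mp, intro AE_I2 impI)
    fix \<phi> assume \<phi>: "\<phi> \<in> space gibbs"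
      and all: "\<forall>\<eta>\<in>colourings U. real_cond_exp gibbs F (indicator (cyl V U \<eta>)) \<phi>
        = potts_boundary_prob 4 w V E U \<eta> * indicator (cyl V B (restrict \<eta> B)) \<phi>"
    define \<eta> where "\<eta> = restrict \<phi> U"
    have "\<eta> \<in> colourings U" using \<phi> U space by (auto simp: \<eta>_def PiE_iff)
    moreover have "\<phi> \<in> cyl V B (restrict \<eta> B)"
      using \<phi> BU space by (simp add: \<eta>_def cyl_def restrict_restrict Int_absorb1)
    moreover have "potts_boundary_prob 4 w V E U \<eta> = potts_boundary_prob 4 w V E U \<phi>"
      by (rule potts_boundary_prob_cong) (simp add: \<eta>_def)
    moreover have "{\<psi> \<in> space gibbs. restrict \<psi> U = restrict \<phi> U} = cyl V U \<eta>"
      by (simp only: \<eta>_def cyl_def space)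
    ultimately show "real_cond_exp gibbs (restriction_algebra 4 V (V - graph_interior V E U))
      (indicator {\<psi> \<in> space gibbs. restrict \<psi> U = restrict \<phi> U}) \<phi> = potts_boundary_prob 4 w V E U \<phi>"
      using all by (simp add: F_def)
  qed
qed

end
section \<open>A second Gibbs measure\<close>

context boundary_law
begin

lemma root_marginal:
  assumes "a \<in> colours"
  shows "measure gibbs (cyl V {r} (\<lambda>x\<in>{r}. a)) = message_step w l r a / partition_fn 1"
proof -
  define \<tau> where "\<tau> = (\<lambda>x\<in>{r}. a)"
  have \<tau>: "\<tau> \<in> configs (ball 0)" using assms by (auto simp: \<tau>_def configs_def ball_0)
  have "cyl V {r} \<tau> = {\<psi> \<in> colourings V. restrict \<psi> (ball 1) \<in> {\<eta>. restrict \<eta> (ball 0) = \<tau>}}"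
    using ball_mono[of 0 1] by (simp add: cyl_def ball_0 restrict_restrict Int_absorb1)
  then have "measure gibbs (cyl V {r} \<tau>) = measure (marginal_pmf 1) {\<eta>. restrict \<eta> (ball 0) = \<tau>}"
    by (simp only: measure_gibbs[OF order_refl])
  also have "\<dots> = (\<Sum>\<eta> | \<eta> \<in> configs (ball 1) \<and> restrict \<eta> (ball 0) = \<tau>. weight 1 \<eta>) / partition_fn 1"
    by (simp only: measure_marginal_pmf[OF order_refl] marginal_def sum_divide_distrib mem_Collect_eq)
  also have "(\<Sum>\<eta> | \<eta> \<in> configs (ball 1) \<and> restrict \<eta> (ball 0) = \<tau>. weight 1 \<eta>)
      = potts_weight w E (ball 0) \<tau> * (\<Prod>v\<in>sphere 0. message_step w l v (\<tau> v))"
    using sum_weights_eq_messages[OF \<tau>, where k = 1 and w = w and f = l]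
    by (simp only: weight_def add_0 One_nat_def funpow.simps o_id)
  also have "\<dots> = message_step w l r a"
    by (simp add: potts_weight_ball_0 sphere_0 \<tau>_def)
  finally show ?thesis by (simp only: \<tau>_def)
qed

end

text \<open>\<open>t\<close> stands for the ratio of the weight of colour \<open>1\<close> to the common weight of the other three
  colours, and \<open>ratio_map\<close> for the effect of one step of the message recursion on it.\<close>

definition ratio_map :: "nat \<Rightarrow> real \<Rightarrow> real \<Rightarrow> real" where
  "ratio_map d w t = ((3 + w * t) / (2 + w + t)) ^ d"

text \<open>For \<open>w < 1\<close> the map \<open>ratio_map d w\<close> is strictly decreasing on
  non-negative arguments, so 1 is its only fixed point there. A law with the same ratio at every
  level would be the constant one; hence the alternation with parity.\<close>

definition periodic_law :: "('v \<Rightarrow> nat) \<Rightarrow> (bool \<Rightarrow> real) \<Rightarrow> 'v \<Rightarrow> nat \<Rightarrow> real" where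
  "periodic_law lev t v a = (if a = 1 then t (even (lev v)) else 1)"

context rooted_regular_tree
begin

lemma message_step_periodic:
  assumes a: "a \<in> colours"
  shows "message_step w (periodic_law level t) v a
    = (if a = 1 then 3 + w * t (odd (level v)) else 2 + w + t (odd (level v))) ^ card (children v)"
proof -
  have "factor (1 - w) (periodic_law level t u) a
      = (if a = 1 then 3 + w * t (odd (level v)) else 2 + w + t (odd (level v)))"
    if "u \<in> children v" for u
  proof -
    have "level u = Suc (level v)" using that by (simp add: children_def sphere_def)
    then show ?thesis
      unfolding factor_def periodic_law_def set_colours by (simp add: algebra_simps)
  qed
  then show ?thesis by (simp add: message_step_eq[OF a])
qed

lemma boundary_law_periodic:
  assumes w: "0 \<le> w" and t: "\<And>e. 0 < t e" "\<And>e. t e = ratio_map d w (t (\<not> e))"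
  shows "boundary_law d V E r w (periodic_law level t)"
proof
  show "0 \<le> w" by (rule w)
  show "0 < periodic_law level t v a" for v a using t(1) by (simp add: periodic_law_def)
  fix v assume v: "v \<in> V" "v \<noteq> r"
  define t' where "t' = t (odd (level v))"
  have t': "0 < t'" "t (even (level v)) = ratio_map d w t'"
    using t(1) t(2)[of "even (level v)"] by (simp_all add: t'_def)
  have "\<forall>a\<in>colours. message_step w (periodic_law level t) v a = (2 + w + t') ^ d * periodic_law level t v a"
  proof
    fix a assume "a \<in> colours"
    from message_step_periodic[OF this, of w t v]
    show "message_step w (periodic_law level t) v a = (2 + w + t') ^ d * periodic_law level t v a"
      using t' w unfolding card_children[OF v] t'_def[symmetric]
      by (simp add: periodic_law_def ratio_map_def power_divide)
  qed
  moreover have "0 < (2 + w + t') ^ d" using w t' by simp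
  ultimately show "\<exists>c>0. \<forall>a\<in>colours. message_step w (periodic_law level t) v a = c * periodic_law level t v a"
    by blast
qed

lemma boundary_law_uniform: "0 \<le> w \<Longrightarrow> boundary_law d V E r w (periodic_law level (\<lambda>_. 1))"
  by (rule boundary_law_periodic) (auto simp: ratio_map_def)

end

lemma ratio_map_pos: "0 \<le> w \<Longrightarrow> 0 \<le> t \<Longrightarrow> 0 < ratio_map d w t"
  unfolding ratio_map_def by (intro zero_less_power divide_pos_pos) (auto intro: add_pos_nonneg)

text \<open>The second iterate \<open>f (f t)\<close> has derivative greater than 1 at its fixed
  point 1, so it lies below \<open>t\<close> just to the left of 1, whereas it is positive at 0. The
  intermediate value theorem gives a fixed point in between.\<close>

lemma ratio_map_two_cycle:
  assumes w: "0 \<le> w" "w < 1 - 4 / (real d + 1)"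
  obtains t where "0 < t" "t < 1" "ratio_map d w (ratio_map d w t) = t"
proof -
  define f where "f = ratio_map d w"
  define D where "D = - (real d * (1 - w) / (3 + w))"
  define G where "G t = f (f t) - t" for t
  have f1: "f 1 = 1" using w by (simp add: f_def ratio_map_def)
  have cont: "continuous_on {0..} f"
    unfolding f_def ratio_map_def using w by (intro continuous_intros) auto
  have pos: "0 < f t" if "0 \<le> t" for t using ratio_map_pos[OF w(1) that] by (simp add: f_def)
  have deriv: "(f has_real_derivative D) (at 1)"
  proof -
    have "((\<lambda>t. (3 + w * t) / (2 + w + t)) has_real_derivative
        (w * (2 + w + 1) - (3 + w * 1) * 1) / ((2 + w + 1) * (2 + w + 1))) (at 1)"
      using w by (auto intro!: derivative_eq_intros)
    from DERIV_power[OF this, of d]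
    have "((\<lambda>t. ((3 + w * t) / (2 + w + t)) ^ d) has_real_derivative
        real d * (((w * (2 + w + 1) - (3 + w * 1) * 1) / ((2 + w + 1) * (2 + w + 1))) * ((3 + w * 1) / (2 + w + 1)) ^ (d - 1))) (at 1)"
      by simp
    moreover have "real d * (((w * (2 + w + 1) - (3 + w * 1) * 1) / ((2 + w + 1) * (2 + w + 1))) * ((3 + w * 1) / (2 + w + 1)) ^ (d - 1)) = D"
    proof -
      have "(3 + w * 1) / (2 + w + 1) = 1" using w by simp
      moreover have "(w * (2 + w + 1) - (3 + w * 1) * 1) / ((2 + w + 1) * (2 + w + 1)) = - ((1 - w) / (3 + w))"
      proof -
        have "w * (2 + w + 1) - (3 + w * 1) * 1 = - (1 - w) * (3 + w)" by (simp add: algebra_simps)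
        moreover have "2 + w + 1 = 3 + w" by simp
        ultimately show ?thesis using w by (simp add: minus_divide_left)
      qed
      ultimately show ?thesis by (simp add: D_def)
    qed
    ultimately show ?thesis by (simp add: f_def ratio_map_def[abs_def])
  qed
  have "D < - 1"
  proof -
    have "w * (real d + 1) < (1 - 4 / (real d + 1)) * (real d + 1)" using w by (intro mult_strict_right_mono) auto
    also have "\<dots> = real d - 3" by (simp add: field_simps)
    finally have "3 + w < real d * (1 - w)" by (simp add: algebra_simps)
    then show ?thesis using w by (simp add: D_def pos_less_divide_eq)
  qed
  then have D2: "0 < D * D - 1"
    using mult_strict_mono'[of 1 "- D" 1 "- D"] by simp
  have "(f has_real_derivative D) (at (f 1))" using deriv f1 by simp
  from DERIV_chain2[OF this deriv] have "(G has_real_derivative D * D - 1) (at 1)"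
    unfolding G_def by (auto intro!: derivative_eq_intros)
  from DERIV_pos_inc_left[OF this D2] obtain e where e: "0 < e" "\<And>h. 0 < h \<Longrightarrow> h < e \<Longrightarrow> G (1 - h) < G 1"
    by blast
  define h where "h = min (e / 2) (1 / 2)"
  have h: "0 < h" "h < e" "h \<le> 1/2" using e by (auto simp: h_def)
  have neg: "G (1 - h) < 0" using e(2)[OF h(1,2)] f1 by (simp add: G_def)
  have G0: "0 < G 0" using pos[of 0] pos[of "f 0"] by (simp add: G_def)
  have "continuous_on {0..1 - h} (\<lambda>t. f (f t))"
  proof (rule continuous_on_compose2[OF cont])
    show "continuous_on {0..1 - h} f" using cont by (rule continuous_on_subset) auto
    show "f ` {0..1 - h} \<subseteq> {0..}" using pos by (auto simp: less_imp_le)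
  qed
  then have "continuous_on {0..1 - h} G" unfolding G_def by (intro continuous_intros)
  then obtain t where t: "0 \<le> t" "t \<le> 1 - h" "G t = 0"
    using IVT2'[of G "1 - h" 0 0] neg G0 h by auto
  have "t \<noteq> 0" using t G0 by auto
  then show thesis using that[of t] t h by (simp add: G_def f_def)
qed

context rooted_regular_tree
begin

lemma gibbs_measure_exists:
  assumes "0 \<le> w" shows "\<exists>\<mu>. potts_gibbs_measure 4 w V E \<mu>"
proof -
  interpret boundary_law d V E r w "periodic_law level (\<lambda>_. 1)"
    by (rule boundary_law_uniform[OF assms])
  show ?thesis using potts_gibbs_measure_gibbs by blast
qed

lemma gibbs_measure_not_unique:
  assumes w: "0 \<le> w" "w < 1 - 4 / (real d + 1)"
  shows "\<exists>\<mu> \<nu>. potts_gibbs_measure 4 w V E \<mu> \<and> potts_gibbs_measure 4 w V E \<nu> \<and> \<mu> \<noteq> \<nu>"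
proof -
  obtain t0 where t0: "0 < t0" "t0 < 1" "ratio_map d w (ratio_map d w t0) = t0"
    using ratio_map_two_cycle[OF w] .
  define t where "t e = (if e then ratio_map d w t0 else t0)" for e
  interpret U: boundary_law d V E r w "periodic_law level (\<lambda>_. 1)"
    by (rule boundary_law_uniform[OF w(1)])
  interpret T: boundary_law d V E r w "periodic_law level t"
    using t0 w ratio_map_pos[of w t0 d] by (intro boundary_law_periodic) (auto simp: t_def)
  have c: "1 \<in> colours" "2 \<in> colours" by auto
  \<comment> \<open>The measures are told apart at the root. Its marginal is uniform for the
    constant law, whereas under the alternating law colours 1 and 2 have odds
    \<open>3 + w * t0\<close> to \<open>2 + w + t0\<close>, raised to the power
    \<open>d + 1\<close>; these agree only if \<open>w = 1\<close> or \<open>t0 = 1\<close>.\<close>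
  have "U.gibbs \<noteq> T.gibbs"
  proof
    assume eq: "U.gibbs = T.gibbs"
    have "measure U.gibbs (cyl V {r} (\<lambda>x\<in>{r}. 1)) = measure U.gibbs (cyl V {r} (\<lambda>x\<in>{r}. 2))"
      unfolding U.root_marginal[OF c(1)] U.root_marginal[OF c(2)]
      unfolding message_step_periodic[OF c(1)] message_step_periodic[OF c(2)] by simp
    then have "message_step w (periodic_law level t) r 1 = message_step w (periodic_law level t) r 2"
      unfolding eq T.root_marginal[OF c(1)] T.root_marginal[OF c(2)]
      using T.partition_fn_pos[of 1] by simp
    then have "(3 + w * t0) ^ (d + 1) = (2 + w + t0) ^ (d + 1)"
      unfolding message_step_periodic[OF c(1)] message_step_periodic[OF c(2)] card_children_root
      by (simp add: t_def)
    then have "3 + w * t0 = 2 + w + t0"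
      using w t0 by (subst (asm) power_eq_iff_eq_base) auto
    then have "(1 - w) * (1 - t0) = 0" by (simp add: algebra_simps)
    moreover have "w < 1" using w(2) by (smt (verit) divide_nonneg_nonneg of_nat_0_le_iff)
    ultimately show False using t0 by simp
  qed
  then show ?thesis using U.potts_gibbs_measure_gibbs T.potts_gibbs_measure_gibbs by blast
qed

end

theorem mainTheorem1:
  fixes d :: nat and w :: real and V :: "'v set" and E :: "'v set set"
  assumes "d \<ge> 4" and "0 \<le> w" and "w < 1"
    and "infinite_regular_tree (d + 1) V E"
  shows "(\<exists>!\<mu>. potts_gibbs_measure 4 w V E \<mu>) \<longleftrightarrow> w \<ge> 1 - 4 / (real d + 1)"
proof -
  have "V \<noteq> {}" using assms(4) by (auto simp: infinite_regular_tree_def)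
  then obtain r where r: "r \<in> V" by blast
  interpret rooted_regular_tree d V E r
    using assms r by unfold_locales auto
  show ?thesis
  proof
    assume "\<exists>!\<mu>. potts_gibbs_measure 4 w V E \<mu>"
    then show "1 - 4 / (real d + 1) \<le> w"
      using gibbs_measure_not_unique[OF assms(2)] not_less by blast
  next
    assume "1 - 4 / (real d + 1) \<le> w"
    then show "\<exists>!\<mu>. potts_gibbs_measure 4 w V E \<mu>"
      using gibbs_measure_exists[OF assms(2)] gibbs_measure_unique[OF assms(1)] assms(3) by (metis less_imp_le)
  qed
qed

end
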